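(* Let $\mu>0$ and let $f:\mathbb R\to\mathbb R$ be continuous with $f(u)\ge0$ for $u\ge0$ and $f(u)=0$ for $u\le0$, such that there is $q\in(2,6)$ with $\lim_{u\to\infty}f(u)/u^{q-1}=0$, and $\lim_{u\to0}f(u)/u=0$. Then any minimising sequence for $E_\mu$ on $\mathcal M_{\mathrm{rad},\mu}$ is convergent. So $\mathfrak m_{\mathrm{rad},\mu}:=\inf_{\mathcal M_{\mathrm{rad},\mu}}E_\mu$ is achieved on a radial function $\mathfrak u$, and moreover $$\mathfrak m_{\mathrm{rad},\mu}=\mathfrak m_\mu=\min_{u\in\mathcal M_\mu}E_\mu(u)=E_\mu(\mathfrak u)>0,$$ where $\mathfrak m_\mu:=\inf_{\mathcal M_\mu}E_\mu$. Finally $\mathfrak u$ is negative (i.e. $\mathfrak u\le0$) and hence $E_\mu(\mathfrak u)=\frac12\|\mathfrak u\|_\mu^2$.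
   Context: $F(t)=\int_0^tf(s)\,ds$. $H^1_\mu(\mathbb R^3)$ is $H^1(\mathbb R^3)$ with norm $\|u\|_\mu^2=\int|\nabla u|^2+\mu\int u^2$; $H^1_{\mathrm{rad},\mu}(\mathbb R^3)$ is its subspace of radial functions. For $u\in H^1(\mathbb R^3)$, $\phi_u(x)=\int_{\mathbb R^3}\frac{1-e^{-|x-y|}}{|x-y|}u^2(y)\,dy$. $E_\mu(u)=\frac12\|u\|_\mu^2+\int F(u)$, $\mathcal M_\mu=\{u\in H^1_\mu(\mathbb R^3):\int\phi_uu^2=1\}$, $\mathcal M_{\mathrm{rad},\mu}=\mathcal M_\mu\cap H^1_{\mathrm{rad},\mu}(\mathbb R^3)$.
   Formalization: "Any minimising sequence is convergent" is proved as: it has a subsequence converging in H^1_μ to an element of M_rad,μ. Full convergence fails, e.g. for f=0 and the sequence (-1)^n u with u a minimiser. *)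

theory Defs
  imports "HOL-Analysis.Analysis"
begin

type_synonym R3 = "real ^ 3"

definition Fprim :: "(real \<Rightarrow> real) \<Rightarrow> real \<Rightarrow> real" where
  "Fprim f t = (LBINT s=0..t. f s)"

definition partial :: "3 \<Rightarrow> (R3 \<Rightarrow> real) \<Rightarrow> R3 \<Rightarrow> real" where
  "partial i \<phi> x = frechet_derivative \<phi> (at x) (axis i 1)"

fun Ck :: "nat \<Rightarrow> (R3 \<Rightarrow> real) \<Rightarrow> bool" where
  "Ck 0 \<phi> = continuous_on UNIV \<phi>"
| "Ck (Suc k) \<phi> = ((\<forall>x. \<phi> differentiable (at x)) \<and> (\<forall>i. Ck k (partial i \<phi>)))"

definition test_fun :: "(R3 \<Rightarrow> real) \<Rightarrow> bool" where
  "test_fun \<phi> \<longleftrightarrow> (\<forall>k. Ck k \<phi>) \<and> compact (closure {x. \<phi> x \<noteq> 0})"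

definition weak_grad :: "(R3 \<Rightarrow> real) \<Rightarrow> (R3 \<Rightarrow> R3) \<Rightarrow> bool" where
  "weak_grad u g \<longleftrightarrow> (\<forall>\<phi>. test_fun \<phi> \<longrightarrow> (\<forall>i.
      integral\<^sup>L lborel (\<lambda>x. u x * partial i \<phi> x) = - integral\<^sup>L lborel (\<lambda>x. g x $ i * \<phi> x)))"

definition L2grad :: "(R3 \<Rightarrow> R3) \<Rightarrow> bool" where
  "L2grad g \<longleftrightarrow> g \<in> borel_measurable lborel \<and> integrable lborel (\<lambda>x. (norm (g x))\<^sup>2)"

text \<open>Membership in H^1(R^3) (as functions; a.e.-equal functions represent the same element).\<close>
definition H1 :: "(R3 \<Rightarrow> real) \<Rightarrow> bool" where
  "H1 u \<longleftrightarrow> u \<in> borel_measurable lborel \<and> integrable lborel (\<lambda>x. (u x)\<^sup>2)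
             \<and> (\<exists>g. L2grad g \<and> weak_grad u g)"

definition grad :: "(R3 \<Rightarrow> real) \<Rightarrow> R3 \<Rightarrow> R3" where
  "grad u = (SOME g. L2grad g \<and> weak_grad u g)"

definition norm_sq_mu :: "real \<Rightarrow> (R3 \<Rightarrow> real) \<Rightarrow> real" where
  "norm_sq_mu \<mu> u = integral\<^sup>L lborel (\<lambda>x. (norm (grad u x))\<^sup>2) + \<mu> * integral\<^sup>L lborel (\<lambda>x. (u x)\<^sup>2)"

definition norm_mu :: "real \<Rightarrow> (R3 \<Rightarrow> real) \<Rightarrow> real" where
  "norm_mu \<mu> u = sqrt (norm_sq_mu \<mu> u)"

definition radial :: "(R3 \<Rightarrow> real) \<Rightarrow> bool" where
  "radial u \<longleftrightarrow> (\<forall>R. orthogonal_transformation R \<longrightarrow> (AE x in lborel. u (R x) = u x))"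

definition phi :: "(R3 \<Rightarrow> real) \<Rightarrow> R3 \<Rightarrow> real" where
  "phi u x = integral\<^sup>L lborel (\<lambda>y. (1 - exp (- dist x y)) / dist x y * (u y)\<^sup>2)"

definition Emu :: "real \<Rightarrow> (real \<Rightarrow> real) \<Rightarrow> (R3 \<Rightarrow> real) \<Rightarrow> real" where
  "Emu \<mu> f u = norm_sq_mu \<mu> u / 2 + integral\<^sup>L lborel (\<lambda>x. Fprim f (u x))"

text \<open>H^1 is the same set for every \<mu> > 0; only the norm depends on \<mu>.\<close>
definition Mmu :: "real \<Rightarrow> (R3 \<Rightarrow> real) set" where
  "Mmu \<mu> = {u. H1 u \<and> integral\<^sup>L lborel (\<lambda>x. phi u x * (u x)\<^sup>2) = 1}"

definition Mrad :: "real \<Rightarrow> (R3 \<Rightarrow> real) set" where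
  "Mrad \<mu> = {u \<in> Mmu \<mu>. radial u}"

end

theory Submission
  imports Defs "HOL-Complex_Analysis.Great_Picard"
begin

text \<open>
  Since \<open>F \<ge> 0\<close> vanishes on the negative half-line and the constraint only sees \<open>u\<^sup>2\<close>, replacing
  \<open>u\<close> by \<open>- \<bar>u\<bar>\<close> reduces everything to minimizing the squared norm on the constraint; the growth of
  \<open>f\<close> plays no role. The kernel is bounded by \<open>1\<close>, so the nonlocal energy is continuous on \<open>L\<^sup>2\<close>.

  Membership in \<open>H\<^sup>1\<close>, and the Dirichlet integral, are recovered from the mean square oscillation
  of \<open>u\<close> over pairs of points at distance less than \<open>\<epsilon>\<close>, normalized by the second moment of the
  \<open>\<epsilon>\<close>-ball: it is at most the Dirichlet integral, and a uniform bound on it yields a weak gradient with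
  the same bound. The oscillation visibly decreases under \<open>u \<mapsto> \<bar>u\<bar>\<close> and under polarization, and
  it controls the distance of \<open>u\<close> to its averages over small cubes, which gives local compactness.

  Polarization also increases the nonlocal energy, because the kernel is decreasing. Maximizing
  \<open>\<integral> v\<^sup>2 / (1 + \<bar>x\<bar>)\<close> over a compact class containing all iterated polarizations of \<open>u\<close> produces a
  function fixed by all polarizations with respect to half-spaces around the origin, hence radial;
  so the radial infimum is the global one.

  For radial functions the energy has uniformly small tails, so along a radial minimizing sequence
  that converges in \<open>L\<^sup>2\<close> locally the energy of the midpoints tends to \<open>1\<close>. By scaling, the
  midpoints then asymptotically have at least the minimal norm, and the parallelogram law makes the
  sequence Cauchy in \<open>H\<^sup>1\<close>.
\<close>

subsection \<open>Square-integrable functions\<close>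

text \<open>The constraint is quartic and the kernel decays only like 1/r, so local L2 convergence
  alone does not pass to it, and mass may escape to infinity along the sequence. Radial tails settle
  the energy but not the L2 norm; convergence of the norm comes only from strict convexity. The
  midpoints leave the constraint set, which is why the lower bound is needed in homogeneous form:
  \<open>energy\<close> has degree 4 and the squared norm degree 2, so a bound d on the constraint
  set becomes d * sqrt (energy) for every radial function of positive energy.

  The second moment is the right normalization because the integral of (h . a)^2 over a ball is that
  moment times |a|^2. Passing from a weak gradient to oscillation bounds and back then loses no
  constant, so comparing oscillations compares Dirichlet integrals.

  Polarization is restricted to half-spaces with the origin in their interior (t > 0): reflection
  then pushes their points outward, so no ball loses mass and the competitors stay tight. The case t
  = 0, which carries the symmetry, is reached by letting t tend to 0, with the gradient bound
  controlling the error.\<close>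

definition sq_int :: "'a measure \<Rightarrow> ('a \<Rightarrow> 'b::euclidean_space) \<Rightarrow> bool" where
  "sq_int M f \<longleftrightarrow> f \<in> borel_measurable M \<and> integrable M (\<lambda>x. (norm (f x))\<^sup>2)"

text \<open>The squared norm is kept instead of the norm, so the triangle inequality appears with a
  factor 2 (\<open>nsq_triangle\<close>), which is enough for every limit below. Where the integrand
  is not integrable the Bochner integral returns 0, hence the companion predicate
  \<open>sq_int\<close>.\<close>

definition nsq :: "'a measure \<Rightarrow> ('a \<Rightarrow> 'b::euclidean_space) \<Rightarrow> real" where
  "nsq M f = (\<integral>x. (norm (f x))\<^sup>2 \<partial>M)"

lemma sq_intD [dest]:
  assumes "sq_int M f"
  shows sq_int_measurable: "f \<in> borel_measurable M"
    and sq_int_integrable: "integrable M (\<lambda>x. (norm (f x))\<^sup>2)"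
  using assms by (auto simp: sq_int_def)

lemma sq_int_real_iff:
  fixes f :: "'a \<Rightarrow> real"
  shows "sq_int M f \<longleftrightarrow> f \<in> borel_measurable M \<and> integrable M (\<lambda>x. (f x)\<^sup>2)"
  by (simp add: sq_int_def)

lemma nsq_real:
  fixes f :: "'a \<Rightarrow> real"
  shows "nsq M f = (\<integral>x. (f x)\<^sup>2 \<partial>M)"
  by (simp add: nsq_def)

lemma nsq_nonneg [simp]: "0 \<le> nsq M f"
  by (simp add: nsq_def)

lemma norm_add_sq_le:
  fixes a b :: "'b::real_inner"
  shows "(norm (a + b))\<^sup>2 \<le> 2 * (norm a)\<^sup>2 + 2 * (norm b)\<^sup>2"
proof -
  have "0 \<le> (norm (a - b))\<^sup>2" by simp
  then show ?thesis
    by (simp add: power2_norm_eq_inner inner_add inner_diff inner_commute algebra_simps)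
qed

lemma sq_int_add:
  assumes "sq_int M f" "sq_int M g"
  shows "sq_int M (\<lambda>x. f x + g x)"
proof -
  have [measurable]: "f \<in> borel_measurable M" "g \<in> borel_measurable M"
    using assms by auto
  have "integrable M (\<lambda>x. 2 * (norm (f x))\<^sup>2 + 2 * (norm (g x))\<^sup>2)"
    using assms by (intro Bochner_Integration.integrable_add integrable_mult_right) auto
  then have "integrable M (\<lambda>x. (norm (f x + g x))\<^sup>2)"
    by (rule Bochner_Integration.integrable_bound) (auto simp: norm_add_sq_le)
  then show ?thesis by (simp add: sq_int_def)
qed

lemma sq_int_scaleR:
  assumes "sq_int M f"
  shows "sq_int M (\<lambda>x. c *\<^sub>R f x)"
  using assms by (auto simp: sq_int_def power_mult_distrib)

lemma sq_int_cmult: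
  fixes f :: "'a \<Rightarrow> real"
  assumes "sq_int M f"
  shows "sq_int M (\<lambda>x. c * f x)"
  using sq_int_scaleR[OF assms, of c] by simp

lemma sq_int_minus:
  assumes "sq_int M f"
  shows "sq_int M (\<lambda>x. - f x)"
  using sq_int_scaleR[OF assms, of "-1"] by simp

lemma sq_int_diff:
  assumes "sq_int M f" "sq_int M g"
  shows "sq_int M (\<lambda>x. f x - g x)"
  using sq_int_add[OF assms(1) sq_int_minus[OF assms(2)]] by simp

lemma sq_int_bound:
  assumes "sq_int M f" and [measurable]: "g \<in> borel_measurable M"
    and "\<And>x. norm (g x) \<le> norm (f x)"
  shows "sq_int M g" "nsq M g \<le> nsq M f"
proof -
  have le: "(norm (g x))\<^sup>2 \<le> (norm (f x))\<^sup>2" for x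
    using assms(3)[of x] by (simp add: power_mono)
  have "integrable M (\<lambda>x. (norm (g x))\<^sup>2)"
    using assms(1) le by (intro Bochner_Integration.integrable_bound[OF sq_int_integrable[OF assms(1)]]) auto
  then show "sq_int M g" by (simp add: sq_int_def)
  then show "nsq M g \<le> nsq M f"
    unfolding nsq_def using assms(1) le by (intro integral_mono) auto
qed

lemma nsq_scaleR: "nsq M (\<lambda>x. c *\<^sub>R f x) = c\<^sup>2 * nsq M f"
  by (simp add: nsq_def power_mult_distrib)

lemma nsq_cmult:
  fixes f :: "'a \<Rightarrow> real"
  shows "nsq M (\<lambda>x. c * f x) = c\<^sup>2 * nsq M f"
  using nsq_scaleR[of M c f] by simp

lemma nsq_diff_commute: "nsq M (\<lambda>x. f x - g x) = nsq M (\<lambda>x. g x - f x)"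
  by (simp add: nsq_def norm_minus_commute)

lemma nsq_add_le:
  assumes "sq_int M f" "sq_int M g"
  shows "nsq M (\<lambda>x. f x + g x) \<le> 2 * nsq M f + 2 * nsq M g"
proof -
  have "nsq M (\<lambda>x. f x + g x) \<le> (\<integral>x. 2 * (norm (f x))\<^sup>2 + 2 * (norm (g x))\<^sup>2 \<partial>M)"
    unfolding nsq_def
    using sq_int_integrable[OF sq_int_add[OF assms]] assms
    by (intro integral_mono Bochner_Integration.integrable_add integrable_mult_right)
       (auto simp: norm_add_sq_le)
  also have "\<dots> = 2 * nsq M f + 2 * nsq M g"
    using assms by (simp add: nsq_def sq_int_integrable)
  finally show ?thesis .
qed

lemma nsq_diff_le:
  assumes "sq_int M f" "sq_int M g"
  shows "nsq M (\<lambda>x. f x - g x) \<le> 2 * nsq M f + 2 * nsq M g"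
  using nsq_add_le[OF assms(1) sq_int_minus[OF assms(2)]] by (simp add: nsq_def)

lemma nsq_triangle:
  assumes "sq_int M f" "sq_int M g" "sq_int M h"
  shows "nsq M (\<lambda>x. f x - h x) \<le> 2 * nsq M (\<lambda>x. f x - g x) + 2 * nsq M (\<lambda>x. g x - h x)"
  using nsq_add_le[OF sq_int_diff[OF assms(1,2)] sq_int_diff[OF assms(2,3)]] by simp

lemma nsq_parallelogram:
  assumes "sq_int M f" "sq_int M g"
  shows "nsq M (\<lambda>x. f x + g x) + nsq M (\<lambda>x. f x - g x) = 2 * nsq M f + 2 * nsq M g"
proof -
  have "nsq M (\<lambda>x. f x + g x) + nsq M (\<lambda>x. f x - g x)
      = (\<integral>x. (norm (f x + g x))\<^sup>2 + (norm (f x - g x))\<^sup>2 \<partial>M)"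
    unfolding nsq_def using sq_int_add[OF assms] sq_int_diff[OF assms]
    by (subst Bochner_Integration.integral_add) auto
  also have "\<dots> = (\<integral>x. 2 * (norm (f x))\<^sup>2 + 2 * (norm (g x))\<^sup>2 \<partial>M)"
    by (intro Bochner_Integration.integral_cong refl)
       (simp add: power2_norm_eq_inner inner_add inner_diff inner_commute algebra_simps)
  also have "\<dots> = 2 * nsq M f + 2 * nsq M g"
    using assms by (simp add: nsq_def sq_int_integrable)
  finally show ?thesis .
qed

lemma abs_inner_le_sq:
  fixes a b :: "'b::real_inner"
  shows "\<bar>a \<bullet> b\<bar> \<le> (norm a)\<^sup>2 + (norm b)\<^sup>2"
proof -
  have "\<bar>a \<bullet> b\<bar> \<le> norm a * norm b" by (rule Cauchy_Schwarz_ineq2)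
  also have "\<dots> \<le> (norm a)\<^sup>2 + (norm b)\<^sup>2"
    using sum_squares_bound[of "norm a" "norm b"] mult_nonneg_nonneg[OF norm_ge_zero[of a] norm_ge_zero[of b]]
    by linarith
  finally show ?thesis .
qed

lemma sq_int_inner_integrable:
  assumes "sq_int M f" "sq_int M g"
  shows "integrable M (\<lambda>x. f x \<bullet> g x)"
proof -
  have [measurable]: "f \<in> borel_measurable M" "g \<in> borel_measurable M"
    using assms by auto
  have "integrable M (\<lambda>x. (norm (f x))\<^sup>2 + (norm (g x))\<^sup>2)"
    using assms by auto
  then show ?thesis
    by (rule Bochner_Integration.integrable_bound) (auto simp: abs_inner_le_sq)
qed

lemma sq_int_mult_integrable:
  fixes f g :: "'a \<Rightarrow> real"
  assumes "sq_int M f" "sq_int M g"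
  shows "integrable M (\<lambda>x. f x * g x)"
  using sq_int_inner_integrable[OF assms] by simp

lemma nsq_add_expand:
  assumes "sq_int M f" "sq_int M g"
  shows "nsq M (\<lambda>x. f x + t *\<^sub>R g x) = nsq M f + 2 * t * (\<integral>x. f x \<bullet> g x \<partial>M) + t\<^sup>2 * nsq M g"
proof -
  have "nsq M (\<lambda>x. f x + t *\<^sub>R g x)
      = (\<integral>x. ((norm (f x))\<^sup>2 + (2 * t) * (f x \<bullet> g x)) + t\<^sup>2 * (norm (g x))\<^sup>2 \<partial>M)"
    unfolding nsq_def
    by (intro Bochner_Integration.integral_cong refl)
       (simp add: power2_norm_eq_inner inner_add_left inner_add_right inner_commute algebra_simps power2_eq_square[of t])
  also have "\<dots> = nsq M f + 2 * t * (\<integral>x. f x \<bullet> g x \<partial>M) + t\<^sup>2 * nsq M g"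
    using assms sq_int_inner_integrable[OF assms] by (simp add: nsq_def sq_int_integrable)
  finally show ?thesis .
qed

text \<open>The quadratic polynomial in t given by \<open>nsq_add_expand\<close> is nonnegative, so
  its discriminant is not positive; the degenerate case of a null second factor is separate.\<close>

lemma nsq_Cauchy_Schwarz:
  assumes "sq_int M f" "sq_int M g"
  shows "\<bar>\<integral>x. f x \<bullet> g x \<partial>M\<bar> \<le> sqrt (nsq M f) * sqrt (nsq M g)"
proof -
  define a b c where "a = nsq M f" and "b = nsq M g" and "c = (\<integral>x. f x \<bullet> g x \<partial>M)"
  have q: "0 \<le> a + 2 * t * c + t\<^sup>2 * b" for t
    using nsq_add_expand[OF assms, of t] nsq_nonneg[of M "\<lambda>x. f x + t *\<^sub>R g x"]
    by (simp add: a_def b_def c_def)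
  have ab: "0 \<le> a" "0 \<le> b" by (auto simp: a_def b_def)
  have "c\<^sup>2 \<le> a * b"
  proof (cases "b = 0")
    case True
    have "c = 0"
    proof (rule ccontr)
      assume "c \<noteq> 0"
      \<comment> \<open>With \<open>b = 0\<close> the polynomial is linear in t, and this t gives it
        the value -1.\<close>
      then show False using q[of "- (a + 1) / (2 * c)"] True by (simp add: field_simps)
    qed
    then show ?thesis by (simp add: True)
  next
    case False
    then have "0 < b" using ab by simp
    have "0 \<le> a + 2 * (- c / b) * c + (- c / b)\<^sup>2 * b" by (rule q)
    also have "\<dots> = a - c\<^sup>2 / b"
      using \<open>0 < b\<close> by (simp add: field_simps power2_eq_square)
    finally show ?thesis using \<open>0 < b\<close> by (simp add: field_simps)
  qed
  then have "\<bar>c\<bar> \<le> sqrt (a * b)" by (metis real_sqrt_abs real_sqrt_le_mono)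
  then show ?thesis by (simp add: a_def b_def c_def real_sqrt_mult)
qed

lemma nsq_Cauchy_Schwarz_real:
  fixes f g :: "'a \<Rightarrow> real"
  assumes "sq_int M f" "sq_int M g"
  shows "(\<integral>x. f x * g x \<partial>M)\<^sup>2 \<le> nsq M f * nsq M g"
proof -
  have "\<bar>\<integral>x. f x * g x \<partial>M\<bar> \<le> sqrt (nsq M f * nsq M g)"
    using nsq_Cauchy_Schwarz[OF assms] by (simp add: real_sqrt_mult)
  then have "\<bar>\<integral>x. f x * g x \<partial>M\<bar>\<^sup>2 \<le> (sqrt (nsq M f * nsq M g))\<^sup>2"
    by (rule power_mono) simp
  then show ?thesis by simp
qed

text \<open>|f|^2 - |g|^2 = (f - g) . (f + g), followed by Cauchy-Schwarz. This is the quantitative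
  continuity behind \<open>nsq_tendsto\<close> and \<open>energy_diff\<close>.\<close>

lemma nsq_abs_diff_le:
  assumes "sq_int M f" "sq_int M g"
  shows "\<bar>nsq M f - nsq M g\<bar>
    \<le> sqrt (nsq M (\<lambda>x. f x - g x)) * sqrt (2 * nsq M f + 2 * nsq M g)"
proof -
  have "nsq M f - nsq M g = (\<integral>x. (f x - g x) \<bullet> (f x + g x) \<partial>M)"
    unfolding nsq_def using assms
    by (subst Bochner_Integration.integral_diff[symmetric])
       (auto simp: power2_norm_eq_inner inner_add inner_diff inner_commute algebra_simps
             intro!: Bochner_Integration.integral_cong)
  then have "\<bar>nsq M f - nsq M g\<bar>
      \<le> sqrt (nsq M (\<lambda>x. f x - g x)) * sqrt (nsq M (\<lambda>x. f x + g x))"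
    using nsq_Cauchy_Schwarz[OF sq_int_diff[OF assms] sq_int_add[OF assms]] by simp
  also have "\<dots> \<le> sqrt (nsq M (\<lambda>x. f x - g x)) * sqrt (2 * nsq M f + 2 * nsq M g)"
    using nsq_add_le[OF assms] by (intro mult_left_mono) auto
  finally show ?thesis .
qed

lemma nsq_eq_0_AE:
  assumes "sq_int M f" "nsq M f = 0"
  shows "AE x in M. f x = 0"
  using assms(2) integral_nonneg_eq_0_iff_AE[OF sq_int_integrable[OF assms(1)]]
  by (simp add: nsq_def)

lemma nsq_tendsto:
  assumes "\<And>n. sq_int M (f n)" "sq_int M F" "(\<lambda>n. nsq M (\<lambda>x. f n x - F x)) \<longlonglongrightarrow> 0"
  shows "(\<lambda>n. nsq M (f n)) \<longlonglongrightarrow> nsq M F"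
proof -
  define d where "d n = nsq M (\<lambda>x. f n x - F x)" for n
  have bound: "norm (nsq M (f n) - nsq M F) \<le> sqrt (d n) * sqrt (4 * d n + 6 * nsq M F)" for n
  proof -
    have "nsq M (f n) \<le> 2 * d n + 2 * nsq M F"
      using nsq_add_le[OF sq_int_diff[OF assms(1)[of n] assms(2)] assms(2)] by (simp add: d_def)
    then have "sqrt (d n) * sqrt (2 * nsq M (f n) + 2 * nsq M F)
        \<le> sqrt (d n) * sqrt (4 * d n + 6 * nsq M F)"
      by (intro mult_left_mono) (auto simp: d_def)
    then show ?thesis using nsq_abs_diff_le[OF assms(1)[of n] assms(2)] by (simp add: d_def)
  qed
  have "(\<lambda>n. sqrt (d n) * sqrt (4 * d n + 6 * nsq M F)) \<longlonglongrightarrow> sqrt 0 * sqrt (4 * 0 + 6 * nsq M F)"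
    using assms(3) unfolding d_def by (intro tendsto_intros)
  then have "(\<lambda>n. nsq M (f n) - nsq M F) \<longlonglongrightarrow> 0"
    by (intro Lim_null_comparison[OF always_eventually[OF allI[OF bound]]]) simp
  then show ?thesis by (simp add: LIM_zero_iff)
qed

lemma inner_integral_tendsto:
  assumes "\<And>n. sq_int M (f n)" "sq_int M F" "(\<lambda>n. nsq M (\<lambda>x. f n x - F x)) \<longlonglongrightarrow> 0" "sq_int M g"
  shows "(\<lambda>n. \<integral>x. f n x \<bullet> g x \<partial>M) \<longlonglongrightarrow> (\<integral>x. F x \<bullet> g x \<partial>M)"
proof -
  have bound: "norm ((\<integral>x. f n x \<bullet> g x \<partial>M) - (\<integral>x. F x \<bullet> g x \<partial>M))
      \<le> sqrt (nsq M (\<lambda>x. f n x - F x)) * sqrt (nsq M g)" for n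
    using nsq_Cauchy_Schwarz[OF sq_int_diff[OF assms(1)[of n] assms(2)] assms(4)]
      sq_int_inner_integrable[OF assms(1)[of n] assms(4)] sq_int_inner_integrable[OF assms(2,4)]
    by (simp add: inner_diff_left)
  have "(\<lambda>n. sqrt (nsq M (\<lambda>x. f n x - F x)) * sqrt (nsq M g)) \<longlonglongrightarrow> sqrt 0 * sqrt (nsq M g)"
    using assms(3) by (intro tendsto_intros)
  then have "(\<lambda>n. (\<integral>x. f n x \<bullet> g x \<partial>M) - (\<integral>x. F x \<bullet> g x \<partial>M)) \<longlonglongrightarrow> 0"
    by (intro Lim_null_comparison[OF always_eventually[OF allI[OF bound]]]) simp
  then show ?thesis by (simp add: LIM_zero_iff)
qed

section \<open>Completeness and weak limits of square-integrable functions\<close>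

definition L2_Cauchy :: "'a measure \<Rightarrow> (nat \<Rightarrow> 'a \<Rightarrow> 'b::euclidean_space) \<Rightarrow> bool" where
  "L2_Cauchy M f \<longleftrightarrow> (\<forall>e>0. \<exists>N. \<forall>n\<ge>N. \<forall>m\<ge>N. nsq M (\<lambda>x. f n x - f m x) < e)"

text \<open>Riesz-Fischer: a subsequence with squared increments below 4^-k converges almost
  everywhere, and Fatou along it turns the Cauchy bound for f n - f m into the same bound for f n -
  F.\<close>

lemma L2_complete:
  assumes sq: "\<And>n. sq_int M (f n)" and cau: "L2_Cauchy M f"
  obtains F where "sq_int M F" "(\<lambda>n. nsq M (\<lambda>x. f n x - F x)) \<longlonglongrightarrow> 0"
proof -
  have [measurable]: "f n \<in> borel_measurable M" for n using sq_int_measurable[OF sq] .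
  have "\<exists>N. \<forall>n\<ge>N. \<forall>m\<ge>N. nsq M (\<lambda>x. f n x - f m x) < (1/4) ^ k" for k :: nat
    using cau unfolding L2_Cauchy_def by simp
  then obtain N where N: "\<And>k n m. n \<ge> N k \<Longrightarrow> m \<ge> N k \<Longrightarrow> nsq M (\<lambda>x. f n x - f m x) < (1/4) ^ k"
    by metis
  \<comment> \<open>Summing all thresholds up to k makes \<open>r\<close> nondecreasing, at least
    \<open>N k\<close> and at least k.\<close>
  define r where "r k = k + (\<Sum>j\<le>k. N j)" for k
  have "N k \<le> (\<Sum>j\<le>k. N j)" for k
    by (rule member_le_sum) auto
  then have r: "N k \<le> r k" "r k \<le> r (Suc k)" "k \<le> r k" for k
    unfolding r_def by (simp_all add: trans_le_add2)
  define d where "d k x = norm (f (r (Suc k)) x - f (r k) x)" for k x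
  have [measurable]: "d k \<in> borel_measurable M" for k unfolding d_def by measurable
  have dint: "(\<integral>\<^sup>+x. ennreal ((d k x)\<^sup>2) \<partial>M) \<le> ennreal ((1/4)^k)" for k
  proof -
    have "(\<integral>\<^sup>+x. ennreal ((d k x)\<^sup>2) \<partial>M) = ennreal (nsq M (\<lambda>x. f (r (Suc k)) x - f (r k) x))"
      unfolding nsq_def d_def
      by (rule nn_integral_eq_integral) (use sq_int_diff[OF sq sq] in auto)
    also have "\<dots> \<le> ennreal ((1/4)^k)"
      using N[of k "r (Suc k)" "r k"] r(1)[of k] r(2)[of k] by (intro ennreal_leI) auto
    finally show ?thesis .
  qed
  have "(\<integral>\<^sup>+x. (\<Sum>k. ennreal (2^k * (d k x)\<^sup>2)) \<partial>M) = (\<Sum>k. \<integral>\<^sup>+x. ennreal (2^k * (d k x)\<^sup>2) \<partial>M)"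
    by (rule nn_integral_suminf) measurable
  also have "\<dots> \<le> (\<Sum>k. ennreal ((1/2)^k))"
  proof (rule suminf_le)
    fix k :: nat
    have "(\<integral>\<^sup>+x. ennreal (2^k * (d k x)\<^sup>2) \<partial>M) = ennreal (2^k) * (\<integral>\<^sup>+x. ennreal ((d k x)\<^sup>2) \<partial>M)"
      by (subst nn_integral_cmult[symmetric]) (auto simp: ennreal_mult)
    also have "\<dots> \<le> ennreal (2^k) * ennreal ((1/4)^k)"
      by (intro mult_left_mono dint) auto
    also have "\<dots> = ennreal ((1/2)^k)"
      by (subst ennreal_mult[symmetric]) (auto simp: power_mult_distrib[symmetric])
    finally show "(\<integral>\<^sup>+x. ennreal (2^k * (d k x)\<^sup>2) \<partial>M) \<le> ennreal ((1/2)^k)" .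
  qed auto
  also have "\<dots> = ennreal (\<Sum>k. (1/2::real)^k)"
    by (intro suminf_ennreal2) (auto simp: summable_geometric)
  also have "\<dots> < \<infinity>" by simp
  finally have "(\<integral>\<^sup>+x. (\<Sum>k. ennreal (2^k * (d k x)\<^sup>2)) \<partial>M) \<noteq> \<infinity>" by simp
  then have "AE x in M. (\<Sum>k. ennreal (2^k * (d k x)\<^sup>2)) \<noteq> \<infinity>"
    by (intro nn_integral_PInf_AE) auto
  \<comment> \<open>The weight 2^k bridges the gap between summing squares and summing increments:
    finiteness gives d_k^2 <= B 2^-k, so the increments are dominated by a geometric series of ratio
    sqrt (1/2).\<close>
  then have conv: "AE x in M. convergent (\<lambda>k. f (r k) x)"
  proof eventually_elim
    case (elim x)
    have "summable (\<lambda>k. 2^k * (d k x)\<^sup>2)"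
      using elim by (intro summable_suminf_not_top) auto
    then have "(\<lambda>k. 2^k * (d k x)\<^sup>2) \<longlonglongrightarrow> 0" by (rule summable_LIMSEQ_zero)
    then have "Bseq (\<lambda>k. 2^k * (d k x)\<^sup>2)" by (rule convergent_imp_Bseq[OF convergentI])
    then obtain B where B: "0 < B" "\<And>k. norm (2^k * (d k x)\<^sup>2) \<le> B" by (auto elim: BseqE)
    have "summable (\<lambda>k. d k x)"
    proof (rule summable_comparison_test')
      show "summable (\<lambda>k. sqrt B * (sqrt (1/2)) ^ k)"
        by (intro summable_mult summable_geometric) (auto simp: real_sqrt_lt_1_iff)
      fix k :: nat
      have "(d k x)\<^sup>2 \<le> B * (1/2)^k" using B(2)[of k] by (simp add: field_simps)
      also have "\<dots> = (sqrt B)\<^sup>2 * ((sqrt (1/2))\<^sup>2) ^ k"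
        using B(1) by simp
      also have "((sqrt (1/2))\<^sup>2) ^ k = ((sqrt (1/2)) ^ k)\<^sup>2"
        by (simp only: power2_eq_square power_mult_distrib)
      finally have "(d k x)\<^sup>2 \<le> (sqrt B * sqrt (1/2) ^ k)\<^sup>2"
        by (simp only: power_mult_distrib)
      then show "norm (d k x) \<le> sqrt B * (sqrt (1/2)) ^ k"
        using B(1) abs_le_square_iff[of "d k x" "sqrt B * sqrt (1/2) ^ k"] by (simp add: abs_mult)
    qed
    then have "summable (\<lambda>k. f (r (Suc k)) x - f (r k) x)"
      unfolding d_def by (rule summable_norm_cancel)
    then have "convergent (\<lambda>n. \<Sum>k<n. f (r (Suc k)) x - f (r k) x)"
      by (simp add: summable_iff_convergent)
    then have "convergent (\<lambda>n. f (r n) x - f (r 0) x)"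
      using sum_lessThan_telescope[of "\<lambda>k. f (r k) x"] by simp
    then have "convergent (\<lambda>n. (f (r n) x - f (r 0) x) + f (r 0) x)"
      by (rule convergent_add) (rule convergent_const)
    then show ?case by simp
  qed
  define F where "F x = lim (\<lambda>k. f (r k) x)" for x
  have [measurable]: "F \<in> borel_measurable M" unfolding F_def by measurable
  have fatou: "(\<integral>\<^sup>+x. ennreal ((norm (f n x - F x))\<^sup>2) \<partial>M) \<le> ennreal e"
    if e: "\<And>m. m \<ge> k \<Longrightarrow> nsq M (\<lambda>x. f n x - f m x) \<le> e" for n k e
  proof -
    have "(\<integral>\<^sup>+x. ennreal ((norm (f n x - F x))\<^sup>2) \<partial>M)
       = (\<integral>\<^sup>+x. liminf (\<lambda>j. ennreal ((norm (f n x - f (r j) x))\<^sup>2)) \<partial>M)"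
    proof (intro nn_integral_cong_AE)
      show "AE x in M. ennreal ((norm (f n x - F x))\<^sup>2)
          = liminf (\<lambda>j. ennreal ((norm (f n x - f (r j) x))\<^sup>2))"
        using conv
      proof eventually_elim
        case (elim x)
        then have "(\<lambda>j. f (r j) x) \<longlonglongrightarrow> F x"
          unfolding F_def by (simp add: convergent_LIMSEQ_iff)
        then have "(\<lambda>j. ennreal ((norm (f n x - f (r j) x))\<^sup>2)) \<longlonglongrightarrow> ennreal ((norm (f n x - F x))\<^sup>2)"
          by (intro tendsto_ennrealI tendsto_intros)
        then show ?case by (intro lim_imp_Liminf[symmetric]) auto
      qed
    qed
    also have "\<dots> \<le> liminf (\<lambda>j. \<integral>\<^sup>+x. ennreal ((norm (f n x - f (r j) x))\<^sup>2) \<partial>M)"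
      by (rule nn_integral_liminf) measurable
    also have "\<dots> = liminf (\<lambda>j. ennreal (nsq M (\<lambda>x. f n x - f (r j) x)))"
      unfolding nsq_def
      by (intro arg_cong[where f=liminf] ext nn_integral_eq_integral) (use sq_int_diff[OF sq sq] in auto)
    also have "\<dots> \<le> ennreal e"
    proof -
      have "liminf (\<lambda>j. ennreal (nsq M (\<lambda>x. f n x - f (r j) x))) \<le> liminf (\<lambda>j. ennreal e)"
        using r(3) by (intro Liminf_mono eventually_sequentiallyI[of k] ennreal_leI e) (rule order_trans)
      then show ?thesis by (simp add: Liminf_const)
    qed
    finally show ?thesis .
  qed
  have small: "sq_int M (\<lambda>x. f n x - F x) \<and> nsq M (\<lambda>x. f n x - F x) \<le> e"
    if e: "\<And>m. m \<ge> k \<Longrightarrow> nsq M (\<lambda>x. f n x - f m x) \<le> e" for n k e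
  proof -
    have "0 \<le> e" by (rule order_trans[OF nsq_nonneg e[OF order_refl]])
    have int: "integrable M (\<lambda>x. (norm (f n x - F x))\<^sup>2)"
      using le_less_trans[OF fatou[OF e] ennreal_less_top] by (intro integrableI_bounded) auto
    then have "ennreal (nsq M (\<lambda>x. f n x - F x)) \<le> ennreal e"
      unfolding nsq_def using fatou[OF e] by (subst nn_integral_eq_integral[symmetric]) auto
    with int \<open>0 \<le> e\<close> show ?thesis by (simp add: sq_int_def)
  qed
  have "sq_int M (\<lambda>x. f (N 0) x - F x)"
    using small[of "N 0" "N 0" 1] N[of 0 "N 0"] by (simp add: less_imp_le)
  then have F: "sq_int M F"
    using sq_int_diff[OF sq[of "N 0"], of "\<lambda>x. f (N 0) x - F x"] by simp
  have "(\<lambda>n. nsq M (\<lambda>x. f n x - F x)) \<longlonglongrightarrow> 0"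
  proof (rule LIMSEQ_I)
    fix e :: real assume "0 < e"
    then obtain K where K: "\<And>n m. n \<ge> K \<Longrightarrow> m \<ge> K \<Longrightarrow> nsq M (\<lambda>x. f n x - f m x) < e / 2"
      using cau unfolding L2_Cauchy_def by (meson half_gt_zero)
    have "nsq M (\<lambda>x. f n x - F x) \<le> e / 2" if "n \<ge> K" for n
      using small[of K n "e/2"] K[OF that] by (simp add: less_imp_le)
    then show "\<exists>K. \<forall>n\<ge>K. norm (nsq M (\<lambda>x. f n x - F x) - 0) < e"
      using \<open>0 < e\<close> by (intro exI[of _ K] allI impI) (simp add: order.strict_trans1[of _ "e/2"])
  qed
  with F show thesis by (rule that)
qed

text \<open>By the parallelogram law |f n - f m|^2 = 2 |f n|^2 + 2 |f m|^2 - 4 |midpoint|^2, so it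
  suffices that midpoints are asymptotically not shorter than the limit. Applied both to almost
  shortest elements of convex sets and to the minimizing sequence itself.\<close>

lemma L2_Cauchy_midpoints:
  assumes sq: "\<And>n. sq_int M (f n)" and lim: "(\<lambda>n. nsq M (f n)) \<longlonglongrightarrow> d"
    and mid: "\<And>e. e > 0 \<Longrightarrow> \<exists>N. \<forall>n\<ge>N. \<forall>m\<ge>N. d - e \<le> nsq M (\<lambda>x. (1/2) *\<^sub>R (f n x + f m x))"
  shows "L2_Cauchy M f"
  unfolding L2_Cauchy_def
proof (intro allI impI)
  fix e :: real assume "0 < e"
  obtain N1 where N1: "\<And>n. n \<ge> N1 \<Longrightarrow> \<bar>nsq M (f n) - d\<bar> < e / 16"
    using LIMSEQ_D[OF lim, of "e/16"] \<open>0 < e\<close> by auto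
  obtain N2 where N2: "\<And>n m. n \<ge> N2 \<Longrightarrow> m \<ge> N2 \<Longrightarrow> d - e / 16 \<le> nsq M (\<lambda>x. (1/2) *\<^sub>R (f n x + f m x))"
    using mid[of "e/16"] \<open>0 < e\<close> by auto
  show "\<exists>N. \<forall>n\<ge>N. \<forall>m\<ge>N. nsq M (\<lambda>x. f n x - f m x) < e"
  proof (intro exI[of _ "max N1 N2"] allI impI)
    fix n m assume nm: "max N1 N2 \<le> n" "max N1 N2 \<le> m"
    have "4 * nsq M (\<lambda>x. (1/2) *\<^sub>R (f n x + f m x)) = nsq M (\<lambda>x. f n x + f m x)"
      by (simp add: nsq_scaleR power2_eq_square del: scaleR_add_right)
    moreover have "\<bar>nsq M (f n) - d\<bar> < e / 16" "\<bar>nsq M (f m) - d\<bar> < e / 16"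
      "d - e / 16 \<le> nsq M (\<lambda>x. (1/2) *\<^sub>R (f n x + f m x))"
      using nm by (intro N1 N2; simp)+
    ultimately show "nsq M (\<lambda>x. f n x - f m x) < e"
      using nsq_parallelogram[OF sq sq, of n m] \<open>0 < e\<close> unfolding abs_less_iff by linarith
  qed
qed

text \<open>The weak limit is found without a Hilbert space structure, as the strong limit of almost
  shortest elements of convex sets \<open>C n\<close> that contain the tails of the sequence.\<close>

lemma weak_limit_exists:
  fixes g :: "nat \<Rightarrow> 'a \<Rightarrow> 'b::euclidean_space"
  assumes sq: "\<And>n. sq_int M (g n)" and bd: "\<And>n. nsq M (g n) \<le> A"
    and T: "\<And>\<psi>. \<psi> \<in> T \<Longrightarrow> sq_int M \<psi>"
    and lim: "\<And>\<psi>. \<psi> \<in> T \<Longrightarrow> (\<lambda>n. \<integral>x. g n x \<bullet> \<psi> x \<partial>M) \<longlonglongrightarrow> L \<psi>"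
  obtains G where "sq_int M G" "nsq M G \<le> A" "\<And>\<psi>. \<psi> \<in> T \<Longrightarrow> (\<integral>x. G x \<bullet> \<psi> x \<partial>M) = L \<psi>"
proof -
  \<comment> \<open>The condition compares errors: any bound valid for the pairings of the whole
    tail \<open>k \<ge> n\<close> must hold for G as well. This makes \<open>C n\<close> convex and
    decreasing in n, and it forces the pairings of elements of \<open>C n\<close> towards
    \<open>L\<close> as n grows.\<close>
  define C where "C n = {G. sq_int M G \<and> (\<forall>\<psi>\<in>T. \<forall>e.
     (\<forall>k\<ge>n. \<bar>(\<integral>x. g k x \<bullet> \<psi> x \<partial>M) - L \<psi>\<bar> \<le> e) \<longrightarrow> \<bar>(\<integral>x. G x \<bullet> \<psi> x \<partial>M) - L \<psi>\<bar> \<le> e)}" for n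
  define d where "d n = Inf (nsq M ` C n)" for n
  have gC: "g n \<in> C n" for n using sq by (auto simp: C_def)
  have Canti: "C m \<subseteq> C n" if "n \<le> m" for n m
    using that by (auto simp: C_def)
  have bdd: "bdd_below (nsq M ` C n)" for n by (rule bdd_belowI2[of _ 0]) simp
  have d_le: "d n \<le> nsq M G" if "G \<in> C n" for n G
    unfolding d_def using that bdd by (intro cInf_lower) auto
  have dA: "d n \<le> A" for n using d_le[OF gC[of n]] bd[of n] by simp
  have dmono: "incseq d"
    unfolding d_def using Canti bdd gC by (intro incseq_SucI cInf_superset_mono image_mono) (auto, blast)
  obtain D where D: "d \<longlonglongrightarrow> D" "\<And>n. d n \<le> D"
    using incseq_convergent[OF dmono] dA by blast
  have DA: "D \<le> A" using LIMSEQ_le_const2[OF D(1)] dA by blast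
  have "\<exists>w. w \<in> C n \<and> nsq M w < d n + inverse (real (Suc n))" for n
    unfolding d_def using cInf_lessD[of "nsq M ` C n" "Inf (nsq M ` C n) + inverse (real (Suc n))"] gC
    by (auto simp del: of_nat_Suc)
  then obtain w where w: "\<And>n. w n \<in> C n" "\<And>n. nsq M (w n) < d n + inverse (real (Suc n))" by metis
  have wsq: "sq_int M (w n)" for n using w(1)[of n] by (auto simp: C_def)
  have wlim: "(\<lambda>n. nsq M (w n)) \<longlonglongrightarrow> D"
  proof (rule tendsto_sandwich[OF _ _ D(1)])
    show "\<forall>\<^sub>F n in sequentially. d n \<le> nsq M (w n)" using d_le w(1) by auto
    show "\<forall>\<^sub>F n in sequentially. nsq M (w n) \<le> d n + inverse (real (Suc n))"
      using w(2) by (intro always_eventually allI less_imp_le)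
    show "(\<lambda>n. d n + inverse (real (Suc n))) \<longlonglongrightarrow> D"
      using tendsto_add[OF D(1) LIMSEQ_inverse_real_of_nat] by simp
  qed
  have midC: "(\<lambda>x. (1/2) *\<^sub>R (G x + H x)) \<in> C n" if "G \<in> C n" "H \<in> C n" for G H n
  proof -
    have GH: "sq_int M G" "sq_int M H" using that by (auto simp: C_def)
    have "\<bar>(\<integral>x. ((1/2) *\<^sub>R (G x + H x)) \<bullet> \<psi> x \<partial>M) - L \<psi>\<bar> \<le> e"
      if "\<psi> \<in> T" "\<forall>k\<ge>n. \<bar>(\<integral>x. g k x \<bullet> \<psi> x \<partial>M) - L \<psi>\<bar> \<le> e" for \<psi> e
    proof -
      have eq: "(\<integral>x. ((1/2) *\<^sub>R (G x + H x)) \<bullet> \<psi> x \<partial>M)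
          = (1/2) * ((\<integral>x. G x \<bullet> \<psi> x \<partial>M) + (\<integral>x. H x \<bullet> \<psi> x \<partial>M))"
        using sq_int_inner_integrable[OF GH(1) T[OF that(1)]] sq_int_inner_integrable[OF GH(2) T[OF that(1)]]
        by (simp add: inner_add_left del: scaleR_add_right)
      have "\<bar>(\<integral>x. G x \<bullet> \<psi> x \<partial>M) - L \<psi>\<bar> \<le> e" "\<bar>(\<integral>x. H x \<bullet> \<psi> x \<partial>M) - L \<psi>\<bar> \<le> e"
        using \<open>G \<in> C n\<close> \<open>H \<in> C n\<close> that unfolding C_def by blast+
      moreover have "\<bar>1 / 2 * (a + b) - l\<bar> \<le> e" if "\<bar>a - l\<bar> \<le> e" "\<bar>b - l\<bar> \<le> e" for a b l :: real
        using that unfolding abs_le_iff by (auto simp: field_simps)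
      ultimately show ?thesis unfolding eq by blast
    qed
    then show ?thesis
      using sq_int_scaleR[OF sq_int_add[OF GH], of "1/2"] by (auto simp: C_def)
  qed
  have "L2_Cauchy M w"
  proof (rule L2_Cauchy_midpoints[OF wsq wlim])
    fix e :: real assume "0 < e"
    then obtain N where N: "\<bar>d N - D\<bar> < e" using D(1) by (auto simp: LIMSEQ_iff)
    \<comment> \<open>Beyond N both elements lie in the convex set \<open>C N\<close>; so does their
      midpoint, whose \<open>nsq\<close> is therefore at least \<open>d N\<close> > D - e.\<close>
    have "D - e \<le> nsq M (\<lambda>x. (1/2) *\<^sub>R (w n x + w m x))" if "n \<ge> N" "m \<ge> N" for n m
      using d_le[OF midC[of "w n" N "w m"]] w(1)[of n] w(1)[of m] Canti[OF that(1)] Canti[OF that(2)] N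
      unfolding abs_less_iff by (auto simp: subset_iff)
    then show "\<exists>N. \<forall>n\<ge>N. \<forall>m\<ge>N. D - e \<le> nsq M (\<lambda>x. (1/2) *\<^sub>R (w n x + w m x))" by blast
  qed
  then obtain G where G: "sq_int M G" "(\<lambda>n. nsq M (\<lambda>x. w n x - G x)) \<longlonglongrightarrow> 0"
    by (rule L2_complete[where f=w, OF wsq])
  show thesis
  proof
    show "sq_int M G" by fact
    show "nsq M G \<le> A"
      using LIMSEQ_unique[OF wlim nsq_tendsto[OF wsq G]] DA by simp
    fix \<psi> assume \<psi>: "\<psi> \<in> T"
    have "(\<lambda>n. \<integral>x. w n x \<bullet> \<psi> x \<partial>M) \<longlonglongrightarrow> L \<psi>"
    proof (rule LIMSEQ_I)
      fix e :: real assume "0 < e"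
      then obtain N where "\<forall>k\<ge>N. \<bar>(\<integral>x. g k x \<bullet> \<psi> x \<partial>M) - L \<psi>\<bar> < e / 2"
        using lim[OF \<psi>] unfolding LIMSEQ_iff by (metis half_gt_zero real_norm_def)
      then have N: "\<forall>k\<ge>N. \<bar>(\<integral>x. g k x \<bullet> \<psi> x \<partial>M) - L \<psi>\<bar> \<le> e / 2" by (auto intro: less_imp_le)
      have "\<bar>(\<integral>x. w n x \<bullet> \<psi> x \<partial>M) - L \<psi>\<bar> \<le> e / 2" if "n \<ge> N" for n
        using w(1)[of n] Canti[OF that] N \<psi> unfolding C_def by blast
      then show "\<exists>N. \<forall>n\<ge>N. norm ((\<integral>x. w n x \<bullet> \<psi> x \<partial>M) - L \<psi>) < e"
        using \<open>0 < e\<close> by (intro exI[of _ N] allI impI) (simp add: order.strict_trans1[of _ "e/2"])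
    qed
    then show "(\<integral>x. G x \<bullet> \<psi> x \<partial>M) = L \<psi>"
      using LIMSEQ_unique inner_integral_tendsto[OF wsq G T[OF \<psi>]] by blast
  qed
qed

subsection \<open>Test functions\<close>

text \<open>The smooth function exp(-1/t), flat at 0, times a polynomial in 1/t: the polynomial
  parameter closes the family under differentiation, which an induction over \<open>Ck\<close>
  requires.\<close>

definition flat :: "real poly \<Rightarrow> real \<Rightarrow> real" where
  "flat p t = (if 0 < t then poly p (1 / t) * exp (- (1 / t)) else 0)"

lemma poly_times_exp_minus_tendsto_0:
  fixes q :: "real poly"
  shows "((\<lambda>s. poly q s * exp (- s)) \<longlongrightarrow> 0) at_top"
proof -
  have "((\<lambda>s. \<Sum>i\<le>degree q. coeff q i * (s ^ i / exp s)) \<longlongrightarrow> (\<Sum>i\<le>degree q. coeff q i * 0)) at_top"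
    by (intro tendsto_sum tendsto_mult tendsto_const tendsto_power_div_exp_0)
  moreover have "(\<lambda>s. \<Sum>i\<le>degree q. coeff q i * (s ^ i / exp s)) = (\<lambda>s. poly q s * exp (- s))"
    by (simp add: poly_altdef sum_distrib_right exp_minus divide_inverse mult.assoc)
  ultimately show ?thesis by simp
qed

text \<open>For t > 0, differentiating p(1/t) and exp(-1/t) brings out the factors -1/t^2 and 1/t^2;
  hence the polynomial X^2 (p - p').\<close>

lemma flat_has_derivative:
  "(flat p has_real_derivative flat (monom 1 2 * (p - pderiv p)) t) (at t)"
proof -
  consider "t > 0" | "t < 0" | "t = 0" by linarith
  then show ?thesis
  proof cases
    case 1
    have "((\<lambda>t. poly p (1 / t) * exp (- (1 / t))) has_real_derivative
       flat (monom 1 2 * (p - pderiv p)) t) (at t)"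
      using 1 unfolding flat_def
      by (auto intro!: derivative_eq_intros DERIV_chain2[OF poly_DERIV]
          simp: poly_monom divide_simps power2_eq_square algebra_simps)
    moreover have "\<forall>\<^sub>F s in nhds t. flat p s = poly p (1 / s) * exp (- (1 / s))"
      using eventually_nhds_in_open[of "{0<..}" t] 1 by (auto simp: flat_def elim!: eventually_mono)
    ultimately show ?thesis by (subst DERIV_cong_ev[OF refl _ refl])
  next
    case 2
    have "\<forall>\<^sub>F s in nhds t. flat p s = 0"
      using eventually_nhds_in_open[of "{..<0}" t] 2 by (auto simp: flat_def elim!: eventually_mono)
    moreover have "((\<lambda>s. 0) has_real_derivative flat (monom 1 2 * (p - pderiv p)) t) (at t)"
      using 2 by (simp add: flat_def)
    ultimately show ?thesis by (subst DERIV_cong_ev[OF refl _ refl])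
  next
    case 3
    have "((\<lambda>h. flat p h / h) \<longlongrightarrow> 0) (at 0)"
    proof (rule filterlim_split_at_real)
      have "\<forall>\<^sub>F h in at_left 0. 0 = flat p h / h"
        by (auto simp: flat_def eventually_at intro!: exI[of _ 1])
      then show "((\<lambda>h. flat p h / h) \<longlongrightarrow> 0) (at_left 0)"
        by (rule Lim_transform_eventually[OF tendsto_const])
      \<comment> \<open>\<open>pCons 0 p\<close> is X p: after the substitution s = 1/h it absorbs
        the division by h.\<close>
      have "((\<lambda>h. poly (pCons 0 p) (inverse h) * exp (- inverse h)) \<longlongrightarrow> 0) (at_right 0)"
        by (rule filterlim_compose[OF poly_times_exp_minus_tendsto_0 filterlim_inverse_at_top_right])
      moreover have "\<forall>\<^sub>F h in at_right 0. poly (pCons 0 p) (inverse h) * exp (- inverse h) = flat p h / h"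
        by (auto simp: flat_def eventually_at divide_inverse intro!: exI[of _ 1])
      ultimately show "((\<lambda>h. flat p h / h) \<longlongrightarrow> 0) (at_right 0)"
        by (rule Lim_transform_eventually)
    qed
    then show ?thesis using 3 by (simp add: DERIV_def flat_def[of p 0] flat_def[of _ 0])
  qed
qed

lemma partial_eqI:
  assumes "(\<phi> has_derivative D) (at x)"
  shows "partial i \<phi> x = D (axis i 1)"
  using frechet_derivative_at[OF assms] by (simp add: partial_def)

lemma has_derivative_partial:
  assumes "\<phi> differentiable (at x)"
  shows "(\<phi> has_derivative (\<lambda>h. \<Sum>i\<in>UNIV. h $ i * partial i \<phi> x)) (at x)"
proof -
  have D: "(\<phi> has_derivative frechet_derivative \<phi> (at x)) (at x)"
    using assms frechet_derivative_works by blast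
  have "frechet_derivative \<phi> (at x) h = (\<Sum>i\<in>UNIV. h $ i * partial i \<phi> x)" for h
  proof -
    have "frechet_derivative \<phi> (at x) h = frechet_derivative \<phi> (at x) (\<Sum>i\<in>UNIV. (h $ i) *\<^sub>R axis i 1)"
      using basis_expansion[of h] by (simp add: scalar_mult_eq_scaleR)
    also have "\<dots> = (\<Sum>i\<in>UNIV. h $ i * partial i \<phi> x)"
      using has_derivative_linear[OF D] by (simp add: linear_sum linear_cmul partial_def)
    finally show ?thesis .
  qed
  then show ?thesis using D by (metis (no_types, lifting) ext)
qed

lemma sum_axis [simp]: "(\<Sum>j\<in>UNIV. (axis i 1 :: real ^ 'n) $ j * c j) = c i"
proof -
  have "(\<Sum>j\<in>UNIV. (axis i 1 :: real ^ 'n) $ j * c j) = (\<Sum>j\<in>UNIV. if j = i then c j else 0)"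
    by (intro sum.cong) (auto simp: axis_def)
  then show ?thesis by simp
qed

lemma partial_const [simp]: "partial i (\<lambda>x. c) = (\<lambda>x. 0)"
  using partial_eqI[OF has_derivative_const] by (intro ext) simp

lemma Ck_const: "Ck k (\<lambda>x. c)"
  by (induction k arbitrary: c) auto

lemma Ck_SucD: "Ck (Suc k) \<phi> \<Longrightarrow> Ck k \<phi>"
proof (induction k arbitrary: \<phi>)
  case 0
  then show ?case
    by (auto intro!: differentiable_imp_continuous_on simp: differentiable_on_def)
next
  case (Suc k)
  then show ?case by simp
qed

lemma Ck_add: "Ck k f \<Longrightarrow> Ck k g \<Longrightarrow> Ck k (\<lambda>x. f x + g x)"
proof (induction k arbitrary: f g)
  case 0
  then show ?case by (auto intro: continuous_intros)
next
  case (Suc k)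
  have "partial i (\<lambda>x. f x + g x) = (\<lambda>x. partial i f x + partial i g x)" for i
    using Suc.prems
    by (intro ext, subst partial_eqI[OF has_derivative_add[OF has_derivative_partial has_derivative_partial]])
       auto
  then show ?case using Suc by simp
qed

lemma Ck_mult: "Ck k f \<Longrightarrow> Ck k g \<Longrightarrow> Ck k (\<lambda>x. f x * g x)"
proof (induction k arbitrary: f g)
  case 0
  then show ?case by (auto intro: continuous_intros)
next
  case (Suc k)
  have "partial i (\<lambda>x. f x * g x) = (\<lambda>x. f x * partial i g x + partial i f x * g x)" for i
    using Suc.prems
    by (intro ext, subst partial_eqI[OF has_derivative_mult[OF has_derivative_partial has_derivative_partial]])
       auto
  moreover have "Ck k f" "Ck k g" using Suc.prems by (auto intro: Ck_SucD simp del: Ck.simps)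
  ultimately show ?case using Suc by (auto intro!: Ck_add)
qed

lemma Ck_prod:
  assumes "finite A" "\<And>i. i \<in> A \<Longrightarrow> Ck k (f i)"
  shows "Ck k (\<lambda>x. \<Prod>i\<in>A. f i x)"
  using assms by (induction A rule: finite_induct) (auto intro: Ck_const Ck_mult)

lemma Ck_shift: "Ck k \<phi> \<Longrightarrow> Ck k (\<lambda>x. \<phi> (x - h))"
proof (induction k arbitrary: \<phi>)
  case 0
  then have "continuous_on UNIV (\<lambda>x. \<phi> (x - h))"
    by (auto intro!: continuous_on_compose2[of UNIV \<phi>] continuous_intros)
  then show ?case by simp
next
  case (Suc k)
  have D: "((\<lambda>x. \<phi> (x - h)) has_derivative (\<lambda>v. \<Sum>i\<in>UNIV. v $ i * partial i \<phi> (x - h))) (at x)" for x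
  proof -
    have "((\<lambda>x. x - h) has_derivative (\<lambda>v. v)) (at x)" by (auto intro!: derivative_eq_intros)
    moreover have "(\<phi> has_derivative (\<lambda>v. \<Sum>i\<in>UNIV. v $ i * partial i \<phi> (x - h))) (at (x - h))"
      using Suc.prems by (intro has_derivative_partial) auto
    ultimately show ?thesis using has_derivative_compose[of "\<lambda>x. x - h" "\<lambda>v. v" x UNIV \<phi>] by simp
  qed
  have "partial i (\<lambda>x. \<phi> (x - h)) = (\<lambda>x. partial i \<phi> (x - h))" for i
    by (intro ext, subst partial_eqI[OF D]) auto
  then show ?case using Suc D by (auto simp: differentiable_def)
qed

lemma partial_shift:
  assumes "\<And>x. \<phi> differentiable (at x)"
  shows "partial i (\<lambda>x. \<phi> (x - h)) x = partial i \<phi> (x - h)"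
proof -
  have "((\<lambda>x. x - h) has_derivative (\<lambda>v. v)) (at x)" by (auto intro!: derivative_eq_intros)
  then have D: "((\<lambda>x. \<phi> (x - h)) has_derivative (\<lambda>v. \<Sum>i\<in>UNIV. v $ i * partial i \<phi> (x - h))) (at x)"
    using has_derivative_compose[of "\<lambda>x. x - h" "\<lambda>v. v" x UNIV \<phi>, OF _ has_derivative_partial[OF assms]] by simp
  show ?thesis
    using partial_eqI[OF D] by simp
qed

lemma Ck_flat_coord: "Ck k (\<lambda>x. flat p (c * x $ i + d))"
proof (induction k arbitrary: p)
  case 0
  have "continuous_on UNIV (flat p)"
    using flat_has_derivative by (intro DERIV_continuous_on) auto
  then have "continuous_on UNIV (\<lambda>x::R3. flat p (c * x $ i + d))"
    by (auto intro!: continuous_on_compose2[of UNIV "flat p"] continuous_intros)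
  then show ?case by simp
next
  case (Suc k)
  let ?q = "monom 1 2 * (p - pderiv p)"
  have D: "((\<lambda>x::R3. flat p (c * x $ i + d)) has_derivative
      (\<lambda>v. flat ?q (c * x $ i + d) * (c * v $ i))) (at x)" for x
  proof -
    have "((\<lambda>x::R3. c * x $ i + d) has_derivative (\<lambda>v. c * v $ i)) (at x)"
      by (auto intro!: derivative_eq_intros bounded_linear.has_derivative[OF bounded_linear_vec_nth])
    moreover have "(flat p has_derivative (\<lambda>t. flat ?q (c * x $ i + d) * t)) (at (c * x $ i + d))"
      using flat_has_derivative[of p "c * x $ i + d"] by (simp add: has_field_derivative_def)
    ultimately show ?thesis
      by (rule has_derivative_compose)
  qed
  have "partial j (\<lambda>x. flat p (c * x $ i + d)) = (\<lambda>x. (if i = j then c else 0) * flat ?q (c * x $ i + d))" for j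
    by (intro ext, subst partial_eqI[OF D]) (auto simp: axis_def)
  then show ?case using D Suc by (auto simp: differentiable_def intro!: Ck_mult Ck_const)
qed

lemma flat_1_le: "0 \<le> flat 1 t" "flat 1 t \<le> 1"
  by (auto simp: flat_def)

lemma flat_1_tendsto: "(\<lambda>n. flat 1 (real (Suc n) * t)) \<longlonglongrightarrow> indicator {0<..} t"
proof (cases "t > 0")
  case True
  have "(\<lambda>n. exp (- (inverse (real (Suc n)) * inverse t))) \<longlonglongrightarrow> exp (- (0 * inverse t))"
    by (intro tendsto_exp tendsto_minus tendsto_mult LIMSEQ_inverse_real_of_nat tendsto_const)
  then show ?thesis using True by (simp add: flat_def divide_simps inverse_eq_divide)
qed (simp add: flat_def mult_le_0_iff zero_less_mult_iff)

text \<open>Scaling by \<open>Suc n\<close> steepens the product towards the indicator of the open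
  box, while the support stays inside the box and the values stay at most 1. This gives a majorant
  independent of n.\<close>

definition bump :: "R3 \<Rightarrow> R3 \<Rightarrow> nat \<Rightarrow> R3 \<Rightarrow> real" where
  "bump a b n x = (\<Prod>i\<in>UNIV. flat 1 (real (Suc n) * (x $ i - a $ i)) * flat 1 (real (Suc n) * (b $ i - x $ i)))"

lemma bump_nonzero_subset: "{x. bump a b n x \<noteq> 0} \<subseteq> box a b"
  by (auto simp: bump_def flat_def mem_box_cart zero_less_mult_iff)

lemma test_fun_bump: "test_fun (bump a b n)"
proof -
  have "Ck k (\<lambda>x. flat 1 (real (Suc n) * x $ i + - real (Suc n) * a $ i) *
       flat 1 (- real (Suc n) * x $ i + real (Suc n) * b $ i))" for k i
    by (intro Ck_mult Ck_flat_coord)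
  moreover have "(\<lambda>x. flat 1 (real (Suc n) * x $ i + - real (Suc n) * a $ i) *
       flat 1 (- real (Suc n) * x $ i + real (Suc n) * b $ i))
     = (\<lambda>x. flat 1 (real (Suc n) * (x $ i - a $ i)) * flat 1 (real (Suc n) * (b $ i - x $ i)))" for i
    by (simp add: algebra_simps)
  ultimately have "Ck k (bump a b n)" for k
    unfolding bump_def[abs_def] by (intro Ck_prod) auto
  moreover have "compact (closure {x. bump a b n x \<noteq> 0})"
    using bounded_subset[OF bounded_box bump_nonzero_subset[of a b n]] by simp
  ultimately show ?thesis by (simp add: test_fun_def)
qed

lemma bump_tendsto: "(\<lambda>n. bump a b n x) \<longlonglongrightarrow> indicator (box a b) x"
proof -
  have "(\<lambda>n. bump a b n x) \<longlonglongrightarrow> (\<Prod>i\<in>UNIV. indicator {0<..} (x $ i - a $ i) * indicator {0<..} (b $ i - x $ i))"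
    unfolding bump_def by (intro tendsto_prod tendsto_mult flat_1_tendsto)
  moreover have "(\<Prod>i\<in>UNIV. indicator {0<..} (x $ i - a $ i) * indicator {0<..} (b $ i - x $ i))
      = (indicator (box a b) x :: real)"
    by (auto simp: indicator_def mem_box_cart)
  ultimately show ?thesis by simp
qed

lemma bump_bound: "\<bar>bump a b n x\<bar> \<le> indicator (cbox a b) x"
proof (cases "x \<in> box a b")
  case True
  have "\<bar>bump a b n x\<bar> \<le> 1"
    unfolding bump_def abs_prod by (intro prod_le_1) (auto simp: abs_mult flat_1_le intro!: mult_le_one)
  then show ?thesis using True box_subset_cbox[of a b] by (auto simp: indicator_def)
next
  case False
  then have "bump a b n x = 0" using bump_nonzero_subset[of a b n] by auto
  then show ?thesis by simp
qed

lemma test_fun_Ck: "test_fun \<phi> \<Longrightarrow> Ck k \<phi>"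
  by (simp add: test_fun_def)

lemma test_fun_differentiable: "test_fun \<phi> \<Longrightarrow> \<phi> differentiable (at x)"
  using test_fun_Ck[of \<phi> "Suc 0"] by simp

lemma test_fun_continuous: "test_fun \<phi> \<Longrightarrow> continuous_on UNIV \<phi>"
  using test_fun_Ck[of \<phi> 0] by simp

lemma test_fun_measurable [measurable_dest]: "test_fun \<phi> \<Longrightarrow> \<phi> \<in> borel_measurable borel"
  by (intro borel_measurable_continuous_onI test_fun_continuous)

lemma test_fun_shift:
  assumes "test_fun \<phi>"
  shows "test_fun (\<lambda>x. \<phi> (x - h))"
proof -
  have "{x. \<phi> (x - h) \<noteq> 0} = (\<lambda>x. h + x) ` {x. \<phi> x \<noteq> 0}"
    by (auto intro!: image_eqI[of _ _ "_ - h"])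
  then have "bounded {x. \<phi> (x - h) \<noteq> 0}"
    using assms by (simp add: test_fun_def bounded_translation)
  then show ?thesis using assms by (simp add: test_fun_def Ck_shift)
qed

lemma test_fun_partial:
  assumes "test_fun \<phi>"
  shows "test_fun (partial i \<phi>)"
proof -
  have "partial i \<phi> x = 0" if "x \<notin> closure {x. \<phi> x \<noteq> 0}" for x
  proof -
    have "\<forall>\<^sub>F y in nhds x. y \<in> - closure {x. \<phi> x \<noteq> 0}"
      using that by (intro eventually_nhds_in_open) auto
    then have ev: "\<forall>\<^sub>F y in nhds x. \<phi> y = 0"
      by eventually_elim (use closure_subset[of "{x. \<phi> x \<noteq> 0}"] in auto)
    have "(\<phi> has_derivative (\<lambda>h. 0)) (at x)"
      by (rule has_derivative_transform_eventually[OF has_derivative_const[of 0]])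
         (use ev eventually_nhds_x_imp_x[OF ev] in \<open>auto simp: eventually_at_filter elim: eventually_mono\<close>)
    then show ?thesis by (simp add: partial_eqI)
  qed
  then have "{x. partial i \<phi> x \<noteq> 0} \<subseteq> closure {x. \<phi> x \<noteq> 0}" by auto
  then have "bounded {x. partial i \<phi> x \<noteq> 0}"
    using assms by (auto simp: test_fun_def intro: bounded_subset compact_imp_bounded)
  moreover have "Ck k (partial i \<phi>)" for k
    using test_fun_Ck[OF assms, of "Suc k"] by simp
  ultimately show ?thesis by (simp add: test_fun_def)
qed

lemma test_fun_support:
  assumes "test_fun \<phi>"
  obtains R where "0 < R" "\<And>x. R \<le> norm x \<Longrightarrow> \<phi> x = 0"
proof -
  have "bounded {x. \<phi> x \<noteq> 0}" using assms by (simp add: test_fun_def)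
  then obtain B where "0 < B" "\<And>x. \<phi> x \<noteq> 0 \<Longrightarrow> norm x \<le> B"
    unfolding bounded_pos by auto
  then show thesis using that[of "B + 1"] by fastforce
qed

lemma test_fun_bound:
  assumes "test_fun \<phi>"
  obtains B where "0 < B" "\<And>x. \<bar>\<phi> x\<bar> \<le> B"
proof -
  have "compact (\<phi> ` closure {x. \<phi> x \<noteq> 0})"
    using assms test_fun_continuous[OF assms]
    by (intro compact_continuous_image) (auto simp: test_fun_def intro: continuous_on_subset)
  then obtain B where B: "0 < B" "\<And>y. y \<in> \<phi> ` closure {x. \<phi> x \<noteq> 0} \<Longrightarrow> norm y \<le> B"
    using compact_imp_bounded[of "\<phi> ` closure {x. \<phi> x \<noteq> 0}"] unfolding bounded_pos by blast
  have "\<bar>\<phi> x\<bar> \<le> B" for x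
    using B closure_subset[of "{x. \<phi> x \<noteq> 0}"] by (cases "\<phi> x = 0") auto
  with B(1) show thesis by (rule that)
qed

lemma test_fun_bound_ball:
  assumes "test_fun \<phi>"
  obtains B R where "0 < B" "0 < R" "\<And>x. \<bar>\<phi> x\<bar> \<le> B * indicator (ball 0 R) x"
proof -
  obtain R where R: "0 < R" "\<And>x. R \<le> norm x \<Longrightarrow> \<phi> x = 0" using test_fun_support[OF assms] by blast
  obtain B where B: "0 < B" "\<And>x. \<bar>\<phi> x\<bar> \<le> B" using test_fun_bound[OF assms] by blast
  show thesis using R B by (intro that[of B R]) (auto simp: indicator_def)
qed

lemma sq_int_indicator:
  assumes "A \<in> sets M" "emeasure M A < \<infinity>"
  shows "sq_int M (\<lambda>x. indicator A x :: real)"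
proof -
  have "(\<lambda>x. (norm (indicator A x :: real))\<^sup>2) = indicator A"
    by (auto simp: indicator_def)
  then show ?thesis using assms by (simp add: sq_int_def integrable_real_indicator)
qed

lemma test_fun_sq_int:
  assumes "test_fun \<phi>"
  shows "sq_int lborel \<phi>"
proof -
  obtain B R where B: "0 < B" "0 < R" "\<And>x. \<bar>\<phi> x\<bar> \<le> B * indicator (ball 0 R) x"
    using test_fun_bound_ball[OF assms] by blast
  have "sq_int lborel (\<lambda>x. B * indicator (ball (0::R3) R) x)"
    by (intro sq_int_cmult sq_int_indicator emeasure_lborel_ball_finite) simp
  then show ?thesis
    by (rule sq_int_bound) (use assms B in \<open>auto simp: abs_mult indicator_def\<close>)
qed

lemma test_fun_Lipschitz:
  assumes "test_fun \<phi>"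
  obtains L where "0 < L" "\<And>x y. \<bar>\<phi> x - \<phi> y\<bar> \<le> L * norm (x - y)"
proof -
  have "\<exists>B. \<forall>x. \<bar>partial i \<phi> x\<bar> \<le> B" for i
    using test_fun_bound[OF test_fun_partial[OF assms]] by metis
  then obtain B where B: "\<And>i x. \<bar>partial i \<phi> x\<bar> \<le> B i" by metis
  define L where "L = (\<Sum>i\<in>UNIV. B i)"
  have L: "norm (\<phi> x - \<phi> y) \<le> L * norm (x - y)" for x y
  proof (rule differentiable_bound[of UNIV \<phi> "\<lambda>z h. \<Sum>i\<in>UNIV. h $ i * partial i \<phi> z"])
    fix z :: R3
    show "(\<phi> has_derivative (\<lambda>h. \<Sum>i\<in>UNIV. h $ i * partial i \<phi> z)) (at z within UNIV)"
      using has_derivative_partial[OF test_fun_differentiable[OF assms]] by simp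
    show "onorm (\<lambda>h. \<Sum>i\<in>UNIV. h $ i * partial i \<phi> z) \<le> L"
    proof (rule onorm_le)
      fix h :: R3
      have "norm (\<Sum>i\<in>UNIV. h $ i * partial i \<phi> z) \<le> (\<Sum>i\<in>UNIV. norm h * B i)"
        using B component_le_norm_cart[of h]
        by (intro order_trans[OF norm_sum] sum_mono) (auto simp: abs_mult intro!: mult_mono)
      then show "norm (\<Sum>i\<in>UNIV. h $ i * partial i \<phi> z) \<le> L * norm h"
        by (simp add: L_def sum_distrib_left mult.commute)
    qed
  qed auto
  have "0 \<le> B i" for i using B[of i undefined] by linarith
  then have "0 \<le> L" by (simp add: L_def sum_nonneg)
  show thesis
  proof (rule that[of "L + 1"])
    show "\<bar>\<phi> x - \<phi> y\<bar> \<le> (L + 1) * norm (x - y)" for x y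
      using order_trans[OF L[of x y], of "(L + 1) * norm (x - y)"] by (simp add: distrib_right)
  qed (use \<open>0 \<le> L\<close> in auto)
qed

lemma bounded_mult_sq_int:
  fixes f c :: "'a \<Rightarrow> real"
  assumes "sq_int M f" "c \<in> borel_measurable M" "\<And>x. \<bar>c x\<bar> \<le> B"
  shows "sq_int M (\<lambda>x. c x * f x)" "nsq M (\<lambda>x. c x * f x) \<le> B\<^sup>2 * nsq M f"
proof -
  have [measurable]: "f \<in> borel_measurable M" "c \<in> borel_measurable M" using assms by auto
  have "norm (c x * f x) \<le> norm (B * f x)" for x
    using assms(3)[of x] by (simp add: abs_mult mult_right_mono)
  then show "sq_int M (\<lambda>x. c x * f x)" "nsq M (\<lambda>x. c x * f x) \<le> B\<^sup>2 * nsq M f"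
    using sq_int_bound[OF sq_int_cmult[OF assms(1), of B], of "\<lambda>x. c x * f x"] by (auto simp: nsq_cmult)
qed

lemma sq_int_indicator_integrable:
  fixes w :: "'a \<Rightarrow> real"
  assumes "sq_int M w" "A \<in> sets M" "emeasure M A < \<infinity>"
  shows "integrable M (\<lambda>x. w x * indicator A x)"
  using sq_int_mult_integrable[OF assms(1) sq_int_indicator[OF assms(2,3)]] by simp

text \<open>\<open>ennreal\<close> truncates negative numbers to 0, so it turns w and -w into the
  positive and the negative part. Their densities define measures that agree and are finite on
  boxes, an intersection-stable generator of the Borel sets, hence they coincide.\<close>

lemma box_integrals_zero_imp_AE_zero:
  fixes w :: "'a::euclidean_space \<Rightarrow> real"
  assumes w: "sq_int lborel w" and z: "\<And>a b. (\<integral>x. w x * indicator (box a b) x \<partial>lborel) = 0"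
  shows "AE x in lborel. w x = 0"
proof -
  have [measurable]: "w \<in> borel_measurable borel" using w by (auto simp: sq_int_def)
  have int: "integrable lborel (\<lambda>x. w x * indicator (box a b) x)" for a b
    by (rule sq_int_indicator_integrable[OF w _ emeasure_lborel_box_finite]) simp
  have *: "(\<integral>\<^sup>+x. ennreal (w x) * indicator (box a b) x \<partial>lborel)
      = (\<integral>\<^sup>+x. ennreal (- w x) * indicator (box a b) x \<partial>lborel) \<and>
      (\<integral>\<^sup>+x. ennreal (w x) * indicator (box a b) x \<partial>lborel) \<noteq> \<infinity>" for a b
  proof -
    have i: "(\<integral>\<^sup>+x. ennreal (c * w x) * indicator (box a b) x \<partial>lborel)
       = ennreal (\<integral>x. max 0 (c * (w x * indicator (box a b) x)) \<partial>lborel)" for c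
    proof -
      have "(\<integral>\<^sup>+x. ennreal (c * w x) * indicator (box a b) x \<partial>lborel)
          = (\<integral>\<^sup>+x. ennreal (max 0 (c * (w x * indicator (box a b) x))) \<partial>lborel)"
        by (intro nn_integral_cong) (auto simp: indicator_def max_def ennreal_neg)
      also have "\<dots> = ennreal (\<integral>x. max 0 (c * (w x * indicator (box a b) x)) \<partial>lborel)"
        by (intro nn_integral_eq_integral integrable_max integrable_mult_right int) auto
      finally show ?thesis .
    qed
    have "(\<integral>x. max 0 (1 * (w x * indicator (box a b) x)) \<partial>lborel)
        - (\<integral>x. max 0 (-1 * (w x * indicator (box a b) x)) \<partial>lborel)
        = (\<integral>x. w x * indicator (box a b) x \<partial>lborel)"
    proof -
      have m: "integrable lborel (\<lambda>x. max 0 (c * (w x * indicator (box a b) x)))" for c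
        by (intro integrable_max integrable_mult_right int) auto
      show ?thesis
        by (subst Bochner_Integration.integral_diff[OF m m, symmetric])
           (auto intro!: Bochner_Integration.integral_cong simp: max_def)
    qed
    then show ?thesis using i[of 1] i[of "-1"] z[of a b] by simp
  qed
  have "density lborel (\<lambda>x. ennreal (w x)) = density lborel (\<lambda>x. ennreal (- w x))"
  proof (rule measure_eqI_generator_eq)
    let ?E = "range (\<lambda>(a, b). box a b::'a set)"
    let ?A = "\<lambda>n::nat. box (- (real n *\<^sub>R One)) (real n *\<^sub>R One) :: 'a set"
    show "Int_stable ?E" by (auto simp: Int_stable_def box_Int_box)
    show "?E \<subseteq> Pow UNIV" "range ?A \<subseteq> ?E" by auto
    show "sets (density lborel (\<lambda>x. ennreal (w x))) = sigma_sets UNIV ?E"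
      "sets (density lborel (\<lambda>x. ennreal (- w x))) = sigma_sets UNIV ?E"
      by (simp_all add: borel_eq_box)
    show "(\<Union>i. ?A i) = UNIV" by (rule UN_box_eq_UNIV)
    show "emeasure (density lborel (\<lambda>x. ennreal (w x))) X = emeasure (density lborel (\<lambda>x. ennreal (- w x))) X"
      if "X \<in> ?E" for X
      using that * by (auto simp: emeasure_density)
    show "emeasure (density lborel (\<lambda>x. ennreal (w x))) (?A i) \<noteq> \<infinity>" for i
      using conjunct2[OF *] by (simp add: emeasure_density)
  qed
  then have "AE x in lborel. ennreal (w x) = ennreal (- w x)"
    by (intro sigma_finite_measure.density_unique[OF sigma_finite_lborel]) auto
  then show ?thesis
    by eventually_elim (metis ennreal_eq_0_iff ennreal_inj linorder_le_cases neg_0_le_iff_le neg_le_0_iff_le order_antisym)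
qed

text \<open>Boxes suffice, and \<open>bump\<close> approximates their indicators under a fixed
  integrable majorant.\<close>

lemma test_fun_orthogonal_imp_AE_zero:
  assumes w: "sq_int lborel w" and z: "\<And>\<phi>. test_fun \<phi> \<Longrightarrow> (\<integral>x. w x * \<phi> x \<partial>lborel) = 0"
  shows "AE x in lborel. w x = 0"
proof (rule box_integrals_zero_imp_AE_zero[OF w])
  fix a b :: R3
  have [measurable]: "w \<in> borel_measurable borel" using w by (auto simp: sq_int_def)
  have [measurable]: "bump a b n \<in> borel_measurable borel" for n by (rule test_fun_measurable[OF test_fun_bump])
  have "(\<lambda>n. \<integral>x. w x * bump a b n x \<partial>lborel) \<longlonglongrightarrow> (\<integral>x. w x * indicator (box a b) x \<partial>lborel)"
  proof (rule integral_dominated_convergence[where w="\<lambda>x. \<bar>w x * indicator (cbox a b) x\<bar>"])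
    show "integrable lborel (\<lambda>x. \<bar>w x * indicator (cbox a b) x\<bar>)"
      by (intro integrable_abs sq_int_indicator_integrable[OF w] emeasure_lborel_cbox_finite) simp
    show "AE x in lborel. (\<lambda>n. w x * bump a b n x) \<longlonglongrightarrow> w x * indicator (box a b) x"
      by (intro AE_I2 tendsto_intros bump_tendsto)
    show "AE x in lborel. norm (w x * bump a b n x) \<le> \<bar>w x * indicator (cbox a b) x\<bar>" for n
      using bump_bound[of a b n] by (auto simp: abs_mult intro!: mult_left_mono)
  qed measurable
  moreover have "(\<lambda>n. \<integral>x. w x * bump a b n x \<partial>lborel) = (\<lambda>n. 0)"
    using z[OF test_fun_bump] by simp
  ultimately show "(\<integral>x. w x * indicator (box a b) x \<partial>lborel) = 0"
    by (simp add: LIMSEQ_const_iff)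
qed

subsection \<open>Measure-preserving maps and second moments\<close>

definition measure_preserving :: "'a measure \<Rightarrow> ('a \<Rightarrow> 'a) \<Rightarrow> bool" where
  "measure_preserving M s \<longleftrightarrow> s \<in> measurable M M \<and> distr M M s = M"

lemma measure_preserving_measurable: "measure_preserving M s \<Longrightarrow> s \<in> measurable M M"
  by (simp add: measure_preserving_def)

lemma measure_preserving_integral:
  fixes f :: "'a \<Rightarrow> 'b::{banach, second_countable_topology}"
  assumes "measure_preserving M s" "f \<in> borel_measurable M"
  shows "(\<integral>x. f (s x) \<partial>M) = (\<integral>x. f x \<partial>M)"
  using assms integral_distr[of s M M f] by (simp add: measure_preserving_def)

lemma measure_preserving_nn_integral:
  assumes "measure_preserving M s" "f \<in> borel_measurable M"
  shows "(\<integral>\<^sup>+x. f (s x) \<partial>M) = (\<integral>\<^sup>+x. f x \<partial>M)"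
  using assms nn_integral_distr[of s M M f] by (simp add: measure_preserving_def)

lemma measure_preserving_integrable:
  fixes f :: "'a \<Rightarrow> 'b::{banach, second_countable_topology}"
  assumes "measure_preserving M s" "integrable M f"
  shows "integrable M (\<lambda>x. f (s x))"
  using assms integrable_distr[of s M M f] by (simp add: measure_preserving_def)

lemma measure_preserving_AE:
  assumes "measure_preserving M s" "AE x in M. P x"
  shows "AE x in M. P (s x)"
  using assms AE_distrD[of s M M P] unfolding measure_preserving_def by metis

lemma measure_preserving_compose:
  assumes "measure_preserving M s" "measure_preserving M t"
  shows "measure_preserving M (\<lambda>x. s (t x))"
  using assms distr_distr[of s M M t M] by (auto simp: measure_preserving_def comp_def)

lemma measure_preserving_sq_int:
  assumes "measure_preserving M s" "sq_int M f"
  shows "sq_int M (\<lambda>x. f (s x))" "nsq M (\<lambda>x. f (s x)) = nsq M f"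
proof -
  have m: "f \<in> borel_measurable M" using assms by auto
  show "sq_int M (\<lambda>x. f (s x))"
    using measurable_compose[OF measure_preserving_measurable[OF assms(1)] m]
      measure_preserving_integrable[OF assms(1) sq_int_integrable[OF assms(2)]]
    by (simp add: sq_int_def)
  show "nsq M (\<lambda>x. f (s x)) = nsq M f"
    unfolding nsq_def
    by (rule measure_preserving_integral[OF assms(1), of "\<lambda>x. (norm (f x))\<^sup>2"]) (use m in measurable)
qed

lemma measure_preserving_pair:
  assumes "measure_preserving M s" "measure_preserving N t" "sigma_finite_measure N"
  shows "measure_preserving (M \<Otimes>\<^sub>M N) (\<lambda>(x, y). (s x, t y))"
  using assms pair_measure_distr[of s M M t N N] unfolding measure_preserving_def
  by (auto intro!: measurable_Pair simp: split_beta' intro: measurable_compose[OF measurable_fst] measurable_compose[OF measurable_snd])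

lemma measure_preserving_plus: "measure_preserving lborel (\<lambda>x::'a::euclidean_space. x + c)"
proof -
  have "distr lborel lborel (\<lambda>x. x + c) = distr lborel borel ((+) c)"
    by (intro distr_cong) (auto simp: add.commute)
  then show ?thesis by (simp add: measure_preserving_def lborel_distr_plus)
qed

text \<open>Lebesgue measure is determined by its values on boxes, and the preimage of a box is its
  image under the inverse, again an orthogonal map. The detour through \<open>lebesgue\<close>
  serves to apply the measure theorem for orthogonal images.\<close>

lemma measure_preserving_orthogonal:
  fixes R :: "R3 \<Rightarrow> R3"
  assumes R: "orthogonal_transformation R"
  shows "measure_preserving lborel R"
proof -
  have lin: "linear R" using R by (rule orthogonal_transformation_linear)
  have [measurable]: "R \<in> borel_measurable borel"
    by (intro borel_measurable_continuous_onI linear_continuous_on) (simp add: lin linear_conv_bounded_linear[symmetric])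
  have R': "orthogonal_transformation (inv R)" using R by (rule orthogonal_transformation_inv)
  have bij: "bij R" using R by (rule orthogonal_transformation_bij)
  have "lborel = distr lborel lborel R"
  proof (rule lborel_eqI)
    fix l u :: R3 assume le: "\<And>b. b \<in> Basis \<Longrightarrow> l \<bullet> b \<le> u \<bullet> b"
    have S: "R -` box l u \<in> sets borel"
      using measurable_sets_borel[of R borel "box l u"] by simp
    have eq: "R -` box l u = inv R ` box l u" using bij by (simp add: bij_vimage_eq_inv_image)
    have fm: "inv R ` box l u \<in> lmeasurable" "box l u \<in> lmeasurable"
      using measurable_orthogonal_image[OF R'] by auto
    have "emeasure (distr lborel lborel R) (box l u) = emeasure lborel (R -` box l u)"
      by (subst emeasure_distr) auto
    also have "\<dots> = emeasure lebesgue (inv R ` box l u)"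
      using S by (simp add: eq emeasure_completion)
    also have "\<dots> = emeasure lebesgue (box l u)"
      using emeasure_eq_measure2[OF fm(1)] emeasure_eq_measure2[OF fm(2)] measure_orthogonal_image[OF R' fm(2)] by simp
    also have "\<dots> = (\<Prod>b\<in>Basis. (u - l) \<bullet> b)"
      using le by (simp add: emeasure_completion emeasure_lborel_box)
    finally show "emeasure (distr lborel lborel R) (box l u) = (\<Prod>b\<in>Basis. (u - l) \<bullet> b)" .
  qed simp
  then show ?thesis by (simp add: measure_preserving_def)
qed

lemma nn_integral_shift:
  fixes f :: "'a::euclidean_space \<Rightarrow> ennreal"
  assumes "f \<in> borel_measurable borel"
  shows "(\<integral>\<^sup>+x. f (x + c) \<partial>lborel) = (\<integral>\<^sup>+x. f x \<partial>lborel)"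
  using measure_preserving_nn_integral[OF measure_preserving_plus, of f] assms by simp

lemma nn_integral_sq_int:
  assumes "sq_int M f"
  shows "(\<integral>\<^sup>+x. ennreal ((norm (f x))\<^sup>2) \<partial>M) = ennreal (nsq M f)"
  unfolding nsq_def using assms by (intro nn_integral_eq_integral) auto

lemma sq_intI_nn_integral:
  assumes "f \<in> borel_measurable M" "(\<integral>\<^sup>+x. ennreal ((norm (f x))\<^sup>2) \<partial>M) \<le> ennreal c" "0 \<le> c"
  shows "sq_int M f" "nsq M f \<le> c"
proof -
  show *: "sq_int M f"
    using assms(1) le_less_trans[OF assms(2) ennreal_less_top]
    by (auto simp: sq_int_def intro!: integrableI_bounded)
  show "nsq M f \<le> c"
    using assms(2,3) nn_integral_sq_int[OF *] by simp
qed

text \<open>Fubini with x innermost, where translation invariance removes the shift. Since the shift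
  may depend on t in any measurable way, the same statement serves averages along segments,
  increments in a ball and, with shift 0, plain cutoffs.\<close>

lemma sq_int_pair_shift:
  fixes k :: "'a::euclidean_space \<Rightarrow> 'c::euclidean_space" and s :: "'b::euclidean_space \<Rightarrow> 'a"
  assumes k: "sq_int lborel k" and A: "A \<in> sets borel" "emeasure lborel A < \<infinity>"
    and s[measurable]: "s \<in> borel_measurable borel"
  shows "sq_int (lborel \<Otimes>\<^sub>M lborel) (\<lambda>(x, t). indicator A t *\<^sub>R k (x + s t))"
    "nsq (lborel \<Otimes>\<^sub>M lborel) (\<lambda>(x, t). indicator A t *\<^sub>R k (x + s t)) \<le> measure lborel A * nsq lborel k"
proof -
  have [measurable]: "k \<in> borel_measurable borel" "A \<in> sets borel" using k A by (auto simp: sq_int_def)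
  have "(\<integral>\<^sup>+p. ennreal ((norm (case p of (x, t) \<Rightarrow> indicator A t *\<^sub>R k (x + s t)))\<^sup>2) \<partial>(lborel \<Otimes>\<^sub>M lborel))
      = (\<integral>\<^sup>+t. \<integral>\<^sup>+x. indicator A t * ennreal ((norm (k (x + s t)))\<^sup>2) \<partial>lborel \<partial>lborel)"
    by (subst lborel_pair.nn_integral_snd[symmetric])
       (auto simp: indicator_def intro!: nn_integral_cong)
  also have "\<dots> = (\<integral>\<^sup>+t. indicator A t * (\<integral>\<^sup>+x. ennreal ((norm (k (x + s t)))\<^sup>2) \<partial>lborel) \<partial>lborel)"
    by (intro nn_integral_cong nn_integral_cmult) measurable
  also have "\<dots> = (\<integral>\<^sup>+t. indicator A t * ennreal (nsq lborel k) \<partial>lborel)"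
    using nn_integral_shift[of "\<lambda>x. ennreal ((norm (k x))\<^sup>2)"] nn_integral_sq_int[OF k] by simp
  also have "\<dots> = emeasure lborel A * ennreal (nsq lborel k)"
    by (subst nn_integral_multc) auto
  also have "\<dots> = ennreal (measure lborel A * nsq lborel k)"
    using A by (simp add: emeasure_eq_ennreal_measure ennreal_mult top.not_eq_extremum)
  finally show "sq_int (lborel \<Otimes>\<^sub>M lborel) (\<lambda>(x, t). indicator A t *\<^sub>R k (x + s t))"
    "nsq (lborel \<Otimes>\<^sub>M lborel) (\<lambda>(x, t). indicator A t *\<^sub>R k (x + s t)) \<le> measure lborel A * nsq lborel k"
    by (auto intro!: sq_intI_nn_integral)
qed

section \<open>Second moments of a ball\<close>

lemma ball_measurable [measurable]: "ball a e \<in> sets borel"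
  by simp

definition moment :: "real \<Rightarrow> real" where
  "moment e = (\<integral>h. indicator (ball 0 e) h * (h $ 1)\<^sup>2 \<partial>(lborel :: R3 measure))"

lemma ball_bounded_integrable:
  fixes f :: "'a::euclidean_space \<Rightarrow> real"
  assumes [measurable]: "f \<in> borel_measurable borel" and "\<And>h. norm h < e \<Longrightarrow> \<bar>f h\<bar> \<le> B"
  shows "integrable lborel (\<lambda>h. indicator (ball 0 e) h * f h)"
proof (rule Bochner_Integration.integrable_bound)
  show "integrable lborel (\<lambda>h. B * indicator (ball (0::'a) e) h)"
    by (intro integrable_mult_right integrable_real_indicator emeasure_lborel_ball_finite) simp
  show "AE h in lborel. norm (indicator (ball 0 e) h * f h) \<le> norm (B * indicator (ball 0 e) h)"
    using assms(2) by (intro AE_I2) (force simp: indicator_def)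
qed measurable

lemma ball_inner_integrable:
  fixes a b :: R3
  shows "integrable lborel (\<lambda>h. indicator (ball 0 e) h * ((h \<bullet> a) * (h \<bullet> b)))"
proof (rule ball_bounded_integrable)
  fix h :: R3 assume h: "norm h < e"
  have "\<bar>h \<bullet> a\<bar> \<le> e * norm a" "\<bar>h \<bullet> b\<bar> \<le> e * norm b"
    using h by (auto intro!: order_trans[OF Cauchy_Schwarz_ineq2] mult_right_mono)
  then show "\<bar>(h \<bullet> a) * (h \<bullet> b)\<bar> \<le> (e * norm a) * (e * norm b)"
    unfolding abs_mult using order_trans[OF norm_ge_zero less_imp_le[OF h]] by (intro mult_mono) auto
qed measurable

lemma orthogonal_transformation_between:
  fixes a b :: "real ^ 'n"
  assumes "norm a = norm b"
  shows "\<exists>R. orthogonal_transformation R \<and> R a = b"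
proof (rule orthogonal_transformation_exists[OF assms])
  fix f :: "real ^ 'n \<Rightarrow> real ^ 'n"
  assume "orthogonal_transformation f" "f a = b"
  then show ?thesis by (intro exI[of _ f] conjI)
qed

text \<open>A rotation taking the first axis to the direction of a preserves both the ball and the
  measure.\<close>

lemma moment_sq: "(\<integral>h. indicator (ball 0 e) h * (h \<bullet> a)\<^sup>2 \<partial>lborel) = moment e * (norm (a :: R3))\<^sup>2"
proof -
  have n: "norm (norm a *\<^sub>R axis 1 1 :: R3) = norm a" by simp
  obtain R :: "R3 \<Rightarrow> R3" where R: "orthogonal_transformation R" "R (norm a *\<^sub>R axis 1 1) = a"
    using orthogonal_transformation_between[OF n] by auto
  have [measurable]: "(\<lambda>h. indicator (ball 0 e) h * (h \<bullet> a)\<^sup>2) \<in> borel_measurable borel" by measurable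
  have "(\<integral>h. indicator (ball 0 e) h * (h \<bullet> a)\<^sup>2 \<partial>lborel)
      = (\<integral>h. indicator (ball 0 e) (R h) * (R h \<bullet> R (norm a *\<^sub>R axis 1 1))\<^sup>2 \<partial>lborel)"
    using measure_preserving_integral[OF measure_preserving_orthogonal[OF R(1)],
        of "\<lambda>h. indicator (ball 0 e) h * (h \<bullet> a)\<^sup>2"] R(2) by simp
  also have "\<dots> = (\<integral>h. (norm a)\<^sup>2 * (indicator (ball 0 e) h * ((h::R3) $ 1)\<^sup>2) \<partial>lborel)"
    using R(1) by (intro Bochner_Integration.integral_cong refl)
      (auto simp: orthogonal_transformation_def orthogonal_transformation_norm[OF R(1)] indicator_def
        power_mult_distrib inner_axis)
  finally show ?thesis by (simp add: moment_def mult.commute)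
qed

text \<open>Polarization identity applied to \<open>moment_sq\<close>. Because of this identity
  averaged difference quotients reproduce the gradient of an affine function exactly.\<close>

lemma moment_inner:
  "(\<integral>h. indicator (ball 0 e) h * ((h \<bullet> a) * (h \<bullet> b)) \<partial>lborel) = moment e * (a \<bullet> (b :: R3))"
proof -
  have i: "integrable lborel (\<lambda>h. indicator (ball 0 e) h * (h \<bullet> c)\<^sup>2)" for c :: R3
    using ball_inner_integrable[of e c c] by (simp add: power2_eq_square)
  have "(\<integral>h. indicator (ball 0 e) h * ((h \<bullet> a) * (h \<bullet> b)) \<partial>lborel)
      = (\<integral>h. (1/4) * (indicator (ball 0 e) h * (h \<bullet> (a + b))\<^sup>2 - indicator (ball 0 e) h * (h \<bullet> (a - b))\<^sup>2) \<partial>lborel)"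
    by (intro Bochner_Integration.integral_cong refl)
       (simp add: inner_add_right inner_diff_right power2_eq_square algebra_simps)
  also have "\<dots> = (1/4) * (moment e * (norm (a + b))\<^sup>2 - moment e * (norm (a - b))\<^sup>2)"
    using i by (simp add: moment_sq del: power2_norm_eq_inner)
  also have "\<dots> = moment e * (a \<bullet> b)"
    by (simp add: power2_norm_eq_inner inner_add inner_diff inner_commute algebra_simps)
  finally show ?thesis .
qed

lemma moment_nonneg: "0 \<le> moment e"
  by (simp add: moment_def)

lemma moment_norm: "(\<integral>h. indicator (ball 0 e) h * (norm (h::R3))\<^sup>2 \<partial>lborel) = 3 * moment e"
proof -
  have "(\<integral>h. indicator (ball 0 e) h * (norm (h::R3))\<^sup>2 \<partial>lborel)
      = (\<integral>h. (\<Sum>i\<in>UNIV. indicator (ball 0 e) h * (((h::R3) \<bullet> axis i 1) * (h \<bullet> axis i 1))) \<partial>lborel)"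
  proof (intro Bochner_Integration.integral_cong refl)
    fix h :: R3
    have "(norm h)\<^sup>2 = (\<Sum>i\<in>UNIV. (h \<bullet> axis i 1) * (h \<bullet> axis i 1))"
      by (simp add: power2_norm_eq_inner inner_axis inner_vec_def[of h h])
    then show "indicator (ball 0 e) h * (norm h)\<^sup>2
        = (\<Sum>i\<in>UNIV. indicator (ball 0 e) h * ((h \<bullet> axis i 1) * (h \<bullet> axis i 1)))"
      by (simp add: sum_distrib_left)
  qed
  also have "\<dots> = (\<Sum>i\<in>(UNIV::3 set). moment e * (axis i 1 \<bullet> (axis i 1 :: R3)))"
    by (subst Bochner_Integration.integral_sum) (simp_all add: ball_inner_integrable moment_inner)
  finally show ?thesis by (simp add: inner_axis_axis)
qed

lemma moment_pos:
  assumes "0 < e"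
  shows "0 < moment e"
proof (rule ccontr)
  assume "\<not> 0 < moment e"
  then have "moment e = 0" using moment_nonneg[of e] by simp
  then have "(\<integral>h. indicator (ball 0 e) h * (norm (h::R3))\<^sup>2 \<partial>lborel) = 0" by (simp add: moment_norm)
  moreover have "integrable lborel (\<lambda>h. indicator (ball 0 e) h * (norm (h::R3))\<^sup>2)"
    by (rule ball_bounded_integrable[where B="e\<^sup>2"]) (auto intro: power_mono)
  ultimately have "AE h in lborel. indicator (ball 0 e) h * (norm (h::R3))\<^sup>2 = 0"
    by (subst (asm) integral_nonneg_eq_0_iff_AE) auto
  then have "AE h in lborel. (h::R3) \<in> ball 0 e \<longrightarrow> h = 0"
    by eventually_elim (auto simp: indicator_def)
  moreover have "AE h in lborel. (h::R3) \<noteq> 0" using AE_lborel_singleton by auto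
  ultimately have "AE h in lborel. (h::R3) \<notin> ball 0 e" by eventually_elim auto
  then have "ball (0::R3) e \<in> null_sets lborel" by (subst AE_iff_null_sets) auto
  then show False
    using content_ball_pos[OF assms, of "0::R3"] by (simp add: null_sets_def measure_def)
qed

lemma moment_le: "moment e \<le> e\<^sup>2 * measure lborel (ball (0::R3) e)"
proof -
  have "moment e \<le> (\<integral>h. e\<^sup>2 * indicator (ball (0::R3) e) h \<partial>lborel)"
    unfolding moment_def
  proof (rule integral_mono)
    show "integrable lborel (\<lambda>h::R3. indicator (ball 0 e) h * (h $ 1)\<^sup>2)"
      using ball_inner_integrable[of e "axis 1 1" "axis 1 1"] by (simp add: inner_axis power2_eq_square)
    show "integrable lborel (\<lambda>h. e\<^sup>2 * indicator (ball (0::R3) e) h)"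
      by (intro integrable_mult_right integrable_real_indicator emeasure_lborel_ball_finite) simp
    fix h :: R3
    have "\<bar>h $ 1\<bar> \<le> norm h" by (rule component_le_norm_cart)
    then have "(h $ 1)\<^sup>2 \<le> e\<^sup>2" if "norm h < e"
      using that by (intro abs_le_square_iff[THEN iffD1]) auto
    then show "indicator (ball 0 e) h * (h $ 1)\<^sup>2 \<le> e\<^sup>2 * indicator (ball 0 e) h"
      by (auto simp: indicator_def)
  qed
  then show ?thesis by simp
qed

section \<open>Mean square oscillation\<close>

definition osc_fun :: "real \<Rightarrow> (R3 \<Rightarrow> real) \<Rightarrow> R3 \<times> R3 \<Rightarrow> real" where
  "osc_fun e u = (\<lambda>(x, h). indicator (ball 0 e) h * (u (x + h) - u x))"

text \<open>Not normalized: the value to compare with is \<open>moment e\<close> times a Dirichlet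
  integral. Being an \<open>nsq\<close> on the product space, it inherits continuity and
  monotonicity from the general lemmas.\<close>

definition osc :: "real \<Rightarrow> (R3 \<Rightarrow> real) \<Rightarrow> real" where
  "osc e u = nsq (lborel \<Otimes>\<^sub>M lborel) (osc_fun e u)"

lemma osc_fun_sq_int:
  assumes "sq_int lborel u"
  shows "sq_int (lborel \<Otimes>\<^sub>M lborel) (osc_fun e u)"
    "osc e u \<le> 4 * measure lborel (ball (0::R3) e) * nsq lborel u"
proof -
  let ?W = "lborel \<Otimes>\<^sub>M lborel :: (R3 \<times> R3) measure"
  note s = sq_int_pair_shift[OF assms _ emeasure_lborel_ball_finite[of "0::R3" e]]
  have 1: "sq_int ?W (\<lambda>(x, h). indicator (ball 0 e) h *\<^sub>R u (x + h))"
    "nsq ?W (\<lambda>(x, h). indicator (ball 0 e) h *\<^sub>R u (x + h)) \<le> measure lborel (ball (0::R3) e) * nsq lborel u"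
    by (rule s[of "\<lambda>h. h"]; simp)+
  have 2: "sq_int ?W (\<lambda>(x, h). indicator (ball 0 e) h *\<^sub>R u (x + 0))"
    "nsq ?W (\<lambda>(x, h). indicator (ball 0 e) h *\<^sub>R u (x + 0)) \<le> measure lborel (ball (0::R3) e) * nsq lborel u"
    by (rule s[of "\<lambda>h. 0"]; simp)+
  have eq: "osc_fun e u = (\<lambda>p. (case p of (x, h) \<Rightarrow> indicator (ball 0 e) h *\<^sub>R u (x + h))
      - (case p of (x, h) \<Rightarrow> indicator (ball 0 e) h *\<^sub>R u (x + 0)))"
    by (auto simp: osc_fun_def algebra_simps)
  show "sq_int ?W (osc_fun e u)" unfolding eq by (rule sq_int_diff[OF 1(1) 2(1)])
  show "osc e u \<le> 4 * measure lborel (ball (0::R3) e) * nsq lborel u"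
    unfolding osc_def eq using nsq_diff_le[OF 1(1) 2(1)] 1(2) 2(2) by linarith
qed

text \<open>With x innermost a fixed shift is compared with a gradient; with h innermost a fixed
  point is compared with averages around it. Both orders are used.\<close>

lemma osc_eq_nn_integral:
  assumes "sq_int lborel u"
  shows "ennreal (osc e u) = (\<integral>\<^sup>+h. indicator (ball 0 e) h * (\<integral>\<^sup>+x. ennreal ((u (x + h) - u x)\<^sup>2) \<partial>lborel) \<partial>lborel)"
    "ennreal (osc e u) = (\<integral>\<^sup>+x. \<integral>\<^sup>+h. ennreal ((osc_fun e u (x, h))\<^sup>2) \<partial>lborel \<partial>lborel)"
proof -
  have [measurable]: "u \<in> borel_measurable borel" using assms by (auto simp: sq_int_def)
  have m[measurable]: "osc_fun e u \<in> borel_measurable (lborel \<Otimes>\<^sub>M lborel)"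
    using osc_fun_sq_int[OF assms] by auto
  have "ennreal (osc e u) = (\<integral>\<^sup>+p. ennreal ((norm (osc_fun e u p))\<^sup>2) \<partial>(lborel \<Otimes>\<^sub>M lborel))"
    unfolding osc_def using nn_integral_sq_int[OF osc_fun_sq_int(1)[OF assms]] by simp
  also have "\<dots> = (\<integral>\<^sup>+h. \<integral>\<^sup>+x. ennreal ((norm (osc_fun e u (x, h)))\<^sup>2) \<partial>lborel \<partial>lborel)"
    by (subst lborel_pair.nn_integral_snd[symmetric]) auto
  also have "\<dots> = (\<integral>\<^sup>+h. \<integral>\<^sup>+x. indicator (ball 0 e) h * ennreal ((u (x + h) - u x)\<^sup>2) \<partial>lborel \<partial>lborel)"
    by (intro nn_integral_cong) (auto simp: osc_fun_def indicator_def)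
  also have "\<dots> = (\<integral>\<^sup>+h. indicator (ball 0 e) h * (\<integral>\<^sup>+x. ennreal ((u (x + h) - u x)\<^sup>2) \<partial>lborel) \<partial>lborel)"
    by (intro nn_integral_cong nn_integral_cmult) measurable
  finally show "ennreal (osc e u) = \<dots>" .
  have "ennreal (osc e u) = (\<integral>\<^sup>+p. ennreal ((norm (osc_fun e u p))\<^sup>2) \<partial>(lborel \<Otimes>\<^sub>M lborel))"
    unfolding osc_def using nn_integral_sq_int[OF osc_fun_sq_int(1)[OF assms]] by simp
  also have "\<dots> = (\<integral>\<^sup>+x. \<integral>\<^sup>+h. ennreal ((norm (osc_fun e u (x, h)))\<^sup>2) \<partial>lborel \<partial>lborel)"
    by (subst lborel.nn_integral_fst[symmetric]) auto
  finally show "ennreal (osc e u) = (\<integral>\<^sup>+x. \<integral>\<^sup>+h. ennreal ((osc_fun e u (x, h))\<^sup>2) \<partial>lborel \<partial>lborel)"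
    by simp
qed

subsection \<open>Weak gradients and mean square oscillation\<close>

lemma borel_measurable_vec_nth' [measurable (raw)]:
  fixes f :: "'a \<Rightarrow> real ^ 'n"
  assumes "f \<in> borel_measurable M"
  shows "(\<lambda>x. f x $ i) \<in> borel_measurable M"
  by (rule measurable_compose[OF assms]) (intro borel_measurable_continuous_onI continuous_intros)

lemma L2grad_iff: "L2grad g \<longleftrightarrow> sq_int lborel g"
  by (simp add: L2grad_def sq_int_def)

lemma H1_iff: "H1 u \<longleftrightarrow> sq_int lborel u \<and> (\<exists>g. sq_int lborel g \<and> weak_grad u g)"
  by (simp add: H1_def sq_int_real_iff L2grad_iff)

lemma sq_int_inner_const:
  fixes a :: "'b::euclidean_space"
  assumes "sq_int M g"
  shows "sq_int M (\<lambda>x. a \<bullet> g x)"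
  by (rule sq_int_bound[OF sq_int_scaleR[OF assms, of "norm a"]])
     (use assms in \<open>auto simp: Cauchy_Schwarz_ineq2\<close>)

lemma sq_int_component:
  fixes g :: "'a \<Rightarrow> real ^ 'n"
  assumes "sq_int M g"
  shows "sq_int M (\<lambda>x. g x $ i)"
  using sq_int_inner_const[OF assms, of "axis i 1"] by (simp add: inner_axis' )

text \<open>Cauchy-Schwarz against the indicator of A, stated in \<open>ennreal\<close> so that it
  applies to every section under a Fubini integral, integrable or not.\<close>

lemma sq_integral_le:
  fixes f :: "'a \<Rightarrow> real"
  assumes [measurable]: "f \<in> borel_measurable M" "A \<in> sets M" and A: "emeasure M A < \<infinity>"
  shows "ennreal ((\<integral>x. indicator A x * f x \<partial>M)\<^sup>2)
    \<le> ennreal (measure M A) * (\<integral>\<^sup>+x. ennreal ((indicator A x * f x)\<^sup>2) \<partial>M)"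
proof (cases "(\<integral>\<^sup>+x. ennreal ((indicator A x * f x)\<^sup>2) \<partial>M) = \<infinity>")
  case True
  show ?thesis
  proof (cases "measure M A = 0")
    case False
    then show ?thesis using True by (simp add: ennreal_mult_top)
  next
    \<comment> \<open>Here the right side is 0 times infinity, which is 0 in \<open>ennreal\<close>,
      so the left side has to vanish too.\<close>
    case m0: True
    then have "emeasure M A = 0" using A by (simp add: emeasure_eq_ennreal_measure less_top)
    then have "A \<in> null_sets M" by (simp add: null_sets_def)
    from AE_not_in[OF this] have "AE x in M. indicator A x * f x = 0"
      by eventually_elim simp
    then have "(\<integral>x. indicator A x * f x \<partial>M) = 0" by (rule integral_eq_zero_AE)
    then show ?thesis by simp
  qed
next
  case False
  then have f: "sq_int M (\<lambda>x. indicator A x * f x)"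
    by (auto simp: sq_int_def less_top intro!: integrableI_bounded)
  have i: "nsq M (\<lambda>x. indicator A x :: real) = measure M A"
  proof -
    have "(\<lambda>x. (norm (indicator A x :: real))\<^sup>2) = indicator A" by (auto simp: indicator_def)
    then show ?thesis by (simp add: nsq_def)
  qed
  have "(\<integral>x. indicator A x * (indicator A x * f x) \<partial>M) = (\<integral>x. indicator A x * f x \<partial>M)"
    by (intro Bochner_Integration.integral_cong) (auto simp: indicator_def)
  then have "(\<integral>x. indicator A x * f x \<partial>M)\<^sup>2 \<le> measure M A * nsq M (\<lambda>x. indicator A x * f x)"
    using nsq_Cauchy_Schwarz_real[OF sq_int_indicator[OF _ A] f] i by simp
  then show ?thesis
    using nn_integral_sq_int[OF f] by (simp add: ennreal_mult[symmetric] ennreal_leI)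
qed

text \<open>With c = h and k the derivative in direction h, this is the right side of the
  fundamental theorem of calculus on the segment from x to x + h.\<close>

definition segment_avg :: "R3 \<Rightarrow> (R3 \<Rightarrow> real) \<Rightarrow> R3 \<Rightarrow> real" where
  "segment_avg c k x = (\<integral>t. indicator {0..1} t * k (x + t *\<^sub>R c) \<partial>lborel)"

lemma segment_avg_sq_int:
  assumes k: "sq_int lborel k"
  shows "sq_int lborel (segment_avg c k)" "nsq lborel (segment_avg c k) \<le> nsq lborel k"
proof -
  have [measurable]: "k \<in> borel_measurable borel" using k by (auto simp: sq_int_def)
  have e1: "emeasure lborel {0..1::real} < \<infinity>" by simp
  define F where "F = (\<lambda>(x, t). indicator {0..1::real} t *\<^sub>R k (x + t *\<^sub>R c))"
  have F: "sq_int (lborel \<Otimes>\<^sub>M lborel) F" "nsq (lborel \<Otimes>\<^sub>M lborel) F \<le> nsq lborel k"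
    using sq_int_pair_shift[OF k _ e1, of "\<lambda>t. t *\<^sub>R c"] by (auto simp: F_def)
  have [measurable]: "F \<in> borel_measurable (lborel \<Otimes>\<^sub>M lborel)" using F by auto
  have m: "segment_avg c k \<in> borel_measurable lborel"
    unfolding segment_avg_def by measurable
  have "ennreal ((segment_avg c k x)\<^sup>2) \<le> (\<integral>\<^sup>+t. ennreal ((F (x, t))\<^sup>2) \<partial>lborel)" for x
    using sq_integral_le[of "\<lambda>t. k (x + t *\<^sub>R c)" lborel "{0..1::real}"] by (simp add: segment_avg_def F_def)
  then have "(\<integral>\<^sup>+x. ennreal ((norm (segment_avg c k x))\<^sup>2) \<partial>lborel) \<le> (\<integral>\<^sup>+x. \<integral>\<^sup>+t. ennreal ((F (x, t))\<^sup>2) \<partial>lborel \<partial>lborel)"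
    by (auto intro!: nn_integral_mono)
  also have "\<dots> = (\<integral>\<^sup>+p. ennreal ((norm (F p))\<^sup>2) \<partial>(lborel \<Otimes>\<^sub>M lborel))"
    by (subst lborel.nn_integral_fst[symmetric]) auto
  also have "\<dots> \<le> ennreal (nsq lborel k)"
    using nn_integral_sq_int[OF F(1)] F(2) by (simp add: ennreal_leI)
  finally show "sq_int lborel (segment_avg c k)" "nsq lborel (segment_avg c k) \<le> nsq lborel k"
    using m by (auto intro!: sq_intI_nn_integral)
qed

lemma integral_shift:
  fixes f :: "'a::euclidean_space \<Rightarrow> real"
  assumes "f \<in> borel_measurable borel"
  shows "(\<integral>x. f (x + c) \<partial>lborel) = (\<integral>x. f x \<partial>lborel)"
  using measure_preserving_integral[OF measure_preserving_plus, of f] assms by simp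

lemma sq_int_shift:
  fixes k :: "'a::euclidean_space \<Rightarrow> 'b::euclidean_space"
  assumes "sq_int lborel k"
  shows "sq_int lborel (\<lambda>x. k (x + c))" "nsq lborel (\<lambda>x. k (x + c)) = nsq lborel k"
  using measure_preserving_sq_int[OF measure_preserving_plus assms] by auto

text \<open>Fubini and a translation in x: averaging along c is adjoint to averaging along
  -c.\<close>

lemma segment_avg_pairing:
  assumes k: "sq_int lborel k" and \<psi>: "sq_int lborel \<psi>"
  shows "(\<integral>x. segment_avg c k x * \<psi> x \<partial>lborel)
    = (\<integral>t. indicator {0..1} t * (\<integral>x. k x * \<psi> (x - t *\<^sub>R c) \<partial>lborel) \<partial>lborel)"
proof -
  have [measurable]: "k \<in> borel_measurable borel" "\<psi> \<in> borel_measurable borel"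
    using k \<psi> by (auto simp: sq_int_def)
  have e1: "emeasure lborel {0..1::real} < \<infinity>" by simp
  \<comment> \<open>The indicator is placed in both factors so that each of them is square
    integrable on the product.\<close>
  let ?F = "\<lambda>x t. (indicator {0..1::real} t * k (x + t *\<^sub>R c)) * (indicator {0..1::real} t * \<psi> x)"
  have "integrable (lborel \<Otimes>\<^sub>M lborel) (\<lambda>p. (case p of (x, t) \<Rightarrow> indicator {0..1::real} t *\<^sub>R k (x + t *\<^sub>R c))
      * (case p of (x, t) \<Rightarrow> indicator {0..1::real} t *\<^sub>R \<psi> (x + 0)))"
    by (intro sq_int_mult_integrable sq_int_pair_shift[OF k _ e1] sq_int_pair_shift[OF \<psi> _ e1]) auto
  then have int: "integrable (lborel \<Otimes>\<^sub>M lborel) (\<lambda>(x, t). ?F x t)"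
    by (simp add: split_beta')
  have "(\<integral>x. segment_avg c k x * \<psi> x \<partial>lborel) = (\<integral>x. (\<integral>t. ?F x t \<partial>lborel) \<partial>lborel)"
  proof -
    have *: "?F x t = (indicator {0..1} t * k (x + t *\<^sub>R c)) * \<psi> x" for x t
      by (simp add: indicator_def)
    show ?thesis unfolding segment_avg_def * by simp
  qed
  also have "\<dots> = (\<integral>t. (\<integral>x. ?F x t \<partial>lborel) \<partial>lborel)"
    by (rule lborel_pair.Fubini_integral[OF int, symmetric])
  also have "\<dots> = (\<integral>t. indicator {0..1} t * (\<integral>x. k x * \<psi> (x - t *\<^sub>R c) \<partial>lborel) \<partial>lborel)"
  proof (intro Bochner_Integration.integral_cong refl)
    fix t :: real
    have "(\<integral>x. ?F x t \<partial>lborel) = indicator {0..1} t * (\<integral>x. k (x + t *\<^sub>R c) * \<psi> x \<partial>lborel)"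
    proof -
      have *: "?F x t = indicator {0..1} t * (k (x + t *\<^sub>R c) * \<psi> x)" for x
        by (simp add: indicator_def)
      show ?thesis unfolding * by simp
    qed
    also have "(\<integral>x. k (x + t *\<^sub>R c) * \<psi> x \<partial>lborel) = (\<integral>x. k x * \<psi> (x - t *\<^sub>R c) \<partial>lborel)"
      using integral_shift[of "\<lambda>x. k x * \<psi> (x - t *\<^sub>R c)" "t *\<^sub>R c"] by simp
    finally show "(\<integral>x. ?F x t \<partial>lborel) = indicator {0..1} t * (\<integral>x. k x * \<psi> (x - t *\<^sub>R c) \<partial>lborel)" .
  qed
  finally show ?thesis .
qed

lemma test_fun_dir_deriv:
  assumes "test_fun \<phi>"
  shows "sq_int lborel (\<lambda>x. \<Sum>i\<in>UNIV. h $ i * partial i \<phi> x)"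
    "continuous_on UNIV (\<lambda>x. \<Sum>i\<in>UNIV. h $ i * partial i \<phi> x)"
proof -
  have "sq_int lborel (\<lambda>x. h $ 1 * partial 1 \<phi> x + (h $ 2 * partial 2 \<phi> x + h $ 3 * partial 3 \<phi> x))"
    by (intro sq_int_add sq_int_cmult test_fun_sq_int test_fun_partial assms)
  then show "sq_int lborel (\<lambda>x. \<Sum>i\<in>UNIV. h $ i * partial i \<phi> x)"
    by (simp add: sum_3 add.assoc)
  show "continuous_on UNIV (\<lambda>x. \<Sum>i\<in>UNIV. h $ i * partial i \<phi> x)"
    by (intro continuous_intros test_fun_continuous test_fun_partial assms)
qed

lemma segment_avg_dir_deriv:
  assumes "test_fun \<phi>"
  shows "segment_avg (- h) (\<lambda>x. \<Sum>i\<in>UNIV. h $ i * partial i \<phi> x) x = \<phi> x - \<phi> (x - h)"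
proof -
  let ?d = "\<lambda>x. \<Sum>i\<in>UNIV. h $ i * partial i \<phi> x"
  have "(\<integral>t. indicator {0..1::real} t *\<^sub>R (- ?d (x + t *\<^sub>R - h)) \<partial>lborel) = \<phi> (x + 1 *\<^sub>R - h) - \<phi> (x + 0 *\<^sub>R - h)"
  proof (rule integral_FTC_atLeastAtMost)
    fix t :: real
    have "((\<lambda>t. x + t *\<^sub>R - h) has_derivative (\<lambda>s. s *\<^sub>R - h)) (at t within {0..1})"
      by (auto intro!: derivative_eq_intros)
    from has_derivative_compose[OF this has_derivative_partial[OF test_fun_differentiable[OF assms]]]
    show "((\<lambda>t. \<phi> (x + t *\<^sub>R - h)) has_vector_derivative (- ?d (x + t *\<^sub>R - h))) (at t within {0..1})"
      by (simp add: has_vector_derivative_def sum_negf sum_distrib_left mult.assoc)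
    show "continuous_on {0..1} (\<lambda>t. - ?d (x + t *\<^sub>R - h))"
      by (intro continuous_intros continuous_on_compose2[OF test_fun_dir_deriv(2)[OF assms]]) auto
  qed auto
  then show ?thesis by (simp add: segment_avg_def)
qed

text \<open>Fundamental theorem of calculus for weak gradients. Tested against phi, the average of h
  . g moves onto translates of phi, where the weak gradient produces directional derivatives of phi;
  these integrate along the segment to a difference of phi, and a translation returns the difference
  to u.\<close>

lemma shift_diff_eq_segment_avg:
  assumes u: "sq_int lborel u" and g: "sq_int lborel g" and w: "weak_grad u g"
  shows "AE x in lborel. u (x + h) - u x = segment_avg h (\<lambda>x. h \<bullet> g x) x"
proof -
  define k where "k = (\<lambda>x. h \<bullet> g x)"
  have k: "sq_int lborel k" unfolding k_def by (rule sq_int_inner_const[OF g])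
  have [measurable]: "u \<in> borel_measurable borel" using u by (auto simp: sq_int_def)
  have us: "sq_int lborel (\<lambda>x. u (x + h))" by (rule sq_int_shift[OF u])
  have "AE x in lborel. (u (x + h) - u x) - segment_avg h k x = 0"
  proof (rule test_fun_orthogonal_imp_AE_zero)
    show "sq_int lborel (\<lambda>x. (u (x + h) - u x) - segment_avg h k x)"
      by (intro sq_int_diff us u segment_avg_sq_int k)
    fix \<phi> assume \<phi>: "test_fun \<phi>"
    have [measurable]: "\<phi> \<in> borel_measurable borel" using \<phi> by (rule test_fun_measurable)
    note \<phi>2 = test_fun_sq_int[OF \<phi>]
    define d where "d = (\<lambda>x. \<Sum>i\<in>UNIV. h $ i * partial i \<phi> x)"
    have d: "sq_int lborel d" unfolding d_def by (rule test_fun_dir_deriv[OF \<phi>])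
    have kt: "(\<integral>x. k x * \<phi> (x - t *\<^sub>R h) \<partial>lborel) = - (\<integral>x. u x * d (x - t *\<^sub>R h) \<partial>lborel)" for t
    proof -
      let ?\<phi> = "\<lambda>x. \<phi> (x - t *\<^sub>R h)"
      have t: "test_fun ?\<phi>" by (rule test_fun_shift[OF \<phi>])
      have gi: "integrable lborel (\<lambda>x. g x $ i * ?\<phi> x)" for i
        by (intro sq_int_mult_integrable sq_int_component g test_fun_sq_int t)
      have ui: "integrable lborel (\<lambda>x. u x * partial i ?\<phi> x)" for i
        by (intro sq_int_mult_integrable u test_fun_sq_int test_fun_partial t)
      have "(\<integral>x. k x * ?\<phi> x \<partial>lborel) = (\<integral>x. (\<Sum>i\<in>UNIV. h $ i * (g x $ i * ?\<phi> x)) \<partial>lborel)"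
        by (simp add: k_def inner_vec_def sum_distrib_right mult.assoc)
      also have "\<dots> = (\<Sum>i\<in>UNIV. h $ i * (\<integral>x. g x $ i * ?\<phi> x \<partial>lborel))"
        using gi by (simp add: Bochner_Integration.integral_sum)
      also have "\<dots> = (\<Sum>i\<in>UNIV. - (h $ i * (\<integral>x. u x * partial i ?\<phi> x \<partial>lborel)))"
        using w t unfolding weak_grad_def by simp
      also have "\<dots> = - (\<integral>x. (\<Sum>i\<in>UNIV. h $ i * (u x * partial i ?\<phi> x)) \<partial>lborel)"
        using ui by (simp add: Bochner_Integration.integral_sum sum_negf)
      also have "\<dots> = - (\<integral>x. u x * d (x - t *\<^sub>R h) \<partial>lborel)"
        by (simp add: d_def partial_shift[OF test_fun_differentiable[OF \<phi>]] sum_distrib_left mult.left_commute)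
      finally show ?thesis .
    qed
    have "(\<integral>x. segment_avg h k x * \<phi> x \<partial>lborel)
        = (\<integral>t. indicator {0..1} t * (- (\<integral>x. u x * d (x - t *\<^sub>R h) \<partial>lborel)) \<partial>lborel)"
      by (simp add: segment_avg_pairing[OF k \<phi>2] kt)
    also have "\<dots> = - (\<integral>t. indicator {0..1} t * (\<integral>x. d x * u (x - t *\<^sub>R - h) \<partial>lborel) \<partial>lborel)"
    proof -
      have "(\<integral>x. u x * d (x - t *\<^sub>R h) \<partial>lborel) = (\<integral>x. d x * u (x - t *\<^sub>R - h) \<partial>lborel)" for t
      proof -
        have [measurable]: "d \<in> borel_measurable borel" using d by (auto simp: sq_int_def)
        show ?thesis
          using integral_shift[of "\<lambda>x. u x * d (x - t *\<^sub>R h)" "t *\<^sub>R h"] by (simp add: mult.commute)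
      qed
      then show ?thesis by simp
    qed
    \<comment> \<open>The pairing lemma read backwards in the opposite direction: the function
      averaged is now a derivative of the test function, to which the classical theorem
      applies.\<close>
    also have "\<dots> = - (\<integral>x. segment_avg (- h) d x * u x \<partial>lborel)"
      by (simp add: segment_avg_pairing[OF d u])
    also have "\<dots> = (\<integral>x. u x * \<phi> (x - h) - u x * \<phi> x \<partial>lborel)"
      by (simp add: d_def segment_avg_dir_deriv[OF \<phi>] algebra_simps flip: Bochner_Integration.integral_minus)
    also have "\<dots> = (\<integral>x. u x * \<phi> (x - h) \<partial>lborel) - (\<integral>x. u x * \<phi> x \<partial>lborel)"
      by (intro Bochner_Integration.integral_diff sq_int_mult_integrable u \<phi>2 test_fun_sq_int[OF test_fun_shift[OF \<phi>]])
    also have "(\<integral>x. u x * \<phi> (x - h) \<partial>lborel) = (\<integral>x. u (x + h) * \<phi> x \<partial>lborel)"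
      using integral_shift[of "\<lambda>x. u x * \<phi> (x - h)" h] by simp
    finally have eq: "(\<integral>x. segment_avg h k x * \<phi> x \<partial>lborel)
        = (\<integral>x. u (x + h) * \<phi> x \<partial>lborel) - (\<integral>x. u x * \<phi> x \<partial>lborel)" .
    show "(\<integral>x. ((u (x + h) - u x) - segment_avg h k x) * \<phi> x \<partial>lborel) = 0"
      using sq_int_mult_integrable[OF us \<phi>2] sq_int_mult_integrable[OF u \<phi>2]
        sq_int_mult_integrable[OF segment_avg_sq_int(1)[OF k, of h] \<phi>2] eq
      by (simp add: left_diff_distrib)
  qed
  then show ?thesis unfolding k_def by eventually_elim simp
qed

lemma nsq_shift_diff_le:
  assumes "sq_int lborel u" "sq_int lborel g" "weak_grad u g"
  shows "nsq lborel (\<lambda>x. u (x + h) - u x) \<le> nsq lborel (\<lambda>x. h \<bullet> g x)"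
proof -
  have [measurable]: "u \<in> borel_measurable borel" using assms by (auto simp: sq_int_def)
  have k: "sq_int lborel (\<lambda>x. h \<bullet> g x)" by (rule sq_int_inner_const[OF assms(2)])
  have [measurable]: "segment_avg h (\<lambda>x. h \<bullet> g x) \<in> borel_measurable borel"
    using segment_avg_sq_int(1)[OF k, of h] by (auto simp: sq_int_def)
  have "nsq lborel (\<lambda>x. u (x + h) - u x) = nsq lborel (segment_avg h (\<lambda>x. h \<bullet> g x))"
    unfolding nsq_def using shift_diff_eq_segment_avg[OF assms, of h]
    by (intro integral_cong_AE) auto
  also have "\<dots> \<le> nsq lborel (\<lambda>x. h \<bullet> g x)" by (rule segment_avg_sq_int(2)[OF k])
  finally show ?thesis .
qed

text \<open>Integrate the bound for a single shift over the ball and exchange the integrals; for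
  each x the inner integral of (h . g x)^2 is \<open>moment e\<close> times |g x|^2. This is the
  exact counterpart of \<open>weak_grad_of_osc_bound\<close>.\<close>

lemma osc_le_moment:
  assumes u: "sq_int lborel u" and g: "sq_int lborel g" and w: "weak_grad u g"
  shows "osc e u \<le> moment e * nsq lborel g"
proof -
  have [measurable]: "u \<in> borel_measurable borel" "g \<in> borel_measurable borel"
    using u g by (auto simp: sq_int_def)
  have "ennreal (osc e u) \<le> (\<integral>\<^sup>+h. indicator (ball 0 e) h * (\<integral>\<^sup>+x. ennreal ((h \<bullet> g x)\<^sup>2) \<partial>lborel) \<partial>lborel)"
  proof -
    have "(\<integral>\<^sup>+x. ennreal ((u (x + h) - u x)\<^sup>2) \<partial>lborel) \<le> (\<integral>\<^sup>+x. ennreal ((h \<bullet> g x)\<^sup>2) \<partial>lborel)" for h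
    proof -
      have "(\<integral>\<^sup>+x. ennreal ((u (x + h) - u x)\<^sup>2) \<partial>lborel) = ennreal (nsq lborel (\<lambda>x. u (x + h) - u x))"
        using nn_integral_sq_int[OF sq_int_diff[OF sq_int_shift(1)[OF u, of h] u]] by simp
      also have "\<dots> \<le> ennreal (nsq lborel (\<lambda>x. h \<bullet> g x))"
        by (intro ennreal_leI nsq_shift_diff_le[OF assms])
      also have "\<dots> = (\<integral>\<^sup>+x. ennreal ((h \<bullet> g x)\<^sup>2) \<partial>lborel)"
        using nn_integral_sq_int[OF sq_int_inner_const[OF g, of h]] by simp
      finally show ?thesis .
    qed
    note * = this
    show ?thesis
      unfolding osc_eq_nn_integral(1)[OF u] by (rule nn_integral_mono, rule mult_left_mono, rule *, simp)
  qed
  also have "\<dots> = (\<integral>\<^sup>+h. \<integral>\<^sup>+x. indicator (ball 0 e) h * ennreal ((h \<bullet> g x)\<^sup>2) \<partial>lborel \<partial>lborel)"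
    by (intro nn_integral_cong nn_integral_cmult[symmetric]) measurable
  also have "\<dots> = (\<integral>\<^sup>+x. \<integral>\<^sup>+h. indicator (ball 0 e) h * ennreal ((h \<bullet> g x)\<^sup>2) \<partial>lborel \<partial>lborel)"
    by (rule lborel_pair.Fubini') measurable
  also have "\<dots> = (\<integral>\<^sup>+x. ennreal (moment e * (norm (g x))\<^sup>2) \<partial>lborel)"
  proof (intro nn_integral_cong)
    fix x
    have "(\<integral>\<^sup>+h. indicator (ball 0 e) h * ennreal ((h \<bullet> g x)\<^sup>2) \<partial>lborel)
        = (\<integral>\<^sup>+h. ennreal (indicator (ball 0 e) h * (h \<bullet> g x)\<^sup>2) \<partial>lborel)"
      by (intro nn_integral_cong) (auto simp: indicator_def)
    also have "\<dots> = ennreal (\<integral>h. indicator (ball 0 e) h * (h \<bullet> g x)\<^sup>2 \<partial>lborel)"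
      using ball_inner_integrable[of e "g x" "g x"]
      by (intro nn_integral_eq_integral) (auto simp: power2_eq_square)
    finally show "(\<integral>\<^sup>+h. indicator (ball 0 e) h * ennreal ((h \<bullet> g x)\<^sup>2) \<partial>lborel) = ennreal (moment e * (norm (g x))\<^sup>2)"
      by (simp add: moment_sq)
  qed
  also have "\<dots> = ennreal (moment e) * ennreal (nsq lborel g)"
    using nn_integral_sq_int[OF g] moment_nonneg[of e]
    by (simp add: ennreal_mult nn_integral_cmult)
  finally show ?thesis
    using moment_nonneg[of e] by (simp add: ennreal_mult[symmetric])
qed

text \<open>An averaged difference quotient; by \<open>moment_inner\<close> its value on an affine
  function is the gradient, for every e > 0.\<close>

definition diff_quot :: "real \<Rightarrow> (R3 \<Rightarrow> real) \<Rightarrow> R3 \<Rightarrow> R3" where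
  "diff_quot e v x = (1 / moment e) *\<^sub>R (\<integral>h. osc_fun e v (x, h) *\<^sub>R h \<partial>lborel)"

lemma osc_fun_section:
  assumes v: "sq_int lborel v"
  shows "sq_int lborel (\<lambda>h. osc_fun e v (x, h))"
proof -
  have [measurable]: "v \<in> borel_measurable borel" using v by (auto simp: sq_int_def)
  have i: "sq_int lborel (\<lambda>h. indicator (ball (0::R3) e) h :: real)"
    by (intro sq_int_indicator emeasure_lborel_ball_finite) simp
  have 1: "sq_int lborel (\<lambda>h. indicator (ball 0 e) h * v (h + x))"
    by (rule bounded_mult_sq_int(1)[OF sq_int_shift(1)[OF v], of _ 1]) (auto simp: indicator_def)
  have 2: "sq_int lborel (\<lambda>h. v x * indicator (ball (0::R3) e) h)"
    by (rule sq_int_cmult[OF i])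
  show ?thesis
    using sq_int_diff[OF 1 2] by (simp add: osc_fun_def algebra_simps)
qed

text \<open>The alternative \<open>moment e = 0\<close> is listed because division by it yields 0;
  positivity of the moment excludes it wherever e > 0.\<close>

lemma osc_fun_inner:
  assumes v: "sq_int lborel v"
  shows "integrable lborel (\<lambda>h. osc_fun e v (x, h) *\<^sub>R h)"
    "moment e * (diff_quot e v x \<bullet> a) = (\<integral>h. osc_fun e v (x, h) * (h \<bullet> a) \<partial>lborel) \<or> moment e = 0"
proof -
  have i: "sq_int lborel (\<lambda>h. indicator (ball (0::R3) e) h :: real)"
    by (intro sq_int_indicator emeasure_lborel_ball_finite) simp
  note s = osc_fun_section[OF v, of e x]
  have [measurable]: "(\<lambda>h. osc_fun e v (x, h)) \<in> borel_measurable borel"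
    using s by (auto simp: sq_int_def)
  show int: "integrable lborel (\<lambda>h. osc_fun e v (x, h) *\<^sub>R h)"
  proof (rule Bochner_Integration.integrable_bound)
    show "integrable lborel (\<lambda>h. osc_fun e v (x, h) * (e * indicator (ball 0 e) h))"
      by (intro sq_int_mult_integrable s sq_int_cmult i)
    show "AE h in lborel. norm (osc_fun e v (x, h) *\<^sub>R h) \<le> norm (osc_fun e v (x, h) * (e * indicator (ball 0 e) h))"
      by (auto simp: osc_fun_def indicator_def abs_mult intro!: AE_I2 mult_left_mono)
  qed measurable
  show "moment e * (diff_quot e v x \<bullet> a) = (\<integral>h. osc_fun e v (x, h) * (h \<bullet> a) \<partial>lborel) \<or> moment e = 0"
    using integral_inner_left[of a lborel "\<lambda>h. osc_fun e v (x, h) *\<^sub>R h"] int by (auto simp: diff_quot_def)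
qed

text \<open>Pair a = \<open>diff_quot e v x\<close> with itself. With M the moment and N the section
  of the oscillation at x, Cauchy-Schwarz gives (M |a|^2)^2 <= N * M |a|^2, and cancelling leaves M
  |a|^2 <= N with constant 1.\<close>

lemma diff_quot_sq_int:
  assumes v: "sq_int lborel v" and e: "0 < e"
  shows "sq_int lborel (diff_quot e v)" "nsq lborel (diff_quot e v) \<le> osc e v / moment e"
proof -
  note m = moment_pos[OF e]
  have [measurable]: "osc_fun e v \<in> borel_measurable (lborel \<Otimes>\<^sub>M lborel)"
    using osc_fun_sq_int(1)[OF v] by auto
  have mm: "diff_quot e v \<in> borel_measurable lborel"
    unfolding diff_quot_def by measurable
  have pt: "(norm (diff_quot e v x))\<^sup>2 \<le> nsq lborel (\<lambda>h. osc_fun e v (x, h)) / moment e" for x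
  proof -
    define a where "a = diff_quot e v x"
    define N where "N = nsq lborel (\<lambda>h. osc_fun e v (x, h))"
    have ia: "sq_int lborel (\<lambda>h. indicator (ball 0 e) h * (h \<bullet> a))"
    proof -
      have "(\<lambda>h. (norm (indicator (ball 0 e) h * (h \<bullet> a)))\<^sup>2) = (\<lambda>h. indicator (ball 0 e) h * ((h \<bullet> a) * (h \<bullet> a)))"
        by (auto simp: indicator_def power2_eq_square)
      then show ?thesis using ball_inner_integrable[of e a a] by (simp add: sq_int_def)
    qed
    have na: "nsq lborel (\<lambda>h. indicator (ball 0 e) h * (h \<bullet> a)) = moment e * (norm a)\<^sup>2"
      unfolding nsq_def moment_sq[symmetric]
      by (intro Bochner_Integration.integral_cong) (auto simp: indicator_def)
    have "moment e * (norm a)\<^sup>2 = (\<integral>h. osc_fun e v (x, h) * (h \<bullet> a) \<partial>lborel)"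
      using osc_fun_inner(2)[OF v, of e x a] m by (simp add: a_def power2_norm_eq_inner)
    also have "\<dots> = (\<integral>h. osc_fun e v (x, h) * (indicator (ball 0 e) h * (h \<bullet> a)) \<partial>lborel)"
      by (intro Bochner_Integration.integral_cong) (auto simp: osc_fun_def indicator_def)
    finally have "(moment e * (norm a)\<^sup>2)\<^sup>2 \<le> N * (moment e * (norm a)\<^sup>2)"
      using nsq_Cauchy_Schwarz_real[OF osc_fun_section[OF v, of e x] ia] by (simp add: na N_def)
    then have "moment e * (norm a)\<^sup>2 \<le> N"
    proof (cases "a = 0")
      case True then show ?thesis by (simp add: N_def)
    next
      case False
      then have "0 < moment e * (norm a)\<^sup>2" using m by simp
      then show ?thesis using \<open>(moment e * (norm a)\<^sup>2)\<^sup>2 \<le> N * (moment e * (norm a)\<^sup>2)\<close>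
        by (simp add: power2_eq_square mult_le_cancel_right)
    qed
    then show ?thesis using m by (simp add: a_def N_def field_simps)
  qed
  have "(\<integral>\<^sup>+x. ennreal ((norm (diff_quot e v x))\<^sup>2) \<partial>lborel)
      \<le> (\<integral>\<^sup>+x. ennreal (1 / moment e) * (\<integral>\<^sup>+h. ennreal ((osc_fun e v (x, h))\<^sup>2) \<partial>lborel) \<partial>lborel)"
  proof (rule nn_integral_mono)
    fix x
    have "ennreal (1 / moment e) * (\<integral>\<^sup>+h. ennreal ((osc_fun e v (x, h))\<^sup>2) \<partial>lborel)
        = ennreal (nsq lborel (\<lambda>h. osc_fun e v (x, h)) / moment e)"
      using nn_integral_sq_int[OF osc_fun_section[OF v, of e x]] m by (simp add: ennreal_mult[symmetric])
    then show "ennreal ((norm (diff_quot e v x))\<^sup>2)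
       \<le> ennreal (1 / moment e) * (\<integral>\<^sup>+h. ennreal ((osc_fun e v (x, h))\<^sup>2) \<partial>lborel)"
      using pt[of x] by (simp add: ennreal_leI)
  qed
  also have "\<dots> = ennreal (1 / moment e) * ennreal (osc e v)"
    unfolding osc_eq_nn_integral(2)[OF v] by (rule nn_integral_cmult) measurable
  also have "\<dots> = ennreal (osc e v / moment e)"
    using m by (simp add: ennreal_mult[symmetric] osc_def)
  finally show "sq_int lborel (diff_quot e v)" "nsq lborel (diff_quot e v) \<le> osc e v / moment e"
    using mm m by (auto intro!: sq_intI_nn_integral simp: osc_def)
qed

text \<open>The adjoint of the i-th component of \<open>diff_quot\<close>, acting on the test
  function.\<close>

definition test_quot :: "real \<Rightarrow> 3 \<Rightarrow> (R3 \<Rightarrow> real) \<Rightarrow> R3 \<Rightarrow> real" where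
  "test_quot e i \<phi> x = (1 / moment e) * (\<integral>h. indicator (ball 0 e) h * (h $ i * (\<phi> (x - h) - \<phi> x)) \<partial>lborel)"

lemma diff_quot_pairing:
  assumes v: "sq_int lborel v" and e: "0 < e" and \<phi>: "test_fun \<phi>"
  shows "(\<integral>x. diff_quot e v x $ i * \<phi> x \<partial>lborel) = (\<integral>x. v x * test_quot e i \<phi> x \<partial>lborel)"
proof -
  let ?W = "lborel \<Otimes>\<^sub>M lborel :: (R3 \<times> R3) measure"
  note m = moment_pos[OF e]
  note \<phi>2 = test_fun_sq_int[OF \<phi>]
  have eb: "emeasure lborel (ball (0::R3) e) < \<infinity>" by (rule emeasure_lborel_ball_finite)
  have [measurable]: "v \<in> borel_measurable borel" "\<phi> \<in> borel_measurable borel"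
    using v \<phi>2 by (auto simp: sq_int_def)
  have [measurable]: "osc_fun e v \<in> borel_measurable ?W" using osc_fun_sq_int(1)[OF v] by auto
  have small: "\<bar>indicator (ball 0 e) h * h $ i\<bar> \<le> e * indicator (ball 0 e) h" for h :: R3
    using component_le_norm_cart[of h i] by (auto simp: indicator_def)
  \<comment> \<open>A bounded multiplier carrying the coordinate of h. With a cutoff to the ball in
    every factor, integrability reduces to products of square-integrable functions.\<close>
  define A where "A = (\<lambda>p::R3\<times>R3. indicator (ball 0 e) (snd p) * snd p $ i)"
  have [measurable]: "A \<in> borel_measurable ?W" unfolding A_def by measurable
  have Ab: "\<bar>A p\<bar> \<le> e" for p
    using small[of "snd p"] e by (auto simp: A_def indicator_def)
  have p0: "sq_int ?W (\<lambda>(x, h). indicator (ball 0 e) h *\<^sub>R \<phi> (x + 0))"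
    by (rule sq_int_pair_shift[OF \<phi>2 _ eb]) auto
  have p1: "sq_int ?W (\<lambda>(x, h). indicator (ball 0 e) h *\<^sub>R \<phi> (x + - h))"
    by (rule sq_int_pair_shift[OF \<phi>2 _ eb]) auto
  have v0: "sq_int ?W (\<lambda>(x, h). indicator (ball 0 e) h *\<^sub>R v (x + 0))"
    by (rule sq_int_pair_shift[OF v _ eb]) auto
  have i1: "integrable ?W (\<lambda>(x, h). osc_fun e v (x, h) * (indicator (ball 0 e) h * h $ i) * \<phi> x)"
  proof -
    have "integrable ?W (\<lambda>p. osc_fun e v p * (A p * (case p of (x, h) \<Rightarrow> indicator (ball 0 e) h *\<^sub>R \<phi> (x + 0))))"
      by (intro sq_int_mult_integrable osc_fun_sq_int(1)[OF v] bounded_mult_sq_int(1)[OF p0 _ Ab]) measurable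
    moreover have "(\<lambda>p. osc_fun e v p * (A p * (case p of (x, h) \<Rightarrow> indicator (ball 0 e) h *\<^sub>R \<phi> (x + 0))))
        = (\<lambda>(x, h). osc_fun e v (x, h) * (indicator (ball 0 e) h * h $ i) * \<phi> x)"
      by (auto simp: A_def indicator_def)
    ultimately show ?thesis by simp
  qed
  have i2: "integrable ?W (\<lambda>(x, h). v x * (indicator (ball 0 e) h * (h $ i * (\<phi> (x - h) - \<phi> x))))"
  proof -
    have "integrable ?W (\<lambda>p. (case p of (x, h) \<Rightarrow> indicator (ball 0 e) h *\<^sub>R v (x + 0)) *
        (A p * ((case p of (x, h) \<Rightarrow> indicator (ball 0 e) h *\<^sub>R \<phi> (x + - h))
          - (case p of (x, h) \<Rightarrow> indicator (ball 0 e) h *\<^sub>R \<phi> (x + 0)))))"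
      by (intro sq_int_mult_integrable v0 bounded_mult_sq_int(1)[OF sq_int_diff[OF p1 p0] _ Ab]) measurable
    moreover have "(\<lambda>p. (case p of (x, h) \<Rightarrow> indicator (ball 0 e) h *\<^sub>R v (x + 0)) *
        (A p * ((case p of (x, h) \<Rightarrow> indicator (ball 0 e) h *\<^sub>R \<phi> (x + - h))
          - (case p of (x, h) \<Rightarrow> indicator (ball 0 e) h *\<^sub>R \<phi> (x + 0)))))
       = (\<lambda>(x, h). v x * (indicator (ball 0 e) h * (h $ i * (\<phi> (x - h) - \<phi> x))))"
      by (auto simp: A_def indicator_def)
    ultimately show ?thesis by simp
  qed
  have dq: "diff_quot e v x $ i * \<phi> x
      = (1 / moment e) * (\<integral>h. osc_fun e v (x, h) * (indicator (ball 0 e) h * h $ i) * \<phi> x \<partial>lborel)" for x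
  proof -
    have "moment e * diff_quot e v x $ i = (\<integral>h. osc_fun e v (x, h) * h $ i \<partial>lborel)"
      using osc_fun_inner(2)[OF v, of e x "axis i 1"] m by (simp add: inner_axis)
    also have "\<dots> = (\<integral>h. osc_fun e v (x, h) * (indicator (ball 0 e) h * h $ i) \<partial>lborel)"
      by (intro Bochner_Integration.integral_cong) (auto simp: osc_fun_def indicator_def)
    finally show ?thesis using m by (simp add: field_simps)
  qed
  have inner: "(\<integral>x. osc_fun e v (x, h) * (indicator (ball 0 e) h * h $ i) * \<phi> x \<partial>lborel)
      = (\<integral>x. v x * (indicator (ball 0 e) h * (h $ i * (\<phi> (x - h) - \<phi> x))) \<partial>lborel)" for h
  proof -
    have s: "sq_int lborel (\<lambda>x. \<phi> (x - h))" by (rule test_fun_sq_int[OF test_fun_shift[OF \<phi>]])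
    have "(\<integral>x. osc_fun e v (x, h) * (indicator (ball 0 e) h * h $ i) * \<phi> x \<partial>lborel)
        = (\<integral>x. (indicator (ball 0 e) h * h $ i) * (v (x + h) * \<phi> x - v x * \<phi> x) \<partial>lborel)"
      by (intro Bochner_Integration.integral_cong) (auto simp: osc_fun_def indicator_def algebra_simps)
    also have "\<dots> = (indicator (ball 0 e) h * h $ i) * ((\<integral>x. v (x + h) * \<phi> x \<partial>lborel) - (\<integral>x. v x * \<phi> x \<partial>lborel))"
      by (simp add: sq_int_mult_integrable sq_int_shift(1)[OF v] \<phi>2 v)
    also have "(\<integral>x. v (x + h) * \<phi> x \<partial>lborel) = (\<integral>x. v x * \<phi> (x - h) \<partial>lborel)"
      using integral_shift[of "\<lambda>x. v x * \<phi> (x - h)" h] by simp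
    also have "(indicator (ball 0 e) h * h $ i) * ((\<integral>x. v x * \<phi> (x - h) \<partial>lborel) - (\<integral>x. v x * \<phi> x \<partial>lborel))
        = (\<integral>x. (indicator (ball 0 e) h * h $ i) * (v x * \<phi> (x - h) - v x * \<phi> x) \<partial>lborel)"
      by (simp add: sq_int_mult_integrable s \<phi>2 v)
    also have "\<dots> = (\<integral>x. v x * (indicator (ball 0 e) h * (h $ i * (\<phi> (x - h) - \<phi> x))) \<partial>lborel)"
      by (intro Bochner_Integration.integral_cong) (auto simp: algebra_simps)
    finally show ?thesis .
  qed
  have "(\<integral>x. diff_quot e v x $ i * \<phi> x \<partial>lborel) = (1 / moment e) *
      (\<integral>x. (\<integral>h. osc_fun e v (x, h) * (indicator (ball 0 e) h * h $ i) * \<phi> x \<partial>lborel) \<partial>lborel)"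
    unfolding dq by simp
  also have "\<dots> = (1 / moment e) *
      (\<integral>h. (\<integral>x. osc_fun e v (x, h) * (indicator (ball 0 e) h * h $ i) * \<phi> x \<partial>lborel) \<partial>lborel)"
    by (subst lborel_pair.Fubini_integral[OF i1]) simp
  also have "\<dots> = (1 / moment e) *
      (\<integral>h. (\<integral>x. v x * (indicator (ball 0 e) h * (h $ i * (\<phi> (x - h) - \<phi> x))) \<partial>lborel) \<partial>lborel)"
    unfolding inner ..
  also have "\<dots> = (1 / moment e) *
      (\<integral>x. (\<integral>h. v x * (indicator (ball 0 e) h * (h $ i * (\<phi> (x - h) - \<phi> x))) \<partial>lborel) \<partial>lborel)"
    by (subst lborel_pair.Fubini_integral[OF i2]) simp
  also have "\<dots> = (\<integral>x. (1 / moment e) * (\<integral>h. v x * (indicator (ball 0 e) h * (h $ i * (\<phi> (x - h) - \<phi> x))) \<partial>lborel) \<partial>lborel)"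
    by simp
  also have "\<dots> = (\<integral>x. v x * test_quot e i \<phi> x \<partial>lborel)"
    by (simp add: test_quot_def)
  finally show ?thesis .
qed

text \<open>Since |h_i r(h)| <= c |h|^2, the factor 3 is the one in \<open>moment_norm\<close>.
  Applied with r a Taylor remainder (c small) and with r a Lipschitz difference (c fixed).\<close>

lemma test_quot_remainder:
  assumes e: "0 < e" and r[measurable]: "r \<in> borel_measurable borel" and c: "0 \<le> c"
    and bound: "\<And>h. norm h < e \<Longrightarrow> \<bar>r h\<bar> \<le> c * norm h"
  shows "integrable lborel (\<lambda>h::R3. indicator (ball 0 e) h * (h $ i * r h))"
    "\<bar>(1 / moment e) * (\<integral>h. indicator (ball 0 e) h * (h $ i * r h) \<partial>lborel)\<bar> \<le> 3 * c"
proof -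
  have b: "\<bar>h $ i * r h\<bar> \<le> c * (norm h)\<^sup>2" if "norm h < e" for h
  proof -
    have "\<bar>h $ i * r h\<bar> \<le> norm h * (c * norm h)"
      unfolding abs_mult using bound[OF that] component_le_norm_cart[of h i] by (intro mult_mono) auto
    then show ?thesis by (simp add: power2_eq_square mult_ac)
  qed
  show i: "integrable lborel (\<lambda>h::R3. indicator (ball 0 e) h * (h $ i * r h))"
  proof (rule ball_bounded_integrable[where B="c * e\<^sup>2"])
    show "\<bar>h $ i * r h\<bar> \<le> c * e\<^sup>2" if "norm h < e" for h :: R3
      using b[OF that] c that by (intro order_trans[OF b[OF that]] mult_left_mono power_mono) auto
  qed measurable
  have i2: "integrable lborel (\<lambda>h::R3. indicator (ball 0 e) h * (norm h)\<^sup>2)"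
    by (rule ball_bounded_integrable[where B="e\<^sup>2"]) (auto intro: power_mono)
  have "\<bar>\<integral>h. indicator (ball 0 e) h * (h $ i * r h) \<partial>lborel\<bar>
      \<le> (\<integral>h. c * (indicator (ball 0 e) h * (norm (h::R3))\<^sup>2) \<partial>lborel)"
    using Bochner_Integration.integral_norm_bound_integral[OF i, of "\<lambda>h. c * (indicator (ball 0 e) h * (norm (h::R3))\<^sup>2)"] i2 b
    by (auto simp: indicator_def)
  also have "\<dots> = 3 * c * moment e"
    by (simp add: moment_norm)
  finally show "\<bar>(1 / moment e) * (\<integral>h. indicator (ball 0 e) h * (h $ i * r h) \<partial>lborel)\<bar> \<le> 3 * c"
    using moment_pos[OF e] by (simp add: abs_mult field_simps)
qed

text \<open>To first order phi(x - h) - phi(x) is -(h . grad phi), which contributes exactly minus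
  the partial derivative at every scale; only the Taylor remainder has to tend to 0.\<close>

lemma test_quot_tendsto:
  assumes \<phi>: "test_fun \<phi>" and e: "\<And>n. 0 < e n" "e \<longlonglongrightarrow> 0"
  shows "(\<lambda>n. test_quot (e n) i \<phi> x) \<longlonglongrightarrow> - partial i \<phi> x"
proof (rule LIMSEQ_I)
  fix \<eta> :: real assume \<eta>: "0 < \<eta>"
  have [measurable]: "\<phi> \<in> borel_measurable borel" using \<phi> by (rule test_fun_measurable)
  define G where "G = (\<chi> j. partial j \<phi> x)"
  have D: "(\<phi> has_derivative (\<lambda>h. h \<bullet> G)) (at x)"
    using has_derivative_partial[OF test_fun_differentiable[OF \<phi>], of x] by (simp add: G_def inner_vec_def)
  \<comment> \<open>The factor 3 of \<open>test_quot_remainder\<close> turns \<eta> / 4 into less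
    than \<eta>.\<close>
  then obtain d where d: "0 < d" "\<And>y. norm (y - x) < d \<Longrightarrow> norm (\<phi> y - \<phi> x - (y - x) \<bullet> G) \<le> \<eta> / 4 * norm (y - x)"
    using \<eta> unfolding has_derivative_at_alt by (metis zero_less_divide_iff zero_less_numeral)
  obtain N where N: "\<And>n. n \<ge> N \<Longrightarrow> e n < d"
    using order_tendstoD(2)[OF e(2) d(1)] by (auto simp: eventually_sequentially)
  have "norm (test_quot (e n) i \<phi> x - - partial i \<phi> x) < \<eta>" if "n \<ge> N" for n
  proof -
    note m = moment_pos[OF e(1)[of n]]
    define r where "r h = \<phi> (x - h) - \<phi> x + h \<bullet> G" for h
    have [measurable]: "r \<in> borel_measurable borel" unfolding r_def by measurable
    have rb: "\<bar>r h\<bar> \<le> \<eta> / 4 * norm h" if "norm h < e n" for h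
      using d(2)[of "x - h"] N[OF \<open>n \<ge> N\<close>] that by (simp add: r_def)
    have \<eta>4: "0 \<le> \<eta> / 4" using \<eta> by simp
    have "(\<integral>h. indicator (ball 0 (e n)) h * (h $ i * (\<phi> (x - h) - \<phi> x)) \<partial>lborel)
        = (\<integral>h. indicator (ball 0 (e n)) h * (h $ i * r h)
            - indicator (ball 0 (e n)) h * ((h \<bullet> axis i 1) * (h \<bullet> G)) \<partial>lborel)"
      by (intro Bochner_Integration.integral_cong) (auto simp: r_def inner_axis algebra_simps)
    also have "\<dots> = (\<integral>h. indicator (ball 0 (e n)) h * (h $ i * r h) \<partial>lborel) - moment (e n) * G $ i"
      using test_quot_remainder(1)[OF e(1)[of n] _ \<eta>4 rb, where i=i] ball_inner_integrable[of "e n" "axis i 1" G]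
      by (simp add: moment_inner inner_axis')
    finally have "test_quot (e n) i \<phi> x + G $ i
        = (1 / moment (e n)) * (\<integral>h. indicator (ball 0 (e n)) h * (h $ i * r h) \<partial>lborel)"
      using m by (simp add: test_quot_def field_simps)
    then have "\<bar>test_quot (e n) i \<phi> x + G $ i\<bar> \<le> 3 * (\<eta> / 4)"
      using test_quot_remainder(2)[OF e(1)[of n] _ \<eta>4 rb, where i=i] by simp
    then show ?thesis using \<eta> by (simp add: G_def)
  qed
  then show "\<exists>N. \<forall>n\<ge>N. norm (test_quot (e n) i \<phi> x - - partial i \<phi> x) < \<eta>" by blast
qed

text \<open>For e <= 1 the support grows by at most 1, and the Lipschitz constant bounds the
  quotient uniformly in e. This is the majorant for dominated convergence.\<close>

lemma test_quot_bound:
  assumes \<phi>: "test_fun \<phi>"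
  obtains C R where "\<And>e x i. 0 < e \<Longrightarrow> e \<le> 1 \<Longrightarrow> \<bar>test_quot e i \<phi> x\<bar> \<le> C * indicator (ball 0 R) x"
proof -
  have [measurable]: "\<phi> \<in> borel_measurable borel" using \<phi> by (rule test_fun_measurable)
  obtain R where R: "0 < R" "\<And>x. R \<le> norm x \<Longrightarrow> \<phi> x = 0"
    using test_fun_support[OF \<phi>] by blast
  obtain L where L: "0 < L" "\<And>x y. \<bar>\<phi> x - \<phi> y\<bar> \<le> L * norm (x - y)"
    using test_fun_Lipschitz[OF \<phi>] by blast
  have "\<bar>test_quot e i \<phi> x\<bar> \<le> (3 * L) * indicator (ball 0 (R + 1)) x" if e: "0 < e" "e \<le> 1" for e x i
  proof (cases "norm x < R + 1")
    case True
    have "\<bar>\<phi> (x - h) - \<phi> x\<bar> \<le> L * norm h" for h using L(2)[of "x - h" x] by simp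
    then show ?thesis
      using True test_quot_remainder(2)[OF e(1), of "\<lambda>h. \<phi> (x - h) - \<phi> x" L i] L(1)
      by (simp add: test_quot_def indicator_def)
  next
    case False
    have "\<phi> (x - h) = 0" if "norm h < e" for h
      using R(2)[of "x - h"] norm_triangle_ineq2[of x h] False that e(2) by simp
    moreover have "\<phi> x = 0" using R(2) False by simp
    ultimately have "(\<integral>h. indicator (ball 0 e) h * (h $ i * (\<phi> (x - h) - \<phi> x)) \<partial>lborel) = (\<integral>h. 0 \<partial>(lborel :: R3 measure))"
      by (intro Bochner_Integration.integral_cong) (auto simp: indicator_def)
    then show ?thesis using L(1) by (simp add: test_quot_def)
  qed
  then show thesis by (rule that)
qed

text \<open>The difference quotients at scales 1/(n+1) are bounded by A, so they have a weak limit
  with the same bound; in the pairing with phi the quotient moves onto phi, where it converges to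
  minus the partial derivative. This supplies weak gradients for -|u|, for symmetrized functions and
  for \<open>tent\<close>.\<close>

lemma weak_grad_of_osc_bound:
  assumes v: "sq_int lborel v" and A: "\<And>e. 0 < e \<Longrightarrow> e \<le> 1 \<Longrightarrow> osc e v \<le> moment e * A"
  obtains g where "sq_int lborel g" "weak_grad v g" "nsq lborel g \<le> A"
proof -
  define e where "e n = inverse (real (Suc n))" for n
  have e: "0 < e n" "e n \<le> 1" for n by (auto simp: e_def divide_simps)
  have e0: "e \<longlonglongrightarrow> 0" unfolding e_def by (rule LIMSEQ_inverse_real_of_nat)
  have [measurable]: "v \<in> borel_measurable borel" using v by (auto simp: sq_int_def)
  define q where "q n = diff_quot (e n) v" for n
  have q: "sq_int lborel (q n)" "nsq lborel (q n) \<le> A" for n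
  proof -
    note m = moment_pos[OF e(1)[of n]]
    have "osc (e n) v / moment (e n) \<le> A" using A[OF e[of n]] m by (simp add: field_simps)
    then show "sq_int lborel (q n)" "nsq lborel (q n) \<le> A"
      using diff_quot_sq_int[OF v e(1)[of n]] by (auto simp: q_def)
  qed
  define T where "T = {\<lambda>x. \<phi> x *\<^sub>R (axis i 1 :: R3) | \<phi> i. test_fun \<phi>}"
  have lim: "(\<lambda>n. \<integral>x. q n x \<bullet> (\<phi> x *\<^sub>R axis i 1) \<partial>lborel) \<longlonglongrightarrow> - (\<integral>x. v x * partial i \<phi> x \<partial>lborel)"
    if \<phi>: "test_fun \<phi>" for \<phi> i
  proof -
    have [measurable]: "\<phi> \<in> borel_measurable borel" "partial i \<phi> \<in> borel_measurable borel"
      using \<phi> by (auto intro: test_fun_measurable test_fun_partial)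
    obtain C R where CR: "\<And>e x i. 0 < e \<Longrightarrow> e \<le> 1 \<Longrightarrow> \<bar>test_quot e i \<phi> x\<bar> \<le> C * indicator (ball 0 R) x"
      using test_quot_bound[OF \<phi>] by blast
    have [measurable]: "test_quot (e n) i \<phi> \<in> borel_measurable lborel" for n
      unfolding test_quot_def by measurable
    have "(\<lambda>n. \<integral>x. v x * test_quot (e n) i \<phi> x \<partial>lborel) \<longlonglongrightarrow> (\<integral>x. v x * - partial i \<phi> x \<partial>lborel)"
    proof (rule integral_dominated_convergence[where w="\<lambda>x. \<bar>v x * (C * indicator (ball 0 R) x)\<bar>"])
      show "integrable lborel (\<lambda>x. \<bar>v x * (C * indicator (ball 0 R) x)\<bar>)"
        by (intro integrable_abs sq_int_mult_integrable v sq_int_cmult sq_int_indicator emeasure_lborel_ball_finite) simp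
      show "AE x in lborel. (\<lambda>n. v x * test_quot (e n) i \<phi> x) \<longlonglongrightarrow> v x * - partial i \<phi> x"
        by (intro AE_I2 tendsto_mult tendsto_const test_quot_tendsto[OF \<phi> e(1) e0])
      show "AE x in lborel. norm (v x * test_quot (e n) i \<phi> x) \<le> \<bar>v x * (C * indicator (ball 0 R) x)\<bar>" for n
      proof (rule AE_I2)
        fix x
        have "\<bar>test_quot (e n) i \<phi> x\<bar> \<le> \<bar>C * indicator (ball 0 R) x\<bar>"
          by (rule order_trans[OF CR[OF e] abs_ge_self])
        then show "norm (v x * test_quot (e n) i \<phi> x) \<le> \<bar>v x * (C * indicator (ball 0 R) x)\<bar>"
          unfolding real_norm_def abs_mult[of "v x"] by (rule mult_left_mono) simp
      qed
    qed measurable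
    then show ?thesis
      using diff_quot_pairing[OF v e(1) \<phi>, of _ i]
      by (simp add: q_def inner_axis mult.commute)
  qed
  \<comment> \<open>The functional is written as a \<open>lim\<close> because it must depend on the
    function psi alone, not on the phi and i that represent it.\<close>
  have "\<exists>G. sq_int lborel G \<and> nsq lborel G \<le> A \<and>
      (\<forall>\<psi>\<in>T. (\<integral>x. G x \<bullet> \<psi> x \<partial>lborel) = lim (\<lambda>n. \<integral>x. q n x \<bullet> \<psi> x \<partial>lborel))"
  proof (rule weak_limit_exists[OF q, where T=T and L="\<lambda>\<psi>. lim (\<lambda>n. \<integral>x. q n x \<bullet> \<psi> x \<partial>lborel)"])
    show "sq_int lborel \<psi>" if \<psi>: "\<psi> \<in> T" for \<psi>
    proof -
      obtain \<phi> i where p: "test_fun \<phi>" "\<psi> = (\<lambda>x. \<phi> x *\<^sub>R axis i 1)" using \<psi> by (auto simp: T_def)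
      show ?thesis
        using test_fun_sq_int[OF p(1)] unfolding p(2) by (auto simp: sq_int_def)
    qed
    show "(\<lambda>n. \<integral>x. q n x \<bullet> \<psi> x \<partial>lborel) \<longlonglongrightarrow> lim (\<lambda>n. \<integral>x. q n x \<bullet> \<psi> x \<partial>lborel)" if \<psi>: "\<psi> \<in> T" for \<psi>
    proof -
      obtain \<phi> i where p: "test_fun \<phi>" "\<psi> = (\<lambda>x. \<phi> x *\<^sub>R axis i 1)" using \<psi> by (auto simp: T_def)
      show ?thesis unfolding p(2) limI[OF lim[OF p(1), of i]] by (rule lim[OF p(1)])
    qed
  qed blast
  then obtain g where g: "sq_int lborel g" "nsq lborel g \<le> A"
    "\<And>\<psi>. \<psi> \<in> T \<Longrightarrow> (\<integral>x. g x \<bullet> \<psi> x \<partial>lborel) = lim (\<lambda>n. \<integral>x. q n x \<bullet> \<psi> x \<partial>lborel)" by blast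
  have "weak_grad v g"
    unfolding weak_grad_def
  proof (intro allI impI)
    fix \<phi> i assume \<phi>: "test_fun \<phi>"
    have "(\<lambda>x. \<phi> x *\<^sub>R axis i 1) \<in> T" using \<phi> by (auto simp: T_def)
    from trans[OF g(3)[OF this] limI[OF lim[OF \<phi>, of i]]]
    have "(\<integral>x. g x \<bullet> (\<phi> x *\<^sub>R axis i 1) \<partial>lborel) = - (\<integral>x. v x * partial i \<phi> x \<partial>lborel)" .
    then show "(\<integral>x. v x * partial i \<phi> x \<partial>lborel) = - (\<integral>x. g x $ i * \<phi> x \<partial>lborel)"
      by (simp add: inner_axis mult.commute)
  qed
  with g show thesis by (intro that)
qed

subsection \<open>Local compactness\<close>

text \<open>The half-open cube of side \<delta> containing x in a fixed grid. A fixed grid has only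
  countably many cubes, as diagonal extraction requires, and the floor encoding makes membership
  jointly measurable in both points.\<close>

definition cube :: "real \<Rightarrow> R3 \<Rightarrow> R3 set" where
  "cube \<delta> x = {y. \<forall>i. \<lfloor>y $ i / \<delta>\<rfloor> = \<lfloor>x $ i / \<delta>\<rfloor>}"

lemma cube_pred_measurable [measurable]:
  "Measurable.pred (borel \<Otimes>\<^sub>M borel) (\<lambda>p::R3 \<times> R3. snd p \<in> cube \<delta> (fst p))"
  unfolding cube_def mem_Collect_eq by measurable

lemma cube_sets [measurable]: "cube \<delta> x \<in> sets borel"
proof -
  have "Measurable.pred borel (\<lambda>y::R3. \<forall>i. \<lfloor>y $ i / \<delta>\<rfloor> = \<lfloor>x $ i / \<delta>\<rfloor>)" by measurable
  then show ?thesis by (simp add: cube_def pred_def)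
qed

lemma cube_subset_ball:
  assumes "0 < \<delta>"
  shows "cube \<delta> x \<subseteq> ball x (3 * \<delta>)"
proof
  fix y assume y: "y \<in> cube \<delta> x"
  have "\<bar>(x - y) $ i\<bar> < \<delta>" for i
  proof -
    have "\<lfloor>y $ i / \<delta>\<rfloor> = \<lfloor>x $ i / \<delta>\<rfloor>" using y by (simp add: cube_def)
    then have "\<bar>x $ i / \<delta> - y $ i / \<delta>\<bar> < 1" by linarith
    then have "\<bar>(x $ i - y $ i) / \<delta>\<bar> < 1" by (simp add: diff_divide_distrib)
    then show ?thesis using assms by (simp add: abs_divide)
  qed
  then have "(\<Sum>i\<in>UNIV. \<bar>(x - y) $ i\<bar>) < (\<Sum>i\<in>(UNIV :: 3 set). \<delta>)"
    by (intro sum_strict_mono) auto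
  then show "y \<in> ball x (3 * \<delta>)"
    using norm_le_l1_cart[of "x - y"] by (simp add: dist_norm)
qed

lemma cube_measure:
  assumes "0 < \<delta>"
  shows "emeasure lborel (cube \<delta> x) < \<infinity>" "\<delta> ^ 3 \<le> measure lborel (cube \<delta> x)"
    "measure lborel (cube \<delta> x) \<le> measure lborel (ball (0::R3) (3 * \<delta>))"
proof -
  show fin: "emeasure lborel (cube \<delta> x) < \<infinity>"
    using emeasure_mono[OF cube_subset_ball[OF assms, of x], of lborel] emeasure_lborel_ball_finite[of x "3 * \<delta>"]
    by (simp add: le_less_trans)
  define a where "a = (\<chi> i. real_of_int \<lfloor>x $ i / \<delta>\<rfloor> * \<delta>)"
  define b where "b = (\<chi> i. (real_of_int \<lfloor>x $ i / \<delta>\<rfloor> + 1) * \<delta>)"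
  have sub: "box a b \<subseteq> cube \<delta> x"
  proof
    fix y assume y: "y \<in> box a b"
    show "y \<in> cube \<delta> x"
      unfolding cube_def mem_Collect_eq
    proof
      fix i
      have "real_of_int \<lfloor>x $ i / \<delta>\<rfloor> * \<delta> < y $ i" "y $ i < (real_of_int \<lfloor>x $ i / \<delta>\<rfloor> + 1) * \<delta>"
        using y by (auto simp: mem_box_cart a_def b_def)
      then have "real_of_int \<lfloor>x $ i / \<delta>\<rfloor> < y $ i / \<delta>" "y $ i / \<delta> < real_of_int \<lfloor>x $ i / \<delta>\<rfloor> + 1"
        using assms by (auto simp: field_simps)
      then show "\<lfloor>y $ i / \<delta>\<rfloor> = \<lfloor>x $ i / \<delta>\<rfloor>" by linarith
    qed
  qed
  have "measure lborel (box a b) = measure lborel (cbox a b)"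
    by (simp add: measure_lborel_box_eq measure_lborel_cbox_eq)
  also have "\<dots> = (\<Prod>i\<in>UNIV. b $ i - a $ i)"
    using assms by (intro content_cbox_cart) (auto simp: a_def b_def interval_eq_empty_cart algebra_simps not_le)
  also have "\<dots> = \<delta> ^ 3" by (simp add: a_def b_def algebra_simps power3_eq_cube)
  finally have "measure lborel (box a b) = \<delta> ^ 3" .
  moreover have "measure lborel (box a b) \<le> measure lborel (cube \<delta> x)"
    using fin sub by (intro measure_mono_fmeasurable) (auto simp: fmeasurable_def)
  ultimately show "\<delta> ^ 3 \<le> measure lborel (cube \<delta> x)" by simp
  have "measure lborel (cube \<delta> x) \<le> measure lborel (ball x (3 * \<delta>))"
    using emeasure_lborel_ball_finite[of x "3 * \<delta>"] cube_subset_ball[OF assms]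
    by (intro measure_mono_fmeasurable) (auto simp: fmeasurable_def)
  also have "\<dots> = measure lborel (ball (0::R3) (3 * \<delta>))"
    using content_ball_conv_unit_ball[of "3 * \<delta>" x] content_ball_conv_unit_ball[of "3 * \<delta>" "0::R3"] assms by simp
  finally show "measure lborel (cube \<delta> x) \<le> measure lborel (ball (0::R3) (3 * \<delta>))" .
qed

definition cube_avg :: "real \<Rightarrow> (R3 \<Rightarrow> real) \<Rightarrow> R3 \<Rightarrow> real" where
  "cube_avg \<delta> u x = (\<integral>y. indicator (cube \<delta> x) y * u y \<partial>lborel) / measure lborel (cube \<delta> x)"

lemma cube_avg_measurable:
  assumes [measurable]: "u \<in> borel_measurable borel"
  shows "cube_avg \<delta> u \<in> borel_measurable borel"
proof -
  have [measurable]: "(\<lambda>p::R3\<times>R3. indicator (cube \<delta> (fst p)) (snd p) :: real) \<in> borel_measurable (borel \<Otimes>\<^sub>M borel)"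
    using cube_pred_measurable[of \<delta>] unfolding indicator_def by measurable
  have "(\<lambda>x. \<integral>y. indicator (cube \<delta> x) y * u y \<partial>lborel) \<in> borel_measurable borel"
    using lborel.borel_measurable_lebesgue_integral[of "\<lambda>x y. indicator (cube \<delta> x) y * u y" borel]
    by (simp add: split_beta')
  moreover have "(\<lambda>x. \<integral>y. indicator (cube \<delta> x) y \<partial>lborel :: real) \<in> borel_measurable borel"
    using lborel.borel_measurable_lebesgue_integral[of "\<lambda>x y. indicator (cube \<delta> x) y :: real" borel]
    by (simp add: split_beta')
  ultimately show ?thesis unfolding cube_avg_def by simp
qed

lemma cube_integral_bound:
  assumes u: "sq_int lborel u" and "0 < \<delta>"
  shows "(\<integral>y. indicator (cube \<delta> x) y * u y \<partial>lborel)\<^sup>2 \<le> measure lborel (cube \<delta> x) * nsq lborel u"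
proof -
  have i: "sq_int lborel (\<lambda>y. indicator (cube \<delta> x) y :: real)"
    by (intro sq_int_indicator cube_measure assms) simp
  have "nsq lborel (\<lambda>y. indicator (cube \<delta> x) y :: real) = measure lborel (cube \<delta> x)"
  proof -
    have "(\<lambda>y. (norm (indicator (cube \<delta> x) y :: real))\<^sup>2) = indicator (cube \<delta> x)" by (auto simp: indicator_def)
    then show ?thesis by (simp add: nsq_def)
  qed
  then show ?thesis using nsq_Cauchy_Schwarz_real[OF i u] by simp
qed

lemma cube_avg_bound:
  assumes u: "sq_int lborel u" and \<delta>: "0 < \<delta>" and C: "nsq lborel u \<le> C"
  shows "\<bar>cube_avg \<delta> u x\<bar> \<le> sqrt (C / \<delta> ^ 3)"
proof -
  define m where "m = measure lborel (cube \<delta> x)"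
  have m: "\<delta> ^ 3 \<le> m" using cube_measure(2)[OF \<delta>] by (simp add: m_def)
  then have m0: "0 < m" using \<delta> by (meson less_le_trans zero_less_power)
  have "(cube_avg \<delta> u x)\<^sup>2 = (\<integral>y. indicator (cube \<delta> x) y * u y \<partial>lborel)\<^sup>2 / m\<^sup>2"
    by (simp add: cube_avg_def m_def power_divide)
  also have "\<dots> \<le> (m * nsq lborel u) / m\<^sup>2"
    using cube_integral_bound[OF u \<delta>, of x] by (intro divide_right_mono) (auto simp: m_def)
  also have "\<dots> = nsq lborel u / m" using m0 by (simp add: power2_eq_square)
  also have "\<dots> \<le> C / \<delta> ^ 3"
    using C m \<delta> order_trans[OF nsq_nonneg C] by (intro frac_le) auto
  finally show ?thesis by (metis real_sqrt_abs real_sqrt_le_mono)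
qed

text \<open>u(x) minus its average is the average of u(x) - u(y) over the cube, which lies in the
  ball of radius 3 \<delta> about x. Cauchy-Schwarz bounds the square by the section of the
  oscillation at x divided by the volume, which is at least \<delta>^3.\<close>

lemma cube_avg_error:
  assumes u: "sq_int lborel u" and \<delta>: "0 < \<delta>"
  shows "sq_int lborel (\<lambda>x. u x - cube_avg \<delta> u x)"
    "nsq lborel (\<lambda>x. u x - cube_avg \<delta> u x) \<le> osc (3 * \<delta>) u / \<delta> ^ 3"
proof -
  have [measurable]: "u \<in> borel_measurable borel" using u by (auto simp: sq_int_def)
  have [measurable]: "cube_avg \<delta> u \<in> borel_measurable borel" by (rule cube_avg_measurable) measurable
  have [measurable]: "osc_fun (3 * \<delta>) u \<in> borel_measurable (lborel \<Otimes>\<^sub>M lborel)"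
    using osc_fun_sq_int(1)[OF u] by auto
  have pt: "ennreal ((u x - cube_avg \<delta> u x)\<^sup>2) \<le> ennreal (1 / \<delta> ^ 3) * (\<integral>\<^sup>+h. ennreal ((osc_fun (3 * \<delta>) u (x, h))\<^sup>2) \<partial>lborel)" for x
  proof -
    define m where "m = measure lborel (cube \<delta> x)"
    have m: "\<delta> ^ 3 \<le> m" using cube_measure(2)[OF \<delta>] by (simp add: m_def)
    then have m0: "0 < m" using \<delta> by (meson less_le_trans zero_less_power)
    have fin: "emeasure lborel (cube \<delta> x) < \<infinity>" by (rule cube_measure(1)[OF \<delta>])
    have i1: "integrable lborel (\<lambda>y. indicator (cube \<delta> x) y * u y)"
      using sq_int_indicator_integrable[OF u _ fin] by (simp add: mult.commute)
    have i2: "integrable lborel (\<lambda>y. indicator (cube \<delta> x) y * u x)"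
      using fin by (intro integrable_mult_left integrable_real_indicator) auto
    have "(\<integral>y. indicator (cube \<delta> x) y * (u x - u y) \<partial>lborel)
        = (\<integral>y. indicator (cube \<delta> x) y * u x \<partial>lborel) - (\<integral>y. indicator (cube \<delta> x) y * u y \<partial>lborel)"
      by (subst Bochner_Integration.integral_diff[OF i2 i1, symmetric]) (simp add: right_diff_distrib)
    also have "\<dots> = m * (u x - cube_avg \<delta> u x)"
      using m0 by (simp add: cube_avg_def m_def field_simps)
    finally have eq: "(\<integral>y. indicator (cube \<delta> x) y * (u x - u y) \<partial>lborel) = m * (u x - cube_avg \<delta> u x)" .
    have "ennreal ((m * (u x - cube_avg \<delta> u x))\<^sup>2)
        \<le> ennreal m * (\<integral>\<^sup>+y. ennreal ((indicator (cube \<delta> x) y * (u x - u y))\<^sup>2) \<partial>lborel)"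
      using sq_integral_le[of "\<lambda>y. u x - u y" lborel "cube \<delta> x", OF _ _ fin] by (simp add: eq m_def)
    also have "(\<integral>\<^sup>+y. ennreal ((indicator (cube \<delta> x) y * (u x - u y))\<^sup>2) \<partial>lborel)
        \<le> (\<integral>\<^sup>+y. ennreal ((osc_fun (3 * \<delta>) u (x, y - x))\<^sup>2) \<partial>lborel)"
      using cube_subset_ball[OF \<delta>, of x]
      by (intro nn_integral_mono) (auto simp: osc_fun_def indicator_def dist_norm norm_minus_commute power2_commute)
    also have "\<dots> = (\<integral>\<^sup>+h. ennreal ((osc_fun (3 * \<delta>) u (x, h))\<^sup>2) \<partial>lborel)"
      using nn_integral_shift[of "\<lambda>h. ennreal ((osc_fun (3 * \<delta>) u (x, h))\<^sup>2)" "- x"] by simp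
    finally have le: "ennreal ((m * (u x - cube_avg \<delta> u x))\<^sup>2)
        \<le> ennreal m * (\<integral>\<^sup>+h. ennreal ((osc_fun (3 * \<delta>) u (x, h))\<^sup>2) \<partial>lborel)"
      by (simp add: mult_left_mono)
    define N where "N = nsq lborel (\<lambda>h. osc_fun (3 * \<delta>) u (x, h))"
    have N: "(\<integral>\<^sup>+h. ennreal ((osc_fun (3 * \<delta>) u (x, h))\<^sup>2) \<partial>lborel) = ennreal N"
      using nn_integral_sq_int[OF osc_fun_section[OF u, of "3 * \<delta>" x]] by (simp add: N_def)
    have N0: "0 \<le> N" by (simp add: N_def)
    have "m\<^sup>2 * (u x - cube_avg \<delta> u x)\<^sup>2 \<le> m * N"
      using le m0 N0 unfolding N by (simp add: ennreal_mult[symmetric] power_mult_distrib)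
    then have "m * (m * (u x - cube_avg \<delta> u x)\<^sup>2) \<le> m * N"
      by (simp only: power2_eq_square[of m] mult.assoc)
    then have "m * (u x - cube_avg \<delta> u x)\<^sup>2 \<le> N"
      by (simp only: mult_le_cancel_left_pos[OF m0])
    then have "(u x - cube_avg \<delta> u x)\<^sup>2 \<le> N / m"
      by (simp only: pos_le_divide_eq[OF m0] mult.commute)
    also have "\<dots> \<le> N / \<delta> ^ 3" using m \<delta> N0 by (intro divide_left_mono) (auto intro: mult_pos_pos m0)
    finally show ?thesis unfolding N using \<delta> N0 by (simp add: ennreal_mult[symmetric] ennreal_leI)
  qed
  have "(\<integral>\<^sup>+x. ennreal ((norm (u x - cube_avg \<delta> u x))\<^sup>2) \<partial>lborel)
      \<le> (\<integral>\<^sup>+x. ennreal (1 / \<delta> ^ 3) * (\<integral>\<^sup>+h. ennreal ((osc_fun (3 * \<delta>) u (x, h))\<^sup>2) \<partial>lborel) \<partial>lborel)"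
    by (rule nn_integral_mono) (use pt in simp)
  also have "\<dots> = ennreal (1 / \<delta> ^ 3) * ennreal (osc (3 * \<delta>) u)"
    unfolding osc_eq_nn_integral(2)[OF u] by (rule nn_integral_cmult) measurable
  also have "\<dots> = ennreal (osc (3 * \<delta>) u / \<delta> ^ 3)"
    using \<delta> by (simp add: ennreal_mult[symmetric] osc_def)
  finally show "sq_int lborel (\<lambda>x. u x - cube_avg \<delta> u x)"
    "nsq lborel (\<lambda>x. u x - cube_avg \<delta> u x) \<le> osc (3 * \<delta>) u / \<delta> ^ 3"
    using \<delta> by (auto intro!: sq_intI_nn_integral simp: osc_def)
qed

text \<open>243 = 3^2 * 3^3: the moment is at most radius squared times volume, at radius 3
  \<delta>. Dividing by \<delta>^3 leaves \<delta>^2, so the averaging error vanishes with the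
  mesh.\<close>

lemma osc_cube_bound:
  assumes "0 < \<delta>" "osc (3 * \<delta>) u \<le> moment (3 * \<delta>) * A" "0 \<le> A"
  shows "osc (3 * \<delta>) u / \<delta> ^ 3 \<le> 243 * measure lborel (ball (0::R3) 1) * A * \<delta>\<^sup>2"
proof -
  have "moment (3 * \<delta>) \<le> (3 * \<delta>)\<^sup>2 * ((3 * \<delta>) ^ 3 * measure lborel (ball (0::R3) 1))"
    using moment_le[of "3 * \<delta>"] content_ball_conv_unit_ball[of "3 * \<delta>" "0::R3"] assms(1) by simp
  then have "moment (3 * \<delta>) * A \<le> (3 * \<delta>)\<^sup>2 * ((3 * \<delta>) ^ 3 * measure lborel (ball (0::R3) 1)) * A"
    using assms(3) by (rule mult_right_mono)
  then have "osc (3 * \<delta>) u \<le> (243 * measure lborel (ball (0::R3) 1) * A * \<delta>\<^sup>2) * \<delta> ^ 3"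
    using assms(2) by (simp add: power_mult_distrib mult_ac)
  then show ?thesis using assms(1) by (simp add: divide_le_eq)
qed

text \<open>Rellich by step functions: uniformly in n, the squared L2 distance of a function to its
  averages on the grid of mesh 1/(j+1) is at most \<open>K j\<close>. All these averages are
  determined by countably many integrals, which one diagonal subsequence makes convergent.\<close>

lemma local_compactness:
  fixes u :: "nat \<Rightarrow> R3 \<Rightarrow> real"
  assumes u: "\<And>n. sq_int lborel (u n)" and C: "\<And>n. nsq lborel (u n) \<le> C"
    and A: "\<And>n e. 0 < e \<Longrightarrow> osc e (u n) \<le> moment e * A"
  obtains r :: "nat \<Rightarrow> nat" where "strict_mono r" "\<And>R. L2_Cauchy lborel (\<lambda>n x. indicator (ball 0 R) x * u (r n) x)"
proof -
  have um[measurable]: "u n \<in> borel_measurable borel" for n using u by (auto simp: sq_int_def)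
  have A0: "0 \<le> A"
  proof -
    have "0 \<le> moment 1 * A" using A[of 1 0] by (simp add: osc_def order_trans[OF nsq_nonneg])
    then show ?thesis using moment_pos[of 1] by (simp add: zero_le_mult_iff)
  qed
  have C0: "0 \<le> C" using C[of 0] nsq_nonneg[of lborel "u 0"] by linarith
  define \<delta> where "\<delta> j = inverse (real (Suc j))" for j
  have \<delta>: "0 < \<delta> j" "\<delta> j \<le> 1" for j by (auto simp: \<delta>_def divide_simps)
  define S where "S = range (\<lambda>(j, x). cube (\<delta> j) x)"
  \<comment> \<open>A cube is determined by its mesh index and three integers, so \<open>S\<close>
    is countable.\<close>
  have "S \<subseteq> range (\<lambda>(j, k :: 3 \<Rightarrow> int). {y. \<forall>i. \<lfloor>y $ i / \<delta> j\<rfloor> = k i})"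
  proof
    fix B assume "B \<in> S"
    then obtain j x where B: "B = cube (\<delta> j) x" by (auto simp: S_def)
    show "B \<in> range (\<lambda>(j, k :: 3 \<Rightarrow> int). {y. \<forall>i. \<lfloor>y $ i / \<delta> j\<rfloor> = k i})"
      by (rule image_eqI[of _ _ "(j, \<lambda>i. \<lfloor>x $ i / \<delta> j\<rfloor>)"]) (auto simp: B cube_def)
  qed
  then have cS: "countable S" by (rule countable_subset) (intro countable_image countableI_type)
  define V where "V = measure lborel (ball (0::R3) 3)"
  have bd: "norm (\<integral>y. indicator B y * u n y \<partial>lborel) \<le> sqrt (V * C)" if B: "B \<in> S" for n B
  proof -
    obtain j x where B: "B = cube (\<delta> j) x" using B by (auto simp: S_def)
    have "measure lborel (cube (\<delta> j) x) \<le> measure lborel (ball (0::R3) (3 * \<delta> j))"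
      by (rule cube_measure(3)[OF \<delta>(1)])
    also have "\<dots> \<le> V"
      unfolding V_def using \<delta>[of j] emeasure_lborel_ball_finite[of "0::R3" 3]
      by (intro measure_mono_fmeasurable subset_ball) (auto simp: fmeasurable_def)
    finally have mV: "measure lborel (cube (\<delta> j) x) \<le> V" .
    have "(\<integral>y. indicator B y * u n y \<partial>lborel)\<^sup>2 \<le> measure lborel (cube (\<delta> j) x) * nsq lborel (u n)"
      unfolding B by (rule cube_integral_bound[OF u \<delta>(1)])
    also have "\<dots> \<le> V * C" using mV C by (intro mult_mono) (auto simp: V_def)
    finally show ?thesis by (metis real_norm_def real_sqrt_abs real_sqrt_le_mono)
  qed
  have "\<exists>r::nat \<Rightarrow> nat. strict_mono r \<and> (\<forall>B\<in>S. \<exists>l. (\<lambda>n. \<integral>y. indicator B y * u (r n) y \<partial>lborel) \<longlonglongrightarrow> l)"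
    by (rule function_convergent_subsequence[OF cS, of "\<lambda>n B. \<integral>y. indicator B y * u n y \<partial>lborel", OF bd]) blast+
  then obtain r :: "nat \<Rightarrow> nat" where r: "strict_mono r"
    and conv: "\<And>B. B \<in> S \<Longrightarrow> \<exists>l. (\<lambda>n. \<integral>y. indicator B y * u (r n) y \<partial>lborel) \<longlonglongrightarrow> l"
    by blast
  define p where "p j x = lim (\<lambda>n. cube_avg (\<delta> j) (u (r n)) x)" for j x
  have p: "(\<lambda>n. cube_avg (\<delta> j) (u (r n)) x) \<longlonglongrightarrow> p j x" for j x
  proof -
    have "cube (\<delta> j) x \<in> S" by (auto simp: S_def)
    then obtain l where "(\<lambda>n. \<integral>y. indicator (cube (\<delta> j) x) y * u (r n) y \<partial>lborel) \<longlonglongrightarrow> l" using conv by blast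
    moreover have "measure lborel (cube (\<delta> j) x) \<noteq> 0"
      using cube_measure(2)[OF \<delta>(1)[of j], of x] \<delta>(1)[of j] by (metis not_le zero_less_power)
    ultimately have "(\<lambda>n. cube_avg (\<delta> j) (u (r n)) x) \<longlonglongrightarrow> l / measure lborel (cube (\<delta> j) x)"
      unfolding cube_avg_def by (intro tendsto_divide tendsto_const)
    then show ?thesis unfolding p_def by (metis limI)
  qed
  have cm[measurable]: "cube_avg (\<delta> j) (u (r n)) \<in> borel_measurable borel" for j n by (rule cube_avg_measurable) measurable
  have pm[measurable]: "p j \<in> borel_measurable borel" for j
    unfolding p_def by measurable
  define M where "M j = sqrt (C / \<delta> j ^ 3)" for j
  have ab: "\<bar>cube_avg (\<delta> j) (u (r n)) x\<bar> \<le> M j" for j n x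
    unfolding M_def by (rule cube_avg_bound[OF u \<delta>(1) C])
  have pb: "\<bar>p j x\<bar> \<le> M j" for j x
    using tendsto_rabs[OF p[of j x]] by (rule LIMSEQ_le_const2) (use ab in blast)
  define K where "K j = 243 * measure lborel (ball (0::R3) 1) * A * (\<delta> j)\<^sup>2" for j
  have Kerr: "nsq lborel (\<lambda>x. u n x - cube_avg (\<delta> j) (u n) x) \<le> K j" for n j
    unfolding K_def using cube_avg_error(2)[OF u \<delta>(1)] osc_cube_bound[OF \<delta>(1) A A0] \<delta>(1)[of j]
    by (meson mult_pos_pos order_trans zero_less_numeral)
  have K0: "K \<longlonglongrightarrow> 0"
    using tendsto_mult[OF tendsto_const[of "243 * measure lborel (ball (0::R3) 1) * A"] tendsto_power[OF LIMSEQ_inverse_real_of_nat, of 2]]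
    by (simp add: K_def[abs_def] \<delta>_def)
  have "L2_Cauchy lborel (\<lambda>n x. indicator (ball 0 R) x * u (r n) x)" for R
  proof -
    define I where "I x = (indicator (ball (0::R3) R) x :: real)" for x
    have [measurable]: "I \<in> borel_measurable borel" unfolding I_def by measurable
    have Ib: "\<bar>I x\<bar> \<le> 1" for x by (auto simp: I_def indicator_def)
    have Isq: "sq_int lborel I"
      unfolding I_def by (intro sq_int_indicator emeasure_lborel_ball_finite) simp
    have Iu: "sq_int lborel (\<lambda>x. I x * u (r n) x)" for n
      by (rule bounded_mult_sq_int(1)[OF u _ Ib]) measurable
    have bsq: "sq_int lborel (\<lambda>x. f x * I x)"
      if [measurable]: "f \<in> borel_measurable borel" and "\<And>x. \<bar>f x\<bar> \<le> B" for f :: "R3 \<Rightarrow> real" and B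
      by (rule bounded_mult_sq_int(1)[OF Isq _ that(2)]) measurable
    have Ip: "sq_int lborel (\<lambda>x. I x * p j x)" for j
      using bsq[OF pm pb] by (simp add: mult.commute)
    have Ia: "sq_int lborel (\<lambda>x. I x * cube_avg (\<delta> j) (u (r n)) x)" for j n
      using bsq[OF cm ab] by (simp add: mult.commute)
    have T: "(\<lambda>n. nsq lborel (\<lambda>x. I x * cube_avg (\<delta> j) (u (r n)) x - I x * p j x)) \<longlonglongrightarrow> 0" for j
    proof -
      have "(\<lambda>n. \<integral>x. (I x * cube_avg (\<delta> j) (u (r n)) x - I x * p j x)\<^sup>2 \<partial>lborel) \<longlonglongrightarrow> (\<integral>x. 0 \<partial>(lborel :: R3 measure))"
      proof (rule integral_dominated_convergence[where w="\<lambda>x. (2 * M j)\<^sup>2 * indicator (ball 0 R) x"])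
        show "integrable lborel (\<lambda>x. (2 * M j)\<^sup>2 * indicator (ball (0::R3) R) x)"
          by (intro integrable_mult_right integrable_real_indicator emeasure_lborel_ball_finite) simp
        show "AE x in lborel. (\<lambda>n. (I x * cube_avg (\<delta> j) (u (r n)) x - I x * p j x)\<^sup>2) \<longlonglongrightarrow> 0"
        proof (rule AE_I2)
          fix x
          have "(\<lambda>n. (I x * cube_avg (\<delta> j) (u (r n)) x - I x * p j x)\<^sup>2) \<longlonglongrightarrow> (I x * p j x - I x * p j x)\<^sup>2"
            by (intro tendsto_intros p)
          then show "(\<lambda>n. (I x * cube_avg (\<delta> j) (u (r n)) x - I x * p j x)\<^sup>2) \<longlonglongrightarrow> 0" by simp
        qed
        show "AE x in lborel. norm ((I x * cube_avg (\<delta> j) (u (r n)) x - I x * p j x)\<^sup>2) \<le> (2 * M j)\<^sup>2 * indicator (ball 0 R) x" for n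
        proof (rule AE_I2)
          fix x
          have "\<bar>cube_avg (\<delta> j) (u (r n)) x - p j x\<bar> \<le> 2 * M j"
            using ab[of j n x] pb[of j x] by linarith
          then have "(cube_avg (\<delta> j) (u (r n)) x - p j x)\<^sup>2 \<le> (2 * M j)\<^sup>2"
            by (metis abs_ge_zero power2_abs power_mono)
          then show "norm ((I x * cube_avg (\<delta> j) (u (r n)) x - I x * p j x)\<^sup>2) \<le> (2 * M j)\<^sup>2 * indicator (ball 0 R) x"
            by (auto simp: I_def indicator_def)
        qed
      qed measurable
      then show ?thesis by (simp add: nsq_def)
    qed
    have close: "nsq lborel (\<lambda>x. I x * u (r n) x - I x * p j x)
        \<le> 2 * K j + 2 * nsq lborel (\<lambda>x. I x * cube_avg (\<delta> j) (u (r n)) x - I x * p j x)" for n j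
    proof -
      have e: "sq_int lborel (\<lambda>x. u (r n) x - cube_avg (\<delta> j) (u (r n)) x)"
        by (rule cube_avg_error(1)[OF u \<delta>(1)])
      have "nsq lborel (\<lambda>x. I x * (u (r n) x - cube_avg (\<delta> j) (u (r n)) x)) \<le> 1\<^sup>2 * nsq lborel (\<lambda>x. u (r n) x - cube_avg (\<delta> j) (u (r n)) x)"
        by (rule bounded_mult_sq_int(2)[OF e _ Ib]) measurable
      then have "nsq lborel (\<lambda>x. I x * u (r n) x - I x * cube_avg (\<delta> j) (u (r n)) x) \<le> K j"
        using Kerr[of "r n" j] by (simp add: right_diff_distrib)
      then show ?thesis using nsq_triangle[OF Iu[of n] Ia[of j n] Ip[of j]] by linarith
    qed
    show ?thesis
      unfolding L2_Cauchy_def I_def[symmetric]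
    proof (intro allI impI)
      fix e :: real assume e: "0 < e"
      \<comment> \<open>Two uses of the factor-2 triangle inequality multiply each of four errors
        (mesh and limit, for n and for m) by 4, so e/16 for each sums to less than e.\<close>
      obtain j where j: "K j < e / 16"
        using order_tendstoD(2)[OF K0, of "e / 16"] e by (auto simp: eventually_sequentially)
      obtain N where N: "\<And>n. n \<ge> N \<Longrightarrow> nsq lborel (\<lambda>x. I x * cube_avg (\<delta> j) (u (r n)) x - I x * p j x) < e / 16"
        using order_tendstoD(2)[OF T[of j], of "e / 16"] e by (auto simp: eventually_sequentially)
      show "\<exists>N. \<forall>n\<ge>N. \<forall>m\<ge>N. nsq lborel (\<lambda>x. I x * u (r n) x - I x * u (r m) x) < e"
      proof (intro exI[of _ N] allI impI)
        fix n m assume nm: "N \<le> n" "N \<le> m"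
        have "nsq lborel (\<lambda>x. I x * u (r n) x - I x * u (r m) x)
          \<le> 2 * nsq lborel (\<lambda>x. I x * u (r n) x - I x * p j x) + 2 * nsq lborel (\<lambda>x. I x * u (r m) x - I x * p j x)"
          using nsq_triangle[OF Iu[of n] Ip[of j] Iu[of m]] by (simp add: nsq_diff_commute[of _ "\<lambda>x. I x * p j x"])
        then show "nsq lborel (\<lambda>x. I x * u (r n) x - I x * u (r m) x) < e"
          using close[of n j] close[of m j] N[OF nm(1)] N[OF nm(2)] j by linarith
      qed
    qed
  qed
  with r show thesis by (rule that)
qed

subsection \<open>The nonlocal energy\<close>

text \<open>The kernel of \<open>phi\<close> takes the junk value \<open>0\<close> on the diagonal; \<open>ker\<close> is its continuous extension.\<close>

definition ker :: "real \<Rightarrow> real" where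
  "ker z = (if z = 0 then 1 else (1 - exp (- z)) / z)"

lemma ker_measurable [measurable]: "ker \<in> borel_measurable borel"
  unfolding ker_def[abs_def] by measurable

lemma ker_pos: "0 \<le> z \<Longrightarrow> 0 < ker z"
  by (auto simp: ker_def)

lemma ker_le_1: "0 \<le> z \<Longrightarrow> ker z \<le> 1"
  using exp_ge_add_one_self[of "- z"] by (auto simp: ker_def divide_le_eq)

lemma ker_le_inverse: "0 < z \<Longrightarrow> ker z \<le> 1 / z"
  by (simp add: ker_def divide_right_mono)

text \<open>For positive arguments the derivative has the sign of (1 + z) exp(-z) - 1, which is at
  most 0 because 1 + z <= exp z.\<close>

lemma ker_antimono:
  assumes "0 \<le> a" "a \<le> b"
  shows "ker b \<le> ker a"
proof (cases "a = 0")
  case True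
  then show ?thesis using ker_le_1[of b] assms by (simp add: ker_def)
next
  case False
  then have a: "0 < a" using assms by simp
  have "(\<lambda>z. (1 - exp (- z)) / z) b \<le> (\<lambda>z. (1 - exp (- z)) / z) a"
  proof (rule DERIV_nonpos_imp_nonincreasing[OF assms(2)])
    fix z assume z: "a \<le> z" "z \<le> b"
    then have z0: "0 < z" using a by simp
    have D: "((\<lambda>z. (1 - exp (- z)) / z) has_real_derivative (exp (- z) * z - (1 - exp (- z))) / (z * z)) (at z)"
      using z0 by (auto intro!: derivative_eq_intros)
    have "exp (- z) * (1 + z) \<le> exp (- z) * exp z"
      by (intro mult_left_mono exp_ge_add_one_self) auto
    then have "exp (- z) * z - (1 - exp (- z)) \<le> 0"
      by (simp add: algebra_simps flip: exp_add)
    then have "(exp (- z) * z - (1 - exp (- z))) / (z * z) \<le> 0"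
      by (intro divide_nonpos_nonneg) auto
    then show "\<exists>y. ((\<lambda>z. (1 - exp (- z)) / z) has_real_derivative y) (at z) \<and> y \<le> 0" using D by blast
  qed
  then show ?thesis using a assms by (simp add: ker_def)
qed

lemma tensor_sq_int:
  fixes u v :: "'a::euclidean_space \<Rightarrow> real"
  assumes u: "sq_int lborel u" and v: "sq_int lborel v"
  shows "sq_int (lborel \<Otimes>\<^sub>M lborel) (\<lambda>(x, y). u x * v y)"
    "nsq (lborel \<Otimes>\<^sub>M lborel) (\<lambda>(x, y). u x * v y) = nsq lborel u * nsq lborel v"
proof -
  have [measurable]: "u \<in> borel_measurable borel" "v \<in> borel_measurable borel"
    using u v by (auto simp: sq_int_def)
  have "(\<integral>\<^sup>+p. ennreal ((norm (case p of (x, y) \<Rightarrow> u x * v y))\<^sup>2) \<partial>(lborel \<Otimes>\<^sub>M lborel))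
      = (\<integral>\<^sup>+x. \<integral>\<^sup>+y. ennreal ((u x)\<^sup>2) * ennreal ((v y)\<^sup>2) \<partial>lborel \<partial>lborel)"
    by (subst lborel.nn_integral_fst[symmetric])
       (auto simp: power_mult_distrib ennreal_mult intro!: nn_integral_cong)
  also have "\<dots> = (\<integral>\<^sup>+x. ennreal ((u x)\<^sup>2) * ennreal (nsq lborel v) \<partial>lborel)"
    using nn_integral_sq_int[OF v] by (intro nn_integral_cong) (simp add: nn_integral_cmult)
  also have "\<dots> = ennreal (nsq lborel u) * ennreal (nsq lborel v)"
    using nn_integral_sq_int[OF u] by (simp add: nn_integral_multc)
  finally have eq: "(\<integral>\<^sup>+p. ennreal ((norm (case p of (x, y) \<Rightarrow> u x * v y))\<^sup>2) \<partial>(lborel \<Otimes>\<^sub>M lborel))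
      = ennreal (nsq lborel u * nsq lborel v)" by (simp add: ennreal_mult)
  then show s: "sq_int (lborel \<Otimes>\<^sub>M lborel) (\<lambda>(x, y). u x * v y)"
    by (intro sq_intI_nn_integral(1)[where c="nsq lborel u * nsq lborel v"]) auto
  show "nsq (lborel \<Otimes>\<^sub>M lborel) (\<lambda>(x, y). u x * v y) = nsq lborel u * nsq lborel v"
    using nn_integral_sq_int[OF s] eq by simp
qed

text \<open>The square root of the kernel makes the nonlocal energy a squared L2 norm on the
  product, so that bounds, monotonicity and continuity reduce to facts about
  \<open>nsq\<close>.\<close>

definition Dfun :: "(R3 \<Rightarrow> real) \<Rightarrow> R3 \<times> R3 \<Rightarrow> real" where
  "Dfun u = (\<lambda>(x, y). sqrt (ker (dist x y)) * (u x * u y))"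

definition energy :: "(R3 \<Rightarrow> real) \<Rightarrow> real" where
  "energy u = nsq (lborel \<Otimes>\<^sub>M lborel) (Dfun u)"

lemma sqrt_ker_bound: "\<bar>sqrt (ker (dist x y))\<bar> \<le> 1"
  using ker_le_1[of "dist x y"] ker_pos[of "dist x y"] by (simp add: real_sqrt_le_1_iff)

lemma sqrt_ker_measurable [measurable]:
  "(\<lambda>p::R3\<times>R3. sqrt (ker (dist (fst p) (snd p)))) \<in> borel_measurable (lborel \<Otimes>\<^sub>M lborel)"
  by measurable

lemma Dfun_sq_int:
  assumes "sq_int lborel u"
  shows "sq_int (lborel \<Otimes>\<^sub>M lborel) (Dfun u)" "energy u \<le> (nsq lborel u)\<^sup>2"
proof -
  have eq: "Dfun u = (\<lambda>p. sqrt (ker (dist (fst p) (snd p))) * (case p of (x, y) \<Rightarrow> u x * u y))"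
    by (auto simp: Dfun_def)
  note b = bounded_mult_sq_int[OF tensor_sq_int(1)[OF assms assms] sqrt_ker_measurable sqrt_ker_bound]
  show "sq_int (lborel \<Otimes>\<^sub>M lborel) (Dfun u)" unfolding eq by (rule b(1))
  show "energy u \<le> (nsq lborel u)\<^sup>2"
    unfolding energy_def eq using b(2) tensor_sq_int(2)[OF assms assms] by (simp add: power2_eq_square)
qed

lemma energy_mono:
  assumes "sq_int lborel v" "sq_int lborel u" "\<And>x. \<bar>u x\<bar> \<le> \<bar>v x\<bar>"
  shows "energy u \<le> energy v"
  unfolding energy_def
proof (rule sq_int_bound(2)[OF Dfun_sq_int(1)[OF assms(1)]])
  show "Dfun u \<in> borel_measurable (lborel \<Otimes>\<^sub>M lborel)" using Dfun_sq_int(1)[OF assms(2)] by auto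
  show "norm (Dfun u p) \<le> norm (Dfun v p)" for p
    using assms(3) by (auto simp: Dfun_def abs_mult split_beta' intro!: mult_mono)
qed

lemma energy_abs: "energy (\<lambda>x. \<bar>u x\<bar>) = energy u"
  by (simp add: energy_def nsq_def Dfun_def split_beta' power_mult_distrib abs_mult)

lemma energy_minus: "energy (\<lambda>x. - u x) = energy u"
  by (simp add: energy_def nsq_def Dfun_def split_beta' power_mult_distrib)

lemma energy_scale: "energy (\<lambda>x. c * u x) = c ^ 4 * energy u"
proof -
  have "Dfun (\<lambda>x. c * u x) = (\<lambda>p. (c\<^sup>2) * Dfun u p)"
    by (auto simp: Dfun_def power2_eq_square)
  then show ?thesis by (simp add: energy_def nsq_cmult power_mult[symmetric])
qed

text \<open>u(x)u(y) - v(x)v(y) = (u - v)(x) u(y) + v(x) (u - v)(y), a sum of two tensor products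
  whose norms factor.\<close>

lemma Dfun_diff:
  assumes u: "sq_int lborel u" and v: "sq_int lborel v"
  shows "nsq (lborel \<Otimes>\<^sub>M lborel) (\<lambda>p. Dfun u p - Dfun v p)
    \<le> 2 * nsq lborel (\<lambda>x. u x - v x) * (nsq lborel u + nsq lborel v)"
proof -
  note d = sq_int_diff[OF u v]
  note t1 = tensor_sq_int[OF d u] and t2 = tensor_sq_int[OF v d]
  have eq: "(\<lambda>p. Dfun u p - Dfun v p) = (\<lambda>p. sqrt (ker (dist (fst p) (snd p))) *
      ((case p of (x, y) \<Rightarrow> (u x - v x) * u y) + (case p of (x, y) \<Rightarrow> v x * (u y - v y))))"
    by (auto simp: Dfun_def algebra_simps)
  have "nsq (lborel \<Otimes>\<^sub>M lborel) (\<lambda>p. Dfun u p - Dfun v p)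
      \<le> 1\<^sup>2 * nsq (lborel \<Otimes>\<^sub>M lborel) (\<lambda>p. (case p of (x, y) \<Rightarrow> (u x - v x) * u y) + (case p of (x, y) \<Rightarrow> v x * (u y - v y)))"
    unfolding eq by (rule bounded_mult_sq_int(2)[OF sq_int_add[OF t1(1) t2(1)] sqrt_ker_measurable sqrt_ker_bound])
  also have "\<dots> \<le> 2 * (nsq lborel (\<lambda>x. u x - v x) * nsq lborel u) + 2 * (nsq lborel v * nsq lborel (\<lambda>x. u x - v x))"
    using nsq_add_le[OF t1(1) t2(1)] t1(2) t2(2) by simp
  finally show ?thesis by (simp add: algebra_simps)
qed

lemma energy_diff:
  assumes u: "sq_int lborel u" and v: "sq_int lborel v" and C: "nsq lborel u \<le> C" "nsq lborel v \<le> C"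
  shows "\<bar>energy u - energy v\<bar> \<le> 4 * (C * sqrt C) * sqrt (nsq lborel (\<lambda>x. u x - v x))"
proof -
  define d where "d = nsq lborel (\<lambda>x. u x - v x)"
  have C0: "0 \<le> C" using C(1) nsq_nonneg[of lborel u] by linarith
  have d0: "0 \<le> d" by (simp add: d_def)
  have eb: "energy w \<le> C\<^sup>2" if "sq_int lborel w" "nsq lborel w \<le> C" for w
    using Dfun_sq_int(2)[OF that(1)] power_mono[OF that(2), of 2] by simp
  have "nsq (lborel \<Otimes>\<^sub>M lborel) (\<lambda>p. Dfun u p - Dfun v p) \<le> 4 * C * d"
  proof -
    have "2 * d * (nsq lborel u + nsq lborel v) \<le> 2 * d * (C + C)"
      using C d0 by (intro mult_left_mono add_mono) auto
    then have "2 * d * (nsq lborel u + nsq lborel v) \<le> 4 * C * d" by (simp add: mult_ac)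
    then show ?thesis using Dfun_diff[OF u v, folded d_def] by linarith
  qed
  then have "\<bar>energy u - energy v\<bar> \<le> sqrt (4 * C * d) * sqrt (4 * C\<^sup>2)"
    using eb[OF u C(1)] eb[OF v C(2)]
      mult_nonneg_nonneg[OF C0 d0]
    unfolding energy_def
    by (intro order_trans[OF nsq_abs_diff_le[OF Dfun_sq_int(1)[OF u] Dfun_sq_int(1)[OF v]]] mult_mono) auto
  also have "\<dots> = 4 * (C * sqrt C) * sqrt d"
    using C0 by (simp add: real_sqrt_mult)
  finally show ?thesis by (simp add: d_def)
qed

lemma nsq_bounded_of_tendsto:
  assumes "\<And>n. sq_int M (f n)" "sq_int M F" "(\<lambda>n. nsq M (\<lambda>x. f n x - F x)) \<longlonglongrightarrow> 0"
  obtains C where "\<And>n. nsq M (f n) \<le> C" "nsq M F \<le> C"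
proof -
  have "Bseq (\<lambda>n. nsq M (f n))"
    by (rule convergent_imp_Bseq[OF convergentI[OF nsq_tendsto[OF assms]]])
  then obtain B where B: "\<And>n. norm (nsq M (f n)) \<le> B" unfolding Bseq_def by blast
  have "nsq M (f n) \<le> max B (nsq M F)" for n using B[of n] by simp
  then show thesis by (rule that) simp
qed

lemma energy_tendsto:
  assumes "\<And>n. sq_int lborel (u n)" "sq_int lborel U" "(\<lambda>n. nsq lborel (\<lambda>x. u n x - U x)) \<longlonglongrightarrow> 0"
  shows "(\<lambda>n. energy (u n)) \<longlonglongrightarrow> energy U"
proof -
  obtain C where C: "\<And>n. nsq lborel (u n) \<le> C" "nsq lborel U \<le> C"
    using nsq_bounded_of_tendsto[OF assms] by blast
  have b: "norm (energy (u n) - energy U) \<le> 4 * (C * sqrt C) * sqrt (nsq lborel (\<lambda>x. u n x - U x))" for n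
    using energy_diff[OF assms(1)[of n] assms(2) C] by simp
  have "(\<lambda>n. 4 * (C * sqrt C) * sqrt (nsq lborel (\<lambda>x. u n x - U x))) \<longlonglongrightarrow> 4 * (C * sqrt C) * sqrt 0"
    by (intro tendsto_intros assms(3))
  then have "(\<lambda>n. energy (u n) - energy U) \<longlonglongrightarrow> 0"
    by (intro Lim_null_comparison[OF always_eventually[OF allI[OF b]]]) simp
  then show ?thesis by (simp add: LIM_zero_iff)
qed

lemma osc_tendsto:
  assumes "\<And>n. sq_int lborel (u n)" "sq_int lborel U" "(\<lambda>n. nsq lborel (\<lambda>x. u n x - U x)) \<longlonglongrightarrow> 0"
  shows "(\<lambda>n. osc e (u n)) \<longlonglongrightarrow> osc e U"
  unfolding osc_def
proof (rule nsq_tendsto)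
  show "sq_int (lborel \<Otimes>\<^sub>M lborel) (osc_fun e (u n))" for n by (rule osc_fun_sq_int(1)[OF assms(1)])
  show "sq_int (lborel \<Otimes>\<^sub>M lborel) (osc_fun e U)" by (rule osc_fun_sq_int(1)[OF assms(2)])
  have eq: "(\<lambda>p. osc_fun e (u n) p - osc_fun e U p) = osc_fun e (\<lambda>x. u n x - U x)" for n
    by (auto simp: osc_fun_def algebra_simps)
  show "(\<lambda>n. nsq (lborel \<Otimes>\<^sub>M lborel) (\<lambda>p. osc_fun e (u n) p - osc_fun e U p)) \<longlonglongrightarrow> 0"
  proof (rule tendsto_sandwich[OF _ _ tendsto_const])
    show "\<forall>\<^sub>F n in sequentially. nsq (lborel \<Otimes>\<^sub>M lborel) (\<lambda>p. osc_fun e (u n) p - osc_fun e U p)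
        \<le> 4 * measure lborel (ball (0::R3) e) * nsq lborel (\<lambda>x. u n x - U x)"
      unfolding eq osc_def[symmetric]
      by (intro always_eventually allI osc_fun_sq_int(2) sq_int_diff assms)
    show "(\<lambda>n. 4 * measure lborel (ball (0::R3) e) * nsq lborel (\<lambda>x. u n x - U x)) \<longlonglongrightarrow> 0"
      using tendsto_mult[OF tendsto_const assms(3)] by simp
  qed auto
qed

text \<open>The kernel never vanishes, so zero energy forces u(x) u(y) = 0 almost everywhere, and
  the squared norm of this tensor product is the square of \<open>nsq lborel u\<close>.\<close>

lemma energy_pos:
  assumes u: "sq_int lborel u" and "0 < nsq lborel u"
  shows "0 < energy u"
proof (rule ccontr)
  assume "\<not> 0 < energy u"
  then have "energy u = 0" using nsq_nonneg[of "lborel \<Otimes>\<^sub>M lborel" "Dfun u"] by (simp add: energy_def)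
  then have "AE p in lborel \<Otimes>\<^sub>M lborel. Dfun u p = 0"
    unfolding energy_def by (rule nsq_eq_0_AE[OF Dfun_sq_int(1)[OF u]])
  then have ae: "AE p in lborel \<Otimes>\<^sub>M lborel. (case p of (x, y) \<Rightarrow> u x * u y) = 0"
  proof eventually_elim
    case (elim p)
    then show ?case using ker_pos[of "dist (fst p) (snd p)"] by (auto simp: Dfun_def split_beta')
  qed
  have m: "(\<lambda>(x, y). u x * u y) \<in> borel_measurable (lborel \<Otimes>\<^sub>M lborel)"
    using tensor_sq_int(1)[OF u u] by auto
  have "nsq (lborel \<Otimes>\<^sub>M lborel) (\<lambda>(x, y). u x * u y) = 0"
    unfolding nsq_def using ae by (intro integral_eq_zero_AE) auto
  then show False using tensor_sq_int(2)[OF u u] assms(2) by simp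
qed

section \<open>Potentials of radial functions and energy tails\<close>

definition pot :: "(R3 \<Rightarrow> real) \<Rightarrow> R3 \<Rightarrow> real" where
  "pot u y = (\<integral>x. ker (dist y x) * (u x)\<^sup>2 \<partial>lborel)"

lemma ker_sq_integrable:
  assumes "sq_int lborel u"
  shows "integrable lborel (\<lambda>x. ker (dist y x) * (u x)\<^sup>2)"
proof -
  have [measurable]: "u \<in> borel_measurable borel" using assms by (auto simp: sq_int_def)
  show ?thesis
  proof (rule Bochner_Integration.integrable_bound[OF sq_int_integrable[OF assms]])
    show "AE x in lborel. norm (ker (dist y x) * (u x)\<^sup>2) \<le> norm ((norm (u x))\<^sup>2)"
    proof (rule AE_I2)
      fix x
      have "ker (dist y x) * (u x)\<^sup>2 \<le> 1 * (u x)\<^sup>2" by (intro mult_right_mono ker_le_1) auto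
      then show "norm (ker (dist y x) * (u x)\<^sup>2) \<le> norm ((norm (u x))\<^sup>2)"
        using ker_pos[of "dist y x"] by (simp add: abs_mult)
    qed
  qed measurable
qed

lemma phi_eq_pot:
  assumes [measurable]: "u \<in> borel_measurable borel"
  shows "phi u x = pot u x"
  unfolding phi_def pot_def
proof (rule integral_cong_AE)
  have "AE y in lborel. y \<noteq> x" using AE_lborel_singleton by auto
  then show "AE y in lborel. (1 - exp (- dist x y)) / dist x y * (u y)\<^sup>2 = ker (dist x y) * (u y)\<^sup>2"
    by eventually_elim (auto simp: ker_def)
qed measurable

lemma Dfun_sq: "(Dfun u (x, y))\<^sup>2 = ker (dist x y) * (u x)\<^sup>2 * (u y)\<^sup>2"
  using ker_pos[of "dist x y"] by (simp add: Dfun_def power_mult_distrib)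

lemma Dfun_sq_integrable:
  assumes "sq_int lborel u"
  shows "integrable (lborel \<Otimes>\<^sub>M lborel) (\<lambda>p. (Dfun u p)\<^sup>2)"
  using sq_int_integrable[OF Dfun_sq_int(1)[OF assms]] by simp

lemma energy_eq:
  assumes "sq_int lborel u"
  shows "(\<integral>x. phi u x * (u x)\<^sup>2 \<partial>lborel) = energy u"
proof -
  have m: "u \<in> borel_measurable borel" using assms by (auto simp: sq_int_def)
  have "(\<integral>x. phi u x * (u x)\<^sup>2 \<partial>lborel) = (\<integral>x. (\<integral>y. (Dfun u (x, y))\<^sup>2 \<partial>lborel) \<partial>lborel)"
  proof (intro Bochner_Integration.integral_cong refl)
    fix x
    have "(Dfun u (x, y))\<^sup>2 = (ker (dist x y) * (u y)\<^sup>2) * (u x)\<^sup>2" for y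
      by (simp add: Dfun_sq mult_ac)
    then show "phi u x * (u x)\<^sup>2 = (\<integral>y. (Dfun u (x, y))\<^sup>2 \<partial>lborel)"
      by (simp add: phi_eq_pot[OF m] pot_def)
  qed
  also have "\<dots> = energy u"
    using lborel_pair.integral_fst'[OF Dfun_sq_integrable[OF assms]] by (simp add: energy_def nsq_def)
  finally show ?thesis .
qed

text \<open>Integration turns the almost everywhere invariance of u into invariance of the potential
  at every point y. This matters because \<open>radial_pot_tail\<close> evaluates it at finitely
  many chosen points.\<close>

lemma pot_rotation:
  assumes u: "sq_int lborel u" "radial u" and R: "orthogonal_transformation R"
  shows "pot u (R y) = pot u y"
proof -
  have [measurable]: "u \<in> borel_measurable borel" using u by (auto simp: sq_int_def)
  have mp: "measure_preserving lborel R" by (rule measure_preserving_orthogonal[OF R])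
  have [measurable]: "R \<in> borel_measurable borel" using measure_preserving_measurable[OF mp] by simp
  have "pot u (R y) = (\<integral>x. ker (dist (R y) (R x)) * (u (R x))\<^sup>2 \<partial>lborel)"
    unfolding pot_def
    using measure_preserving_integral[OF mp, of "\<lambda>x. ker (dist (R y) x) * (u x)\<^sup>2"] by simp
  also have "\<dots> = pot u y"
    unfolding pot_def
  proof (rule integral_cong_AE)
    have "AE x in lborel. u (R x) = u x" using u(2) R by (simp add: radial_def)
    then show "AE x in lborel. ker (dist (R y) (R x)) * (u (R x))\<^sup>2 = ker (dist y x) * (u x)\<^sup>2"
      by eventually_elim (use R in \<open>simp add: orthogonal_transformation_isometry\<close>)
  qed measurable
  finally show ?thesis .
qed

text \<open>By separation x lies within distance s of at most one centre; that one contributes at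
  most 1, each of the others at most 1/s.\<close>

lemma sum_ker_separated:
  fixes Z :: "R3 set"
  assumes "finite Z" "0 < s" and sep: "\<And>z w. z \<in> Z \<Longrightarrow> w \<in> Z \<Longrightarrow> z \<noteq> w \<Longrightarrow> 2 * s \<le> dist z w"
  shows "(\<Sum>z\<in>Z. ker (dist z x)) \<le> 1 + real (card Z) / s"
proof -
  have far: "ker (dist z x) \<le> 1 / s" if "s \<le> dist z x" for z
  proof -
    have "0 < dist z x" using that assms(2) by linarith
    then have "ker (dist z x) \<le> 1 / dist z x" by (rule ker_le_inverse)
    also have "\<dots> \<le> 1 / s" using that assms(2) by (intro divide_left_mono mult_pos_pos \<open>0 < dist z x\<close>) auto
    finally show ?thesis .
  qed
  show ?thesis
  proof (cases "\<exists>z0\<in>Z. dist z0 x < s")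
    case True
    then obtain z0 where z0: "z0 \<in> Z" "dist z0 x < s" by blast
    have "ker (dist z x) \<le> 1 / s" if "z \<in> Z - {z0}" for z
      using sep[of z z0] that z0 dist_triangle2[of z z0 x] by (intro far) auto
    then have "(\<Sum>z\<in>Z - {z0}. ker (dist z x)) \<le> (\<Sum>z\<in>Z - {z0}. 1 / s)" by (rule sum_mono)
    also have "\<dots> \<le> real (card Z) / s"
      using assms(1,2) z0 by (simp add: divide_right_mono card_Diff_subset)
    finally show ?thesis
      using ker_le_1[of "dist z0 x"] sum.remove[OF assms(1) z0(1), of "\<lambda>z. ker (dist z x)"] by simp
  next
    case False
    then have "(\<Sum>z\<in>Z. ker (dist z x)) \<le> (\<Sum>z\<in>Z. 1 / s)" by (intro sum_mono far) auto
    then show ?thesis by simp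
  qed
qed

text \<open>A radial potential takes the same value at \<open>N\<close> far apart points of a large sphere, while the
  sum of the kernels centred at these points is bounded by about \<open>1\<close>.\<close>

lemma radial_pot_tail:
  assumes e: "0 < e"
  obtains \<rho> where "0 < \<rho>"
    "\<And>u y. sq_int lborel u \<Longrightarrow> radial u \<Longrightarrow> \<rho> \<le> norm y \<Longrightarrow> pot u y \<le> e * nsq lborel u"
proof -
  obtain N :: nat where N: "0 < N" "1 / real N < e / 2"
    using reals_Archimedean[of "e / 2"] e by (metis half_gt_zero inverse_eq_divide zero_less_Suc)
  have "infinite (sphere (0::R3) 1)"
  proof -
    have "connected (sphere (0::R3) 1)" by (rule connected_sphere) simp
    moreover have "axis 1 1 \<in> sphere (0::R3) 1" "axis 2 1 \<in> sphere (0::R3) 1" by auto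
    moreover have "axis 1 1 \<noteq> (axis 2 1 :: R3)" by (simp add: axis_eq_axis)
    ultimately show ?thesis using connected_uncountable countable_finite by metis
  qed
  then obtain Z where Z: "finite Z" "card Z = N" "Z \<subseteq> sphere (0::R3) 1"
    using infinite_arbitrarily_large by blast
  \<comment> \<open>The element 1 keeps the set nonempty when N = 1, so that its minimum is
    meaningful.\<close>
  define Q where "Q = insert 1 ((\<lambda>(z, w). dist z w) ` {(z, w). z \<in> Z \<and> w \<in> Z \<and> z \<noteq> w})"
  have fQ: "finite Q"
    unfolding Q_def using finite_subset[of "{(z, w). z \<in> Z \<and> w \<in> Z \<and> z \<noteq> w}" "Z \<times> Z"] Z(1) by auto
  define c where "c = Min Q"
  have "\<forall>q\<in>Q. 0 < q" unfolding Q_def by auto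
  then have c: "0 < c" unfolding c_def using fQ by (subst Min_gr_iff) (auto simp: Q_def)
  have cs: "c \<le> dist z w" if "z \<in> Z" "w \<in> Z" "z \<noteq> w" for z w
    unfolding c_def using fQ that by (intro Min_le) (auto simp: Q_def)
  \<comment> \<open>The N points scaled to the sphere through y are at least c |y| = 2 s apart, and
    |y| >= 4 / (c e) gives 1/s <= e/2; the other half of e pays for 1/N.\<close>
  define \<rho> where "\<rho> = 4 / (c * e)"
  have \<rho>: "0 < \<rho>" using c e by (simp add: \<rho>_def)
  show thesis
  proof (rule that[OF \<rho>])
    fix u :: "R3 \<Rightarrow> real" and y :: R3 assume u: "sq_int lborel u" and rad: "radial u" and y: "\<rho> \<le> norm y"
    have y0: "0 < norm y" using \<rho> y by linarith
    have same: "pot u (norm y *\<^sub>R z) = pot u y" if z: "z \<in> Z" for z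
    proof -
      have n: "norm y = norm (norm y *\<^sub>R z)" using z Z(3) by auto
      obtain R where "orthogonal_transformation R" "R y = norm y *\<^sub>R z"
        using orthogonal_transformation_between[OF n] by auto
      then show ?thesis using pot_rotation[OF u rad, of R y] by simp
    qed
    define s where "s = c * norm y / 2"
    have s: "0 < s" using c y0 by (simp add: s_def)
    define Z' where "Z' = (\<lambda>z. norm y *\<^sub>R z) ` Z"
    have inj: "inj_on (\<lambda>z. norm y *\<^sub>R z) Z" using y0 by (auto simp: inj_on_def)
    have Z': "finite Z'" "card Z' = N" using Z inj by (auto simp: Z'_def card_image)
    have sep: "2 * s \<le> dist z w" if "z \<in> Z'" "w \<in> Z'" "z \<noteq> w" for z w
    proof -
      obtain a b where ab: "a \<in> Z" "b \<in> Z" "z = norm y *\<^sub>R a" "w = norm y *\<^sub>R b"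
        using \<open>z \<in> Z'\<close> \<open>w \<in> Z'\<close> by (auto simp: Z'_def)
      then have "c \<le> dist a b" using cs that(3) by auto
      moreover have "dist z w = norm y * dist a b"
        unfolding ab dist_norm by (simp flip: scaleR_diff_right)
      ultimately show ?thesis using y0 by (simp add: s_def mult.commute)
    qed
    have "real N * pot u y = (\<Sum>z\<in>Z'. pot u z)"
      using same Z(2) by (simp add: Z'_def sum.reindex[OF inj])
    also have "\<dots> = (\<integral>x. (\<Sum>z\<in>Z'. ker (dist z x) * (u x)\<^sup>2) \<partial>lborel)"
      unfolding pot_def by (rule Bochner_Integration.integral_sum[symmetric]) (rule ker_sq_integrable[OF u])
    also have "\<dots> \<le> (\<integral>x. (1 + real N / s) * (u x)\<^sup>2 \<partial>lborel)"
    proof (rule integral_mono)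
      show "integrable lborel (\<lambda>x. \<Sum>z\<in>Z'. ker (dist z x) * (u x)\<^sup>2)"
        by (intro Bochner_Integration.integrable_sum ker_sq_integrable[OF u])
      show "integrable lborel (\<lambda>x. (1 + real N / s) * (u x)\<^sup>2)"
        using sq_int_integrable[OF u] by simp
      show "(\<Sum>z\<in>Z'. ker (dist z x) * (u x)\<^sup>2) \<le> (1 + real N / s) * (u x)\<^sup>2" for x
        using sum_ker_separated[OF Z'(1) s sep, of x] Z'(2)
        by (simp add: mult_right_mono flip: sum_distrib_right)
    qed
    also have "\<dots> = (1 + real N / s) * nsq lborel u" by (simp add: nsq_def)
    finally have "pot u y \<le> (1 / real N + 1 / s) * nsq lborel u"
      using N(1) by (simp add: field_simps)
    also have "\<dots> \<le> e * nsq lborel u"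
    proof (rule mult_right_mono)
      have "4 / e \<le> c * norm y"
        using y c e by (simp add: \<rho>_def field_simps)
      then have "1 / s \<le> e / 2" using s e by (simp add: s_def field_simps)
      then show "1 / real N + 1 / s \<le> e" using N(2) by linarith
    qed simp
    finally show "pot u y \<le> e * nsq lborel u" .
  qed
qed

text \<open>Cutting off loses only pairs with a point outside the ball. By symmetry of the kernel
  they cost at most twice the exterior integral of u^2 times the potential, and there the potential
  is small even if the L2 mass is not.\<close>

lemma radial_energy_tail:
  assumes u: "sq_int lborel u" and tail: "\<And>y. \<rho> \<le> norm y \<Longrightarrow> pot u y \<le> e * nsq lborel u"
  shows "energy u - energy (\<lambda>x. indicator (ball 0 \<rho>) x * u x) \<le> 2 * e * (nsq lborel u)\<^sup>2"
proof -
  let ?W = "lborel \<Otimes>\<^sub>M lborel :: (R3 \<times> R3) measure"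
  have [measurable]: "u \<in> borel_measurable borel" using u by (auto simp: sq_int_def)
  define I where "I x = (indicator (ball (0::R3) \<rho>) x :: real)" for x
  have [measurable]: "I \<in> borel_measurable borel" unfolding I_def by measurable
  have I01: "0 \<le> I x" "I x \<le> 1" "I x = 0 \<or> I x = 1" for x by (auto simp: I_def indicator_def)
  have Ib: "\<bar>I x\<bar> \<le> 1" for x using I01[of x] by simp
  have Iu: "sq_int lborel (\<lambda>x. I x * u x)" by (rule bounded_mult_sq_int(1)[OF u _ Ib]) measurable
  have F: "integrable ?W (\<lambda>p. (Dfun u p)\<^sup>2)" by (rule Dfun_sq_integrable[OF u])
  have Fm[measurable]: "(\<lambda>p. (Dfun u p)\<^sup>2) \<in> borel_measurable ?W" using F by auto
  define G where "G p = (1 - I (fst p)) * (Dfun u p)\<^sup>2" for p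
  have [measurable]: "G \<in> borel_measurable ?W" unfolding G_def by measurable
  have G: "integrable ?W G"
    by (rule Bochner_Integration.integrable_bound[OF F])
       (use I01 in \<open>auto simp: G_def abs_mult intro!: AE_I2 mult_left_le_one_le\<close>)
  define G' where "G' p = (1 - I (snd p)) * (Dfun u p)\<^sup>2" for p
  have sym: "(\<lambda>(x, y). G (y, x)) = G'"
    by (auto simp: G_def G'_def Dfun_sq dist_commute mult_ac)
  have G': "integrable ?W G'" "integral\<^sup>L ?W G' = integral\<^sup>L ?W G"
    using lborel_pair.integrable_product_swap[OF G] lborel_pair.integral_product_swap[of G] sym by simp_all
  have "energy u - energy (\<lambda>x. I x * u x) = (\<integral>p. (Dfun u p)\<^sup>2 - (Dfun (\<lambda>x. I x * u x) p)\<^sup>2 \<partial>?W)"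
    unfolding energy_def nsq_def using F Dfun_sq_integrable[OF Iu] by simp
  also have "\<dots> \<le> (\<integral>p. G p + G' p \<partial>?W)"
  proof (rule integral_mono)
    show "integrable ?W (\<lambda>p. (Dfun u p)\<^sup>2 - (Dfun (\<lambda>x. I x * u x) p)\<^sup>2)"
      using F Dfun_sq_integrable[OF Iu] by simp
    show "integrable ?W (\<lambda>p. G p + G' p)" using G G' by simp
    fix p :: "R3 \<times> R3"
    obtain x y where p: "p = (x, y)" by fastforce
    have "(Dfun (\<lambda>x. I x * u x) p)\<^sup>2 = ((I x)\<^sup>2 * (I y)\<^sup>2) * (Dfun u p)\<^sup>2"
      by (simp add: p Dfun_sq power_mult_distrib)
    moreover have "(1 - (I x)\<^sup>2 * (I y)\<^sup>2) \<le> (1 - I x) + (1 - I y)" using I01(3)[of x] I01(3)[of y] by auto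
    ultimately show "(Dfun u p)\<^sup>2 - (Dfun (\<lambda>x. I x * u x) p)\<^sup>2 \<le> G p + G' p"
      using mult_right_mono[of "1 - (I x)\<^sup>2 * (I y)\<^sup>2" "(1 - I x) + (1 - I y)" "(Dfun u p)\<^sup>2"]
      by (simp add: G_def G'_def p algebra_simps)
  qed
  also have "\<dots> = 2 * integral\<^sup>L ?W G" using G G' by simp
  also have "integral\<^sup>L ?W G = (\<integral>x. (1 - I x) * (u x)\<^sup>2 * pot u x \<partial>lborel)"
  proof -
    have "integral\<^sup>L ?W G = (\<integral>x. (\<integral>y. G (x, y) \<partial>lborel) \<partial>lborel)"
      using lborel_pair.integral_fst'[OF G] by simp
    also have "\<dots> = (\<integral>x. (1 - I x) * (u x)\<^sup>2 * pot u x \<partial>lborel)"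
    proof (intro Bochner_Integration.integral_cong refl)
      fix x
      have "G (x, y) = ((1 - I x) * (u x)\<^sup>2) * (ker (dist x y) * (u y)\<^sup>2)" for y
        by (simp add: G_def Dfun_sq mult_ac)
      then show "(\<integral>y. G (x, y) \<partial>lborel) = (1 - I x) * (u x)\<^sup>2 * pot u x"
        by (simp add: pot_def)
    qed
    finally show ?thesis .
  qed
  also have "\<dots> \<le> (\<integral>x. (e * nsq lborel u) * (u x)\<^sup>2 \<partial>lborel)"
  proof (rule integral_mono')
    show "integrable lborel (\<lambda>x. (e * nsq lborel u) * (u x)\<^sup>2)" using sq_int_integrable[OF u] by simp
    have pot0: "0 \<le> pot u x" for x
      unfolding pot_def using less_imp_le[OF ker_pos] by (intro Bochner_Integration.integral_nonneg) simp
    \<comment> \<open>The potential is nonnegative, so the tail estimate at one point of norm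
      |\<rho>| shows its right side to be nonnegative.\<close>
    have en: "0 \<le> e * nsq lborel u"
      using order_trans[OF pot0 tail[of "(\<bar>\<rho>\<bar>) *\<^sub>R axis 1 1"]] by simp
    fix x
    show "0 \<le> (e * nsq lborel u) * (u x)\<^sup>2" using en by simp
    show "(1 - I x) * (u x)\<^sup>2 * pot u x \<le> (e * nsq lborel u) * (u x)\<^sup>2"
    proof (cases "\<rho> \<le> norm x")
      case True
      then show ?thesis
        using mult_right_mono[OF tail[OF True], of "(u x)\<^sup>2"] by (simp add: I_def indicator_def mult.commute)
    next
      case False
      then show ?thesis using en by (simp add: I_def indicator_def)
    qed
  qed
  also have "\<dots> = e * (nsq lborel u)\<^sup>2" by (simp add: nsq_def power2_eq_square)
  finally show ?thesis unfolding I_def by simp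
qed

subsection \<open>Polarization\<close>

text \<open>For a unit vector e, the reflection across the hyperplane
  \<open>x \<bullet> e = t\<close>.\<close>

definition mirror :: "R3 \<Rightarrow> real \<Rightarrow> R3 \<Rightarrow> R3" where
  "mirror e t x = x - (2 * (x \<bullet> e - t)) *\<^sub>R e"

text \<open>Two-point rearrangement: within each pair of mirror images the larger value goes to the
  near side \<open>x \<bullet> e < t\<close>, which contains the origin when t > 0.\<close>

definition polarize :: "R3 \<Rightarrow> real \<Rightarrow> (R3 \<Rightarrow> real) \<Rightarrow> R3 \<Rightarrow> real" where
  "polarize e t v x = (if x \<bullet> e < t then max (v x) (v (mirror e t x)) else min (v x) (v (mirror e t x)))"

context
  fixes e :: R3 and t :: real
  assumes e: "norm e = 1"
begin

lemma unit_inner: "e \<bullet> e = 1"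
  using e by (simp add: norm_eq_1)

lemma mirror_inner: "mirror e t x \<bullet> e = 2 * t - x \<bullet> e"
  by (simp add: mirror_def inner_diff_left unit_inner)

lemma mirror_mirror [simp]: "mirror e t (mirror e t x) = x"
proof -
  have "mirror e t (mirror e t x) = mirror e t x - (2 * (t - x \<bullet> e)) *\<^sub>R e"
    by (simp add: mirror_def[of e t "mirror e t x"] mirror_inner)
  also have "\<dots> = x - ((2 * (x \<bullet> e - t)) *\<^sub>R e + (2 * (t - x \<bullet> e)) *\<^sub>R e)"
    by (simp only: mirror_def diff_diff_eq)
  also have "\<dots> = x" by (simp flip: scaleR_add_left)
  finally show ?thesis .
qed

lemma mirror_boundary: "x \<bullet> e = t \<Longrightarrow> mirror e t x = x"
  by (simp add: mirror_def)

text \<open>The source of all distance comparisons: for x and y on the same side the added term is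
  nonnegative, and x = 0 compares norms.\<close>

lemma mirror_dist_sq: "(dist x (mirror e t y))\<^sup>2 = (dist x y)\<^sup>2 + 4 * (t - x \<bullet> e) * (t - y \<bullet> e)"
  unfolding dist_norm power2_norm_eq_inner mirror_def
  by (simp add: inner_diff_left inner_diff_right unit_inner inner_commute algebra_simps)

lemma mirror_dist: "dist (mirror e t x) (mirror e t y) = dist x y"
proof -
  have "(dist (mirror e t x) (mirror e t y))\<^sup>2 = (dist y (mirror e t x))\<^sup>2 + 4 * (t - mirror e t x \<bullet> e) * (t - y \<bullet> e)"
    by (simp add: mirror_dist_sq dist_commute)
  also have "\<dots> = (dist x y)\<^sup>2"
    by (simp add: mirror_dist_sq mirror_inner dist_commute algebra_simps)
  finally show ?thesis by simp
qed

lemma mirror_dist_swap: "dist (mirror e t x) y = dist x (mirror e t y)"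
  using mirror_dist[of x "mirror e t y"] by simp

lemma mirror_dist_ge:
  assumes "x \<bullet> e \<le> t" "y \<bullet> e \<le> t"
  shows "dist x y \<le> dist x (mirror e t y)"
proof (rule power2_le_imp_le)
  show "(dist x y)\<^sup>2 \<le> (dist x (mirror e t y))\<^sup>2"
    using assms by (simp add: mirror_dist_sq)
qed simp

lemma mirror_norm_sq: "(norm (mirror e t x))\<^sup>2 = (norm x)\<^sup>2 + 4 * t * (t - x \<bullet> e)"
  using mirror_dist_sq[of 0 x] by (simp add: dist_norm)

lemma mirror_0_orthogonal: "orthogonal_transformation (mirror e 0)"
  unfolding orthogonal_transformation_def
proof
  show "linear (mirror e 0)"
    by (rule linearI) (auto simp: mirror_def inner_add_left algebra_simps scaleR_add_left)
  show "\<forall>v w. mirror e 0 v \<bullet> mirror e 0 w = v \<bullet> w"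
    by (simp add: mirror_def inner_diff_left inner_diff_right unit_inner inner_commute algebra_simps)
qed

lemma mirror_eq_shift: "mirror e t x = mirror e 0 x + (2 * t) *\<^sub>R e"
  by (simp add: mirror_def algebra_simps scaleR_diff_left)

lemma mirror_measure_preserving: "measure_preserving lborel (mirror e t)"
proof -
  have "measure_preserving lborel (\<lambda>x. mirror e 0 x + (2 * t) *\<^sub>R e)"
    by (rule measure_preserving_compose[OF measure_preserving_plus measure_preserving_orthogonal[OF mirror_0_orthogonal]])
  then show ?thesis by (simp add: mirror_eq_shift[symmetric])
qed

lemma mirror_measurable [measurable]: "mirror e t \<in> borel_measurable borel"
  using measure_preserving_measurable[OF mirror_measure_preserving] by simp

lemma polarize_le: "x \<bullet> e \<le> t \<Longrightarrow> polarize e t v x = max (v x) (v (mirror e t x))"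
  using mirror_boundary[of x] by (cases "x \<bullet> e = t") (auto simp: polarize_def)

lemma polarize_mirror: "x \<bullet> e \<le> t \<Longrightarrow> polarize e t v (mirror e t x) = min (v x) (v (mirror e t x))"
  by (auto simp: polarize_def mirror_inner min.commute)

lemma polarize_measurable:
  assumes [measurable]: "v \<in> borel_measurable borel"
  shows "polarize e t v \<in> borel_measurable borel"
  unfolding polarize_def[abs_def] by measurable

lemma polarize_nonneg: "(\<And>x. 0 \<le> v x) \<Longrightarrow> 0 \<le> polarize e t v x"
  by (auto simp: polarize_def max_def)

lemma polarize_sq_int:
  assumes v: "sq_int lborel v"
  shows "sq_int lborel (polarize e t v)"
proof -
  have [measurable]: "v \<in> borel_measurable borel" using v by (auto simp: sq_int_def)
  have a: "sq_int lborel (\<lambda>x. \<bar>f x\<bar>)" if "sq_int lborel f" for f :: "R3 \<Rightarrow> real"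
    using that by (auto simp: sq_int_def)
  have "sq_int lborel (\<lambda>x. \<bar>v x\<bar> + \<bar>v (mirror e t x)\<bar>)"
    by (intro sq_int_add a v measure_preserving_sq_int(1)[OF mirror_measure_preserving])
  then show ?thesis
    by (rule sq_int_bound(1)) (auto simp: polarize_def intro: polarize_measurable[simplified])
qed

lemma mirror_symmetrized_integral:
  fixes f :: "R3 \<Rightarrow> real"
  assumes "integrable lborel f"
  shows "integrable lborel (\<lambda>x. f x + f (mirror e t x))"
    "(\<integral>x. f x + f (mirror e t x) \<partial>lborel) = 2 * (\<integral>x. f x \<partial>lborel)"
proof -
  have i: "integrable lborel (\<lambda>x. f (mirror e t x))"
    by (rule measure_preserving_integrable[OF mirror_measure_preserving assms])
  then show "integrable lborel (\<lambda>x. f x + f (mirror e t x))" using assms by simp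
  have "f \<in> borel_measurable lborel" using assms by auto
  then show "(\<integral>x. f x + f (mirror e t x) \<partial>lborel) = 2 * (\<integral>x. f x \<partial>lborel)"
    using assms i measure_preserving_integral[OF mirror_measure_preserving, of f] by simp
qed

lemma weighted_two_point:
  fixes a b w1 w2 :: real
  assumes "0 \<le> a" "0 \<le> b" "w2 \<le> w1"
  shows "w1 * a\<^sup>2 + w2 * b\<^sup>2 \<le> w1 * (max a b)\<^sup>2 + w2 * (min a b)\<^sup>2"
proof (cases "b \<le> a")
  case False
  then have "a\<^sup>2 \<le> b\<^sup>2" using assms by (simp add: power_mono)
  then have "0 \<le> (w1 - w2) * (b\<^sup>2 - a\<^sup>2)" using assms by simp
  then show ?thesis using False by (simp add: algebra_simps)
qed simp

text \<open>Adding the integrand at mirror images reduces the inequality to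
  \<open>weighted_two_point\<close> for each pair. In the case of equality the nonnegative
  difference vanishes almost everywhere, and a strictly larger weight on the near side then excludes
  pairs that polarization would swap. Weights may be signed: 1 and -1 together give
  \<open>nsq_polarize\<close>.\<close>

lemma polarize_weight:
  fixes w v :: "R3 \<Rightarrow> real"
  assumes v: "sq_int lborel v" "\<And>x. 0 \<le> v x"
    and w: "w \<in> borel_measurable borel" "\<And>x. \<bar>w x\<bar> \<le> B" "\<And>x. x \<bullet> e \<le> t \<Longrightarrow> w (mirror e t x) \<le> w x"
  shows "(\<integral>x. w x * (v x)\<^sup>2 \<partial>lborel) \<le> (\<integral>x. w x * (polarize e t v x)\<^sup>2 \<partial>lborel)"
    "(\<integral>x. w x * (polarize e t v x)\<^sup>2 \<partial>lborel) \<le> (\<integral>x. w x * (v x)\<^sup>2 \<partial>lborel) \<Longrightarrow>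
     (\<And>x. x \<bullet> e < t \<Longrightarrow> w (mirror e t x) < w x) \<Longrightarrow> AE x in lborel. x \<bullet> e < t \<longrightarrow> v (mirror e t x) \<le> v x"
proof -
  have [measurable]: "w \<in> borel_measurable borel" using w by simp
  have int: "integrable lborel (\<lambda>x. w x * (f x)\<^sup>2)" if f: "sq_int lborel f" for f
  proof -
    have [measurable]: "f \<in> borel_measurable borel" using f by (auto simp: sq_int_def)
    have "integrable lborel (\<lambda>x. B * (f x)\<^sup>2)" using sq_int_integrable[OF f] by simp
    then show ?thesis
    proof (rule Bochner_Integration.integrable_bound)
      show "AE x in lborel. norm (w x * (f x)\<^sup>2) \<le> norm (B * (f x)\<^sup>2)"
        using w(2) by (intro AE_I2) (auto simp: abs_mult intro!: mult_right_mono order_trans[OF w(2) abs_ge_self])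
    qed measurable
  qed
  let ?f = "\<lambda>x. w x * (v x)\<^sup>2" and ?g = "\<lambda>x. w x * (polarize e t v x)\<^sup>2"
  let ?d = "\<lambda>x. (?g x + ?g (mirror e t x)) - (?f x + ?f (mirror e t x))"
  note f = mirror_symmetrized_integral[OF int[OF v(1)]]
  note g = mirror_symmetrized_integral[OF int[OF polarize_sq_int[OF v(1)]]]
  have id: "integrable lborel ?d" using f(1) g(1) by simp
  have d: "(\<integral>x. ?d x \<partial>lborel) = 2 * (\<integral>x. ?g x \<partial>lborel) - 2 * (\<integral>x. ?f x \<partial>lborel)"
    using f g by (subst Bochner_Integration.integral_diff) auto
  have half: "0 \<le> ?d x" if "x \<bullet> e \<le> t" for x
    using weighted_two_point[OF v(2) v(2) w(3)[OF that], of x "mirror e t x"] that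
    by (simp add: polarize_le polarize_mirror)
  have d0: "0 \<le> ?d x" for x
  proof (cases "x \<bullet> e \<le> t")
    case False
    then show ?thesis using half[of "mirror e t x"] by (simp add: mirror_inner)
  qed (rule half)
  have "0 \<le> (\<integral>x. ?d x \<partial>lborel)" by (rule Bochner_Integration.integral_nonneg) (rule d0)
  then show "(\<integral>x. ?f x \<partial>lborel) \<le> (\<integral>x. ?g x \<partial>lborel)" using d by simp
  assume le: "(\<integral>x. ?g x \<partial>lborel) \<le> (\<integral>x. ?f x \<partial>lborel)"
    and strict: "\<And>x. x \<bullet> e < t \<Longrightarrow> w (mirror e t x) < w x"
  have "(\<integral>x. ?d x \<partial>lborel) = 0" using \<open>0 \<le> (\<integral>x. ?d x \<partial>lborel)\<close> d le by simp
  then have "AE x in lborel. ?d x = 0"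
    using integral_nonneg_eq_0_iff_AE[OF id] d0 by simp
  then show "AE x in lborel. x \<bullet> e < t \<longrightarrow> v (mirror e t x) \<le> v x"
  proof eventually_elim
    case (elim x)
    show ?case
    proof (rule impI, rule ccontr)
      assume x: "x \<bullet> e < t" and "\<not> v (mirror e t x) \<le> v x"
      then have lt: "v x < v (mirror e t x)" by simp
      then have eq: "?d x = (w x - w (mirror e t x)) * ((v (mirror e t x))\<^sup>2 - (v x)\<^sup>2)"
        using x by (simp add: polarize_le polarize_mirror algebra_simps)
      have "0 < (w x - w (mirror e t x)) * ((v (mirror e t x))\<^sup>2 - (v x)\<^sup>2)"
        using strict[OF x] lt v(2)[of x] by (intro mult_pos_pos) (auto intro: power_strict_mono)
      then show False unfolding eq[symmetric] elim by simp
    qed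
  qed
qed

text \<open>Summing over the four mirror images of (x, y) leaves only two distances, the shorter one
  carrying the larger kernel value; polarization pairs equally ordered values at the shorter
  distance, which is favourable because \<open>\<Phi>\<close> is supermodular. With
  \<open>ker\<close> and a^2 b^2 this yields the energy inequality, with the indicator of short
  distances and -(a - b)^2 the oscillation inequality.\<close>

lemma polarize_pair:
  fixes k :: "real \<Rightarrow> real" and \<Phi> :: "real \<Rightarrow> real \<Rightarrow> real"
  assumes v: "\<And>x. 0 \<le> v x"
    and k: "\<And>s d. 0 \<le> s \<Longrightarrow> s \<le> d \<Longrightarrow> k d \<le> k s"
    and \<Phi>: "\<And>a a' b b'. 0 \<le> a \<Longrightarrow> a \<le> a' \<Longrightarrow> 0 \<le> b \<Longrightarrow> b \<le> b' \<Longrightarrow> \<Phi> a b' + \<Phi> a' b \<le> \<Phi> a b + \<Phi> a' b'"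
    and int: "integrable (lborel \<Otimes>\<^sub>M lborel) (\<lambda>(x, y). k (dist x y) * \<Phi> (v x) (v y))"
      "integrable (lborel \<Otimes>\<^sub>M lborel) (\<lambda>(x, y). k (dist x y) * \<Phi> (polarize e t v x) (polarize e t v y))"
  shows "(\<integral>(x, y). k (dist x y) * \<Phi> (v x) (v y) \<partial>(lborel \<Otimes>\<^sub>M lborel))
    \<le> (\<integral>(x, y). k (dist x y) * \<Phi> (polarize e t v x) (polarize e t v y) \<partial>(lborel \<Otimes>\<^sub>M lborel))"
proof -
  let ?W = "lborel \<Otimes>\<^sub>M lborel :: (R3 \<times> R3) measure"
  let ?r = "mirror e t" and ?p = "polarize e t v"
  define F where "F f p = (case p of (x, y) \<Rightarrow> k (dist x y) * \<Phi> (f x) (f y))" for f :: "R3 \<Rightarrow> real" and p :: "R3 \<times> R3"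
  define S where "S f x y = F f (x, y) + F f (?r x, y) + F f (x, ?r y) + F f (?r x, ?r y)" for f x y
  have mp1: "measure_preserving ?W (\<lambda>(x, y). (?r x, y))"
    using measure_preserving_pair[OF mirror_measure_preserving, of lborel "\<lambda>x. x"] sigma_finite_lborel
    by (simp add: measure_preserving_def)
  have mp2: "measure_preserving ?W (\<lambda>(x, y). (x, ?r y))"
    using measure_preserving_pair[of lborel "\<lambda>x. x", OF _ mirror_measure_preserving] sigma_finite_lborel
    by (simp add: measure_preserving_def)
  have mp3: "measure_preserving ?W (\<lambda>(x, y). (?r x, ?r y))"
    by (rule measure_preserving_pair[OF mirror_measure_preserving mirror_measure_preserving sigma_finite_lborel])
  have S4: "integrable ?W (\<lambda>(x, y). S f x y)" "(\<integral>(x, y). S f x y \<partial>?W) = 4 * integral\<^sup>L ?W (F f)"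
    if f: "integrable ?W (F f)" for f
  proof -
    have m: "F f \<in> borel_measurable ?W" using f by auto
    note i = measure_preserving_integrable[OF mp1 f] measure_preserving_integrable[OF mp2 f]
      measure_preserving_integrable[OF mp3 f]
    note j = measure_preserving_integral[OF mp1 m] measure_preserving_integral[OF mp2 m]
      measure_preserving_integral[OF mp3 m]
    have eq: "(\<lambda>(x, y). S f x y) = (\<lambda>p. F f p + F f (case p of (x, y) \<Rightarrow> (?r x, y))
        + F f (case p of (x, y) \<Rightarrow> (x, ?r y)) + F f (case p of (x, y) \<Rightarrow> (?r x, ?r y)))"
      by (auto simp: S_def)
    show "integrable ?W (\<lambda>(x, y). S f x y)" unfolding eq using f i by simp
    show "(\<integral>(x, y). S f x y \<partial>?W) = 4 * integral\<^sup>L ?W (F f)" unfolding eq using f i j by simp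
  qed
  have Sr: "S f (?r x) y = S f x y" "S f x (?r y) = S f x y" for f x y
    by (simp_all add: S_def)
  have half: "S v x y \<le> S ?p x y" if xy: "x \<bullet> e \<le> t" "y \<bullet> e \<le> t" for x y
  proof -
    define a a' b b' where "a = v x" and "a' = v (?r x)" and "b = v y" and "b' = v (?r y)"
    define K1 K2 where "K1 = k (dist x y)" and "K2 = k (dist x (?r y))"
    have K: "K2 \<le> K1" unfolding K1_def K2_def by (intro k mirror_dist_ge xy) auto
    have nn: "0 \<le> a" "0 \<le> a'" "0 \<le> b" "0 \<le> b'" using v by (auto simp: a_def a'_def b_def b'_def)
    have Sv: "S v x y = K1 * (\<Phi> a b + \<Phi> a' b') + K2 * (\<Phi> a b' + \<Phi> a' b)"
      by (simp add: S_def F_def mirror_dist mirror_dist_swap K1_def K2_def a_def a'_def b_def b'_def algebra_simps)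
    have Sp: "S ?p x y = K1 * (\<Phi> (max a a') (max b b') + \<Phi> (min a a') (min b b'))
        + K2 * (\<Phi> (max a a') (min b b') + \<Phi> (min a a') (max b b'))"
      using xy by (simp add: S_def F_def mirror_dist mirror_dist_swap K1_def K2_def a_def a'_def b_def b'_def
          polarize_le polarize_mirror algebra_simps)
    \<comment> \<open>If the values at x and at y are oppositely ordered under reflection,
      polarization exchanges the sums multiplying \<open>K1\<close> and \<open>K2\<close>; if they
      are equally ordered, nothing changes.\<close>
    have tp: "K1 * (p + q) + K2 * (r + s) \<le> K1 * (r + s) + K2 * (p + q)" if "p + q \<le> r + s" for p q r s
      using mult_nonneg_nonneg[of "K1 - K2" "(r + s) - (p + q)"] K that by (simp add: algebra_simps)
    show ?thesis
      unfolding Sv Sp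
      using nn tp[OF \<Phi>[of a a' b' b]] tp[OF \<Phi>[of a' a b b']]
      by (cases "a \<le> a'"; cases "b \<le> b'") (auto simp: max_def min_def algebra_simps)
  qed
  \<comment> \<open>\<open>S\<close> is invariant under reflection of either variable
    (\<open>Sr\<close>), so both points can be moved to the near side.\<close>
  have all: "S v x y \<le> S ?p x y" for x y
  proof -
    define x' where "x' = (if x \<bullet> e \<le> t then x else ?r x)"
    define y' where "y' = (if y \<bullet> e \<le> t then y else ?r y)"
    have "S f x y = S f x' y'" for f by (simp add: x'_def y'_def Sr)
    moreover have "x' \<bullet> e \<le> t" "y' \<bullet> e \<le> t" by (auto simp: x'_def y'_def mirror_inner)
    ultimately show ?thesis using half by simp
  qed
  have iv: "integrable ?W (F v)" "integrable ?W (F ?p)" using int by (auto simp: F_def[abs_def])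
  have "(\<integral>(x, y). S v x y \<partial>?W) \<le> (\<integral>(x, y). S ?p x y \<partial>?W)"
    using S4(1)[OF iv(1)] S4(1)[OF iv(2)] all by (intro integral_mono) (auto simp: split_beta')
  then show ?thesis using S4(2)[OF iv(1)] S4(2)[OF iv(2)] by (simp add: F_def[abs_def])
qed

lemma energy_polarize:
  assumes v: "sq_int lborel v" "\<And>x. 0 \<le> v x"
  shows "energy v \<le> energy (polarize e t v)"
proof -
  have eq: "energy f = (\<integral>(x, y). ker (dist x y) * ((f x)\<^sup>2 * (f y)\<^sup>2) \<partial>(lborel \<Otimes>\<^sub>M lborel))"
    "(\<lambda>p. (Dfun f p)\<^sup>2) = (\<lambda>(x, y). ker (dist x y) * ((f x)\<^sup>2 * (f y)\<^sup>2))" for f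
    by (auto simp: energy_def nsq_def Dfun_sq mult.assoc split_beta' intro!: Bochner_Integration.integral_cong)
  note p = polarize_sq_int[OF v(1)]
  show ?thesis
    unfolding eq(1)
  proof (rule polarize_pair[OF v(2), of ker "\<lambda>a b. a\<^sup>2 * b\<^sup>2"])
    show "ker d \<le> ker s" if "0 \<le> s" "s \<le> d" for s d by (rule ker_antimono[OF that])
    show "a\<^sup>2 * b'\<^sup>2 + a'\<^sup>2 * b\<^sup>2 \<le> a\<^sup>2 * b\<^sup>2 + a'\<^sup>2 * b'\<^sup>2"
      if "0 \<le> a" "a \<le> a'" "0 \<le> b" "b \<le> b'" for a a' b b' :: real
    proof -
      have "0 \<le> (a'\<^sup>2 - a\<^sup>2) * (b'\<^sup>2 - b\<^sup>2)"
        using that by (intro mult_nonneg_nonneg) (auto intro: power_mono)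
      then show ?thesis by (simp add: algebra_simps)
    qed
    show "integrable (lborel \<Otimes>\<^sub>M lborel) (\<lambda>(x, y). ker (dist x y) * ((v x)\<^sup>2 * (v y)\<^sup>2))"
      using Dfun_sq_integrable[OF v(1)] unfolding eq(2) .
    show "integrable (lborel \<Otimes>\<^sub>M lborel) (\<lambda>(x, y). ker (dist x y) * ((polarize e t v x)\<^sup>2 * (polarize e t v y)\<^sup>2))"
      using Dfun_sq_integrable[OF p] unfolding eq(2) .
  qed
qed

text \<open>The substitution y = x + h exhibits the oscillation as a double integral against a
  decreasing function of the distance, the form that \<open>polarize_pair\<close> expects.\<close>

lemma osc_eq_pair:
  assumes f: "sq_int lborel f"
  shows "integrable (lborel \<Otimes>\<^sub>M lborel) (\<lambda>(x, y). of_bool (dist x y < d) * (f x - f y)\<^sup>2)"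
    "osc d f = (\<integral>(x, y). of_bool (dist x y < d) * (f x - f y)\<^sup>2 \<partial>(lborel \<Otimes>\<^sub>M lborel))"
proof -
  have [measurable]: "f \<in> borel_measurable borel" using f by (auto simp: sq_int_def)
  let ?g = "\<lambda>(x, y). of_bool (dist x y < d) * (f x - f y)\<^sup>2 :: real"
  have [measurable]: "?g \<in> borel_measurable (lborel \<Otimes>\<^sub>M lborel)"
    unfolding of_bool_def by measurable
  have "(\<integral>\<^sup>+p. ennreal (?g p) \<partial>(lborel \<Otimes>\<^sub>M lborel)) = (\<integral>\<^sup>+x. \<integral>\<^sup>+y. ennreal (?g (x, y)) \<partial>lborel \<partial>lborel)"
    by (subst lborel.nn_integral_fst[symmetric]) auto
  also have "\<dots> = (\<integral>\<^sup>+x. \<integral>\<^sup>+h. ennreal (?g (x, h + x)) \<partial>lborel \<partial>lborel)"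
  proof (rule nn_integral_cong)
    fix x :: R3
    have "(\<lambda>y. ennreal (?g (x, y))) = (\<lambda>y. ennreal (if dist x y < d then (f x - f y)\<^sup>2 else 0))" by auto
    then have "(\<lambda>y. ennreal (?g (x, y))) \<in> borel_measurable borel" by simp
    then show "(\<integral>\<^sup>+y. ennreal (?g (x, y)) \<partial>lborel) = (\<integral>\<^sup>+h. ennreal (?g (x, h + x)) \<partial>lborel)"
      by (rule nn_integral_shift[symmetric])
  qed
  also have "\<dots> = (\<integral>\<^sup>+x. \<integral>\<^sup>+h. ennreal ((osc_fun d f (x, h))\<^sup>2) \<partial>lborel \<partial>lborel)"
    by (intro nn_integral_cong)
       (auto simp: osc_fun_def indicator_def dist_norm power2_commute add.commute)
  also have "\<dots> = ennreal (osc d f)" by (rule osc_eq_nn_integral(2)[OF f, symmetric])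
  finally have eq: "(\<integral>\<^sup>+p. ennreal (?g p) \<partial>(lborel \<Otimes>\<^sub>M lborel)) = ennreal (osc d f)" .
  have g0: "0 \<le> ?g p" for p by (simp add: split_beta')
  show i: "integrable (lborel \<Otimes>\<^sub>M lborel) ?g"
    using eq g0 by (intro integrableI_nonneg) (auto simp: less_top[symmetric])
  show "osc d f = integral\<^sup>L (lborel \<Otimes>\<^sub>M lborel) ?g"
    using nn_integral_eq_integral[OF i] eq g0 by (simp add: osc_def integral_nonneg_AE)
qed

lemma osc_polarize:
  assumes v: "sq_int lborel v" "\<And>x. 0 \<le> v x"
  shows "osc d (polarize e t v) \<le> osc d v"
proof -
  note p = polarize_sq_int[OF v(1)]
  have neg: "integrable (lborel \<Otimes>\<^sub>M lborel) (\<lambda>(x, y). of_bool (dist x y < d) * - (f x - f y)\<^sup>2)"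
    "(\<integral>(x, y). of_bool (dist x y < d) * - (f x - f y)\<^sup>2 \<partial>(lborel \<Otimes>\<^sub>M lborel)) = - osc d f"
    if f: "sq_int lborel f" for f
    using Bochner_Integration.integrable_minus[OF osc_eq_pair(1)[OF f, of d]] osc_eq_pair(2)[OF f, of d]
    by (simp_all add: split_beta')
  have "(\<integral>(x, y). of_bool (dist x y < d) * - (v x - v y)\<^sup>2 \<partial>(lborel \<Otimes>\<^sub>M lborel))
      \<le> (\<integral>(x, y). of_bool (dist x y < d) * - (polarize e t v x - polarize e t v y)\<^sup>2 \<partial>(lborel \<Otimes>\<^sub>M lborel))"
  proof (rule polarize_pair[OF v(2), of "\<lambda>s. of_bool (s < d)" "\<lambda>a b. - (a - b)\<^sup>2"])
    show "- (a - b')\<^sup>2 + - (a' - b)\<^sup>2 \<le> - (a - b)\<^sup>2 + - (a' - b')\<^sup>2"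
      if "0 \<le> a" "a \<le> a'" "0 \<le> b" "b \<le> b'" for a a' b b' :: real
    proof -
      have "0 \<le> 2 * ((a' - a) * (b' - b))" using that by simp
      then show ?thesis by (simp add: power2_eq_square algebra_simps)
    qed
  qed (use neg(1)[OF v(1)] neg(1)[OF p] in auto)
  then show ?thesis using neg(2)[OF v(1)] neg(2)[OF p] by simp
qed

lemma nsq_polarize:
  assumes v: "sq_int lborel v" "\<And>x. 0 \<le> v x"
  shows "nsq lborel (polarize e t v) = nsq lborel v"
  using polarize_weight(1)[OF v, of "\<lambda>_. 1" 1] polarize_weight(1)[OF v, of "\<lambda>_. -1" 1]
  by (simp add: nsq_def)

end

subsection \<open>Symmetrization\<close>

text \<open>Multiplication by sqrt w contracts L2, so this is continuity of \<open>nsq\<close> along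
  the sequence sqrt w * v n.\<close>

lemma weighted_tendsto:
  fixes w :: "'a \<Rightarrow> real"
  assumes v: "\<And>n. sq_int M (v n)" "sq_int M V" "(\<lambda>n. nsq M (\<lambda>x. v n x - V x)) \<longlonglongrightarrow> 0"
    and w: "w \<in> borel_measurable M" "\<And>x. 0 \<le> w x" "\<And>x. w x \<le> 1"
  shows "(\<lambda>n. \<integral>x. w x * (v n x)\<^sup>2 \<partial>M) \<longlonglongrightarrow> (\<integral>x. w x * (V x)\<^sup>2 \<partial>M)"
proof -
  have [measurable]: "w \<in> borel_measurable M" by (rule w)
  have b: "\<bar>sqrt (w x)\<bar> \<le> 1" for x using w(2,3)[of x] by simp
  have m: "(\<lambda>x. sqrt (w x)) \<in> borel_measurable M" by measurable
  have s: "sq_int M (\<lambda>x. sqrt (w x) * f x)" "nsq M (\<lambda>x. sqrt (w x) * f x) \<le> nsq M f"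
    if "sq_int M f" for f
    using bounded_mult_sq_int[OF that m b] by auto
  have eq: "nsq M (\<lambda>x. sqrt (w x) * f x) = (\<integral>x. w x * (f x)\<^sup>2 \<partial>M)" for f
    using w(2) by (simp add: nsq_def power_mult_distrib)
  have "(\<lambda>n. nsq M (\<lambda>x. sqrt (w x) * v n x)) \<longlonglongrightarrow> nsq M (\<lambda>x. sqrt (w x) * V x)"
  proof (rule nsq_tendsto)
    show "(\<lambda>n. nsq M (\<lambda>x. sqrt (w x) * v n x - sqrt (w x) * V x)) \<longlonglongrightarrow> 0"
    proof (rule tendsto_sandwich[OF _ _ tendsto_const v(3)])
      show "\<forall>\<^sub>F n in sequentially. nsq M (\<lambda>x. sqrt (w x) * v n x - sqrt (w x) * V x) \<le> nsq M (\<lambda>x. v n x - V x)"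
        using s(2)[OF sq_int_diff[OF v(1) v(2)]] by (simp add: right_diff_distrib)
    qed simp
  qed (intro s(1) v)+
  then show ?thesis by (simp add: eq)
qed

lemma ball_integral_tendsto:
  assumes u: "sq_int lborel u"
  shows "(\<lambda>n. \<integral>x. indicator (ball 0 (real n)) x * (u x)\<^sup>2 \<partial>(lborel :: R3 measure)) \<longlonglongrightarrow> nsq lborel u"
proof -
  have [measurable]: "u \<in> borel_measurable borel" using u by (auto simp: sq_int_def)
  have "(\<lambda>n. \<integral>x. indicator (ball 0 (real n)) x * (u x)\<^sup>2 \<partial>(lborel :: R3 measure)) \<longlonglongrightarrow> (\<integral>x. (u x)\<^sup>2 \<partial>lborel)"
  proof (rule integral_dominated_convergence[where w="\<lambda>x. (u x)\<^sup>2"])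
    show "integrable lborel (\<lambda>x. (u x)\<^sup>2)" using sq_int_integrable[OF u] by simp
    show "AE x in lborel. (\<lambda>n. indicator (ball 0 (real n)) x * (u x)\<^sup>2) \<longlonglongrightarrow> (u x)\<^sup>2"
    proof (rule AE_I2)
      fix x :: R3
      obtain N :: nat where "norm x < real N" using reals_Archimedean2 by blast
      then have "\<forall>n\<ge>N. indicator (ball 0 (real n)) x * (u x)\<^sup>2 = (u x)\<^sup>2"
        by (auto simp: indicator_def)
      then show "(\<lambda>n. indicator (ball 0 (real n)) x * (u x)\<^sup>2) \<longlonglongrightarrow> (u x)\<^sup>2"
        by (intro tendsto_eventually eventually_sequentiallyI[of N]) auto
    qed
    show "AE x in lborel. norm (indicator (ball 0 (real n)) x * (u x)\<^sup>2) \<le> (u x)\<^sup>2" for n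
      by (auto simp: indicator_def)
  qed measurable
  then show ?thesis by (simp add: nsq_def)
qed

text \<open>The closed class of competitors that contains all iterated polarizations of \<open>u\<close>
  with respect to half-spaces containing the origin.\<close>

definition pol_class :: "(R3 \<Rightarrow> real) \<Rightarrow> (R3 \<Rightarrow> real) set" where
  "pol_class u = {v. sq_int lborel v \<and> (\<forall>x. 0 \<le> v x) \<and> (\<forall>d>0. osc d v \<le> osc d u) \<and> energy u \<le> energy v \<and>
     nsq lborel v = nsq lborel u \<and>
     (\<forall>R. (\<integral>x. indicator (ball 0 R) x * (u x)\<^sup>2 \<partial>lborel) \<le> (\<integral>x. indicator (ball 0 R) x * (v x)\<^sup>2 \<partial>lborel))}"

text \<open>Any bounded weight strictly decreasing in |x| would serve: strictness brings a maximizer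
  into the equality case of \<open>polarize_weight\<close>.\<close>

definition radial_weight :: "R3 \<Rightarrow> real" where
  "radial_weight x = 1 / (1 + norm x)"

lemma radial_weight_bounds: "0 \<le> radial_weight x" "radial_weight x \<le> 1"
  by (simp_all add: radial_weight_def pos_divide_le_eq add_pos_nonneg)

lemma radial_weight_measurable [measurable]: "radial_weight \<in> borel_measurable borel"
  unfolding radial_weight_def[abs_def] by measurable

lemma mirror_norm:
  assumes "norm e = 1" "0 < t"
  shows "x \<bullet> e \<le> t \<Longrightarrow> norm x \<le> norm (mirror e t x)" "x \<bullet> e < t \<Longrightarrow> norm x < norm (mirror e t x)"
proof -
  show "norm x \<le> norm (mirror e t x)" if "x \<bullet> e \<le> t"
    using that assms mirror_norm_sq[OF assms(1), of t x] by (intro power2_le_imp_le[of "norm x"]) auto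
  show "norm x < norm (mirror e t x)" if "x \<bullet> e < t"
    using that assms mirror_norm_sq[OF assms(1), of t x] by (intro power2_less_imp_less[of "norm x"]) auto
qed

lemma polarize_pol_class:
  assumes v: "v \<in> pol_class u" and e: "norm e = 1" and t: "0 < t"
  shows "polarize e t v \<in> pol_class u"
proof -
  have v': "sq_int lborel v" "\<And>x. 0 \<le> v x" using v by (auto simp: pol_class_def)
  have "osc d (polarize e t v) \<le> osc d u" if "0 < d" for d
    using osc_polarize[OF e v'] v that unfolding pol_class_def by (blast intro: order_trans)
  moreover have "energy u \<le> energy (polarize e t v)"
    using energy_polarize[OF e v'] v unfolding pol_class_def by (blast intro: order_trans)
  moreover have "(\<integral>x. indicator (ball 0 R) x * (u x)\<^sup>2 \<partial>lborel)
      \<le> (\<integral>x. indicator (ball 0 R) x * (polarize e t v x)\<^sup>2 \<partial>lborel)" for R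
  proof -
    have "(\<integral>x. indicator (ball 0 R) x * (v x)\<^sup>2 \<partial>lborel)
      \<le> (\<integral>x. indicator (ball 0 R) x * (polarize e t v x)\<^sup>2 \<partial>lborel)"
    proof (rule polarize_weight(1)[OF e v', where B=1])
      show "indicator (ball 0 R) (mirror e t x) \<le> (indicator (ball 0 R) x :: real)" if "x \<bullet> e \<le> t" for x
        using mirror_norm(1)[OF e t that] by (auto simp: indicator_def)
    qed (auto simp: indicator_def)
    then show ?thesis using v unfolding pol_class_def by (blast intro: order_trans)
  qed
  ultimately show ?thesis
    using v polarize_sq_int[OF e v'(1)] polarize_nonneg[OF e v'(2)] nsq_polarize[OF e v']
    by (simp add: pol_class_def)
qed

text \<open>The condition on balls bounds the L2 tail of every member by that of u at the same
  radius, which upgrades local convergence to convergence in L2. The remaining conditions are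
  continuous in L2.\<close>

lemma pol_class_compact:
  assumes v: "\<And>n. v n \<in> pol_class u" and u: "sq_int lborel u" and A: "\<And>d. 0 < d \<Longrightarrow> osc d u \<le> moment d * A"
  obtains r V where "strict_mono (r :: nat \<Rightarrow> nat)" "V \<in> pol_class u"
    "(\<lambda>n. nsq lborel (\<lambda>x. v (r n) x - V x)) \<longlonglongrightarrow> 0"
proof -
  have v': "sq_int lborel (v n)" "\<And>x. 0 \<le> v n x" "nsq lborel (v n) = nsq lborel u" for n
    using v[of n] by (auto simp: pol_class_def)
  have "\<exists>r :: nat \<Rightarrow> nat. strict_mono r \<and> (\<forall>R. L2_Cauchy lborel (\<lambda>n x. indicator (ball 0 R) x * v (r n) x))"
  proof (rule local_compactness[of v "nsq lborel u" A])
    show "osc d (v n) \<le> moment d * A" if "0 < d" for n d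
      using v[of n] A[OF that] that unfolding pol_class_def by (blast intro: order_trans)
  qed (use v' in auto)
  then obtain r :: "nat \<Rightarrow> nat" where r: "strict_mono r"
    and loc: "\<And>R. L2_Cauchy lborel (\<lambda>n x. indicator (ball 0 R) x * v (r n) x)" by blast
  have ib: "sq_int lborel (\<lambda>x. indicator (ball 0 R) x * f x)" "sq_int lborel (\<lambda>x. (1 - indicator (ball 0 R) x) * f x)"
    if "sq_int lborel f" for R and f :: "R3 \<Rightarrow> real"
    by (rule bounded_mult_sq_int(1)[OF that, of _ 1]; simp add: indicator_def)+
  have split: "nsq lborel f = nsq lborel (\<lambda>x. indicator (ball 0 R) x * f x) + nsq lborel (\<lambda>x. (1 - indicator (ball 0 R) x) * f x)"
    if "sq_int lborel f" for R and f :: "R3 \<Rightarrow> real"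
  proof -
    have "nsq lborel f = (\<integral>x. (norm (indicator (ball 0 R) x * f x))\<^sup>2 + (norm ((1 - indicator (ball 0 R) x) * f x))\<^sup>2 \<partial>lborel)"
      unfolding nsq_def by (intro Bochner_Integration.integral_cong) (auto simp: indicator_def)
    also have "\<dots> = nsq lborel (\<lambda>x. indicator (ball 0 R) x * f x) + nsq lborel (\<lambda>x. (1 - indicator (ball 0 R) x) * f x)"
      unfolding nsq_def
      by (intro Bochner_Integration.integral_add sq_int_integrable ib that)
    finally show ?thesis .
  qed
  have ball_eq: "nsq lborel (\<lambda>x. indicator (ball 0 R) x * f x) = (\<integral>x. indicator (ball 0 R) x * (f x)\<^sup>2 \<partial>lborel)" for R and f :: "R3 \<Rightarrow> real"
    unfolding nsq_def by (intro Bochner_Integration.integral_cong) (auto simp: indicator_def)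
  have tail: "nsq lborel (\<lambda>x. (1 - indicator (ball 0 R) x) * v n x)
      \<le> nsq lborel u - (\<integral>x. indicator (ball 0 R) x * (u x)\<^sup>2 \<partial>lborel)" for n R
  proof -
    have "(\<integral>x. indicator (ball 0 R) x * (u x)\<^sup>2 \<partial>lborel) \<le> (\<integral>x. indicator (ball 0 R) x * (v n x)\<^sup>2 \<partial>lborel)"
      using v[of n] by (simp add: pol_class_def)
    then show ?thesis using split[OF v'(1)[of n], of R] v'(3)[of n] ball_eq[of R "v n"] by linarith
  qed
  have cau: "L2_Cauchy lborel (\<lambda>n. v (r n))"
    unfolding L2_Cauchy_def
  proof (intro allI impI)
    fix e :: real assume e: "0 < e"
    have "\<forall>\<^sub>F n in sequentially. nsq lborel u - e / 8 < (\<integral>x. indicator (ball 0 (real n)) x * (u x)\<^sup>2 \<partial>(lborel :: R3 measure))"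
      using e by (intro order_tendstoD(1)[OF ball_integral_tendsto[OF u]]) simp
    then obtain R :: nat where "nsq lborel u - e / 8 < (\<integral>x. indicator (ball 0 (real R)) x * (u x)\<^sup>2 \<partial>(lborel :: R3 measure))"
      unfolding eventually_sequentially by blast
    then have R: "nsq lborel u - (\<integral>x. indicator (ball 0 (real R)) x * (u x)\<^sup>2 \<partial>(lborel :: R3 measure)) < e / 8"
      by linarith
    obtain N where N: "\<And>n m. n \<ge> N \<Longrightarrow> m \<ge> N \<Longrightarrow>
        nsq lborel (\<lambda>x. indicator (ball 0 (real R)) x * v (r n) x - indicator (ball 0 (real R)) x * v (r m) x) < e / 2"
      using loc[of "real R", unfolded L2_Cauchy_def, rule_format, of "e / 2"] e by auto
    show "\<exists>N. \<forall>n\<ge>N. \<forall>m\<ge>N. nsq lborel (\<lambda>x. v (r n) x - v (r m) x) < e"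
    proof (intro exI[of _ N] allI impI)
      fix n m assume nm: "N \<le> n" "N \<le> m"
      have "nsq lborel (\<lambda>x. (1 - indicator (ball 0 (real R)) x) * (v (r n) x - v (r m) x))
          \<le> 2 * nsq lborel (\<lambda>x. (1 - indicator (ball 0 (real R)) x) * v (r n) x)
            + 2 * nsq lborel (\<lambda>x. (1 - indicator (ball 0 (real R)) x) * v (r m) x)"
        using nsq_diff_le[OF ib(2)[OF v'(1)] ib(2)[OF v'(1)], of "real R" "r n" "real R" "r m"]
        by (simp add: right_diff_distrib)
      then have 1: "nsq lborel (\<lambda>x. (1 - indicator (ball 0 (real R)) x) * (v (r n) x - v (r m) x)) < e / 2"
        using tail[of "real R" "r n"] tail[of "real R" "r m"] R by linarith
      have 2: "nsq lborel (\<lambda>x. indicator (ball 0 (real R)) x * (v (r n) x - v (r m) x)) < e / 2"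
        using N[OF nm] by (simp add: right_diff_distrib)
      show "nsq lborel (\<lambda>x. v (r n) x - v (r m) x) < e"
        using split[OF sq_int_diff[OF v'(1)[of "r n"] v'(1)[of "r m"]], of "real R"] 1 2 by linarith
    qed
  qed
  obtain V0 where V0: "sq_int lborel V0" "(\<lambda>n. nsq lborel (\<lambda>x. v (r n) x - V0 x)) \<longlonglongrightarrow> 0"
    using cau by (rule L2_complete[where f="\<lambda>n. v (r n)", OF v'(1)])
  \<comment> \<open>The class asks for nonnegativity at every point, which a mere L2 limit lacks;
    replacing \<open>V0\<close> by its absolute value does not increase its distance to nonnegative
    functions.\<close>
  define V where "V x = \<bar>V0 x\<bar>" for x
  have V: "sq_int lborel V" using V0(1) by (auto simp: V_def[abs_def] sq_int_def)
  have lim: "(\<lambda>n. nsq lborel (\<lambda>x. v (r n) x - V x)) \<longlonglongrightarrow> 0"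
  proof (rule tendsto_sandwich[OF _ _ tendsto_const V0(2)])
    show "\<forall>\<^sub>F n in sequentially. nsq lborel (\<lambda>x. v (r n) x - V x) \<le> nsq lborel (\<lambda>x. v (r n) x - V0 x)"
    proof (intro always_eventually allI sq_int_bound(2) sq_int_diff v' V0)
      show "(\<lambda>x. v (r n) x - V x) \<in> borel_measurable lborel" for n
        using sq_int_diff[OF v'(1)[of "r n"] V] by auto
      show "norm (v (r n) x - V x) \<le> norm (v (r n) x - V0 x)" for n x
        using v'(2)[of "r n" x] by (simp add: V_def)
    qed
  qed simp
  have "V \<in> pol_class u"
  proof -
    note T = v'(1) V lim
    have "osc d V \<le> osc d u" if "0 < d" for d
      using osc_tendsto[OF T, of d] by (rule LIMSEQ_le_const2) (use v that in \<open>auto simp: pol_class_def\<close>)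
    moreover have "energy u \<le> energy V"
      using energy_tendsto[OF T] by (rule LIMSEQ_le_const) (use v in \<open>auto simp: pol_class_def\<close>)
    moreover have "nsq lborel V = nsq lborel u"
      using nsq_tendsto[OF T] by (simp add: v'(3) LIMSEQ_const_iff)
    moreover have "(\<integral>x. indicator (ball 0 R) x * (u x)\<^sup>2 \<partial>lborel) \<le> (\<integral>x. indicator (ball 0 R) x * (V x)\<^sup>2 \<partial>lborel)" for R
    proof (rule LIMSEQ_le_const)
      show "(\<lambda>n. \<integral>x. indicator (ball 0 R) x * (v (r n) x)\<^sup>2 \<partial>lborel) \<longlonglongrightarrow> (\<integral>x. indicator (ball 0 R) x * (V x)\<^sup>2 \<partial>lborel)"
        by (rule weighted_tendsto[OF T]) (auto simp: indicator_def)
    qed (use v in \<open>auto simp: pol_class_def\<close>)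
    ultimately show ?thesis using V by (simp add: pol_class_def V_def)
  qed
  with r show thesis using lim by (rule that)
qed

text \<open>Direct method: a maximizing sequence converges along a subsequence inside the class, and
  the weighted integral is continuous in L2.\<close>

lemma pol_class_maximizer:
  assumes u: "sq_int lborel u" "\<And>x. 0 \<le> u x" and A: "\<And>d. 0 < d \<Longrightarrow> osc d u \<le> moment d * A"
  obtains V where "V \<in> pol_class u"
    "\<And>v. v \<in> pol_class u \<Longrightarrow> (\<integral>x. radial_weight x * (v x)\<^sup>2 \<partial>lborel) \<le> (\<integral>x. radial_weight x * (V x)\<^sup>2 \<partial>lborel)"
proof -
  define J where "J v = (\<integral>x. radial_weight x * (v x)\<^sup>2 \<partial>lborel)" for v
  have Jb: "J v \<le> nsq lborel u" if v: "v \<in> pol_class u" for v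
  proof -
    have v2: "integrable lborel (\<lambda>x. (v x)\<^sup>2)" using v sq_int_integrable[of lborel v] by (simp add: pol_class_def)
    have "J v \<le> (\<integral>x. (v x)\<^sup>2 \<partial>lborel)"
      unfolding J_def
      by (rule integral_mono'[OF v2]) (use radial_weight_bounds in \<open>auto intro: mult_left_le_one_le\<close>)
    then show ?thesis using v by (simp add: pol_class_def nsq_real)
  qed
  have uK: "u \<in> pol_class u" using u by (simp add: pol_class_def)
  define s where "s = Sup (J ` pol_class u)"
  have bdd: "bdd_above (J ` pol_class u)" using Jb by (intro bdd_aboveI2)
  have Js: "J v \<le> s" if "v \<in> pol_class u" for v
    unfolding s_def using that bdd by (intro cSup_upper) auto
  have "\<exists>v\<in>pol_class u. s - inverse (real (Suc n)) < J v" for n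
    using less_cSup_iff[of "J ` pol_class u" "s - inverse (real (Suc n))"] uK bdd
    by (auto simp: s_def[symmetric] simp del: of_nat_Suc)
  then obtain v where v: "\<And>n. v n \<in> pol_class u" "\<And>n. s - inverse (real (Suc n)) < J (v n)" by metis
  have "\<exists>r V. strict_mono (r :: nat \<Rightarrow> nat) \<and> V \<in> pol_class u \<and> (\<lambda>n. nsq lborel (\<lambda>x. v (r n) x - V x)) \<longlonglongrightarrow> 0"
    by (rule pol_class_compact[of v, OF v(1) u(1) A]) (auto intro!: exI)
  then obtain r V where r: "strict_mono (r :: nat \<Rightarrow> nat)" and V: "V \<in> pol_class u"
    and lim: "(\<lambda>n. nsq lborel (\<lambda>x. v (r n) x - V x)) \<longlonglongrightarrow> 0"
    by blast
  have "(\<lambda>n. J (v (r n))) \<longlonglongrightarrow> J V"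
    unfolding J_def
    by (rule weighted_tendsto) (use v(1) V lim radial_weight_bounds in \<open>auto simp: pol_class_def\<close>)
  moreover have "(\<lambda>n. J (v (r n))) \<longlonglongrightarrow> s"
  proof (rule LIMSEQ_subseq_LIMSEQ[OF _ r, unfolded comp_def])
    show "(\<lambda>n. J (v n)) \<longlonglongrightarrow> s"
    proof (rule tendsto_sandwich[OF _ _ _ tendsto_const])
      show "\<forall>\<^sub>F n in sequentially. s - inverse (real (Suc n)) \<le> J (v n)"
        using v(2) by (intro always_eventually allI less_imp_le)
      show "\<forall>\<^sub>F n in sequentially. J (v n) \<le> s" using Js v(1) by simp
      show "(\<lambda>n. s - inverse (real (Suc n))) \<longlonglongrightarrow> s"
        using tendsto_diff[OF tendsto_const LIMSEQ_inverse_real_of_nat, of s] by simp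
    qed
  qed
  ultimately have "J V = s" by (rule LIMSEQ_unique)
  then show thesis using that[OF V] Js by (simp add: J_def)
qed

text \<open>The assumption only covers t > 0. On the near side the excess of V at the mirror image
  for t = 0 is at most the change of V under a shift by 2 t, which has L2 norm O(t) by the gradient
  bound; letting t tend to 0 removes the excess.\<close>

lemma reflection_invariant_of_half_spaces:
  assumes V: "sq_int lborel V" and g: "sq_int lborel g" "weak_grad V g"
    and half: "\<And>e t. norm e = 1 \<Longrightarrow> 0 < t \<Longrightarrow> AE x in lborel. x \<bullet> e < t \<longrightarrow> V (mirror e t x) \<le> V x"
    and e: "norm e = 1"
  shows "AE x in lborel. V (mirror e 0 x) = V x"
proof -
  have [measurable]: "V \<in> borel_measurable borel" using V by (auto simp: sq_int_def)
  have one: "AE x in lborel. x \<bullet> f < 0 \<longrightarrow> V (mirror f 0 x) \<le> V x" if f: "norm f = 1" for f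
  proof -
    have mp: "measure_preserving lborel (mirror f 0)" by (rule mirror_measure_preserving[OF f])
    have [measurable]: "mirror f 0 \<in> borel_measurable borel" by (rule mirror_measurable[OF f])
    \<comment> \<open>The violation of the desired inequality on the near side, independent of t, so
      that a bound of order t^2 on \<open>nsq lborel D\<close> makes it vanish.\<close>
    define D where "D x = (if x \<bullet> f < 0 then max 0 (V (mirror f 0 x) - V x) else 0)" for x
    have Dm[measurable]: "D \<in> borel_measurable borel" unfolding D_def by measurable
    have VD: "sq_int lborel (\<lambda>x. V (mirror f 0 x) - V x)"
      by (intro sq_int_diff measure_preserving_sq_int(1)[OF mp] V)
    have D: "sq_int lborel D"
      by (rule sq_int_bound(1)[OF VD]) (auto simp: D_def)
    have small: "nsq lborel D \<le> (2 * t)\<^sup>2 * nsq lborel g" if t: "0 < t" for t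
    proof -
      let ?h = "(2 * t) *\<^sub>R f"
      have s: "sq_int lborel (\<lambda>x. V (x + ?h) - V x)" by (intro sq_int_diff sq_int_shift(1) V)
      have "nsq lborel D \<le> nsq lborel (\<lambda>x. V (mirror f 0 x + ?h) - V (mirror f 0 x))"
        unfolding nsq_def
      proof (rule integral_mono_AE)
        show "integrable lborel (\<lambda>x. (norm (D x))\<^sup>2)" using D by auto
        show "integrable lborel (\<lambda>x. (norm (V (mirror f 0 x + ?h) - V (mirror f 0 x)))\<^sup>2)"
          using measure_preserving_sq_int(1)[OF mp s] by auto
        show "AE x in lborel. (norm (D x))\<^sup>2 \<le> (norm (V (mirror f 0 x + ?h) - V (mirror f 0 x)))\<^sup>2"
          using half[OF f t]
        proof eventually_elim
          case (elim x)
          have "norm (D x) \<le> norm (V (mirror f 0 x + ?h) - V (mirror f 0 x))"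
            using elim t by (auto simp: D_def mirror_eq_shift[OF f, of t x])
          then show ?case by (rule power_mono) simp
        qed
      qed
      also have "\<dots> = nsq lborel (\<lambda>x. V (x + ?h) - V x)"
        by (rule measure_preserving_sq_int(2)[OF mp s])
      also have "\<dots> \<le> nsq lborel (\<lambda>x. ?h \<bullet> g x)" by (rule nsq_shift_diff_le[OF V g])
      also have "\<dots> \<le> nsq lborel (\<lambda>x. (2 * t) *\<^sub>R g x)"
      proof (rule sq_int_bound(2)[OF sq_int_scaleR[OF g(1)]])
        show "(\<lambda>x. ?h \<bullet> g x) \<in> borel_measurable lborel"
          by (rule sq_int_measurable[OF sq_int_inner_const[OF g(1)]])
        show "norm (?h \<bullet> g x) \<le> norm ((2 * t) *\<^sub>R g x)" for x
          using Cauchy_Schwarz_ineq2[of ?h "g x"] f by simp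
      qed
      finally show ?thesis by (simp add: nsq_scaleR)
    qed
    have "nsq lborel D \<le> 0"
    proof (rule LIMSEQ_le_const)
      have "(\<lambda>n. (2 * inverse (real (Suc n)))\<^sup>2 * nsq lborel g) \<longlonglongrightarrow> (2 * 0)\<^sup>2 * nsq lborel g"
        by (intro tendsto_intros LIMSEQ_inverse_real_of_nat)
      then show "(\<lambda>n. (2 * inverse (real (Suc n)))\<^sup>2 * nsq lborel g) \<longlonglongrightarrow> 0" by simp
      show "\<exists>N. \<forall>n\<ge>N. nsq lborel D \<le> (2 * inverse (real (Suc n)))\<^sup>2 * nsq lborel g"
        using small[of "inverse (real (Suc _))"] by (intro exI[of _ 0] allI impI small) simp
    qed
    then have "nsq lborel D = 0" using nsq_nonneg[of lborel D] by linarith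
    then have "AE x in lborel. D x = 0" by (rule nsq_eq_0_AE[OF D])
    then show ?thesis by eventually_elim (auto simp: D_def split: if_splits)
  qed
  \<comment> \<open>The unit vector -e defines the same reflection but the opposite near side, so
    the inequality holds on both sides; applying it at the mirror image gives equality.\<close>
  have neg: "mirror (- e) 0 = mirror e 0" by (auto simp: mirror_def)
  have "AE x in lborel. 0 < x \<bullet> e \<longrightarrow> V (mirror e 0 x) \<le> V x"
    using one[of "- e"] e by (simp add: neg)
  with one[OF e] have "AE x in lborel. V (mirror e 0 x) \<le> V x"
  proof eventually_elim
    case (elim x)
    consider "x \<bullet> e < 0" | "0 < x \<bullet> e" | "x \<bullet> e = 0" by linarith
    then show ?case
    proof cases
      case 3
      then show ?thesis using mirror_boundary[OF e, of x 0] by simp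
    qed (use elim in auto)
  qed
  moreover have "AE x in lborel. V (mirror e 0 (mirror e 0 x)) \<le> V (mirror e 0 x)"
    by (rule measure_preserving_AE[OF mirror_measure_preserving[OF e] \<open>AE x in lborel. V (mirror e 0 x) \<le> V x\<close>])
  ultimately show ?thesis by eventually_elim (simp add: mirror_mirror[OF e])
qed

text \<open>Every orthogonal transformation is a product of reflections: compose with the reflection that
  moves the image of a basis vector back, one basis vector at a time.\<close>

lemma radial_of_reflections:
  assumes inv: "\<And>e. norm e = 1 \<Longrightarrow> AE x in lborel. V (mirror e 0 x) = V x"
  shows "radial V"
proof -
  have *: "AE x in lborel. V (T x) = V x"
    if "finite S" "S \<subseteq> Basis" "orthogonal_transformation T" "\<And>b. b \<in> Basis - S \<Longrightarrow> T b = b" for S :: "R3 set" and T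
    using that
  proof (induction S arbitrary: T rule: finite_induct)
    case empty
    then have "linear T" by (simp add: orthogonal_transformation_linear)
    then have "T x = x" for x
      using linear_eq_on[of T "\<lambda>x. x" x Basis] empty linear_ident by (simp add: span_Basis)
    then show ?case by simp
  next
    case (insert b S)
    show ?case
    proof (cases "T b = b")
      case True
      then show ?thesis using insert by (intro insert.IH) auto
    next
      case False
      \<comment> \<open>The reflection along T b - b takes T b to b. It fixes every basis vector b'
        already fixed by T, because b' . T b = T b' . T b = b' . b makes b' orthogonal to T b -
        b.\<close>
      define c where "c = T b"
      define f where "f = (1 / norm (c - b)) *\<^sub>R (c - b)"
      have cb: "norm (c - b) \<noteq> 0" using False by (simp add: c_def)
      have f: "norm f = 1" using cb by (simp add: f_def)
      have nc: "c \<bullet> c = b \<bullet> b" using insert.prems(2) by (simp add: c_def orthogonal_transformation_def)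
      have oM: "orthogonal_transformation (mirror f 0)" by (rule mirror_0_orthogonal[OF f])
      have Mx: "mirror f 0 x = x - (2 * (x \<bullet> (c - b)) / (norm (c - b))\<^sup>2) *\<^sub>R (c - b)" for x
        by (simp add: mirror_def f_def power2_eq_square)
      have "2 * (c \<bullet> (c - b)) = (norm (c - b))\<^sup>2"
        using nc by (simp add: power2_norm_eq_inner inner_diff_left inner_diff_right inner_commute)
      then have Mc: "mirror f 0 c = b" using cb by (simp add: Mx)
      define T' where "T' = (\<lambda>x. mirror f 0 (T x))"
      have oT': "orthogonal_transformation T'"
        using orthogonal_transformation_compose[OF oM insert.prems(2)] by (simp add: T'_def comp_def)
      have fixed: "T' b' = b'" if b': "b' \<in> Basis - S" for b'
      proof (cases "b' = b")
        case True
        then show ?thesis using Mc by (simp add: T'_def c_def)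
      next
        case False
        then have Tb': "T b' = b'" using insert.prems(3) b' by auto
        have "b' \<bullet> c = T b' \<bullet> T b" by (simp add: Tb' c_def)
        also have "\<dots> = b' \<bullet> b" using insert.prems(2) by (simp add: orthogonal_transformation_def)
        finally have "b' \<bullet> (c - b) = 0" by (simp add: inner_diff_right)
        then show ?thesis by (simp add: T'_def Tb' Mx)
      qed
      have 1: "AE x in lborel. V (T' x) = V x"
        using insert.prems(1) by (intro insert.IH oT' fixed) auto
      have 2: "AE x in lborel. V (mirror f 0 (T' x)) = V (T' x)"
        by (rule measure_preserving_AE[OF measure_preserving_orthogonal[OF oT'] inv[OF f]])
      from 1 2 show ?thesis
        by eventually_elim (simp add: T'_def mirror_mirror[OF f])
    qed
  qed
  show ?thesis
    unfolding radial_def using *[of Basis] by auto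
qed

text \<open>No polarization with t > 0 can improve the maximizer, so the equality case of
  \<open>polarize_weight\<close> orders V on all these half-spaces. Membership in the class
  transports the L2 norm, the energy bound and the oscillation bound A.\<close>

lemma symmetrization:
  assumes u: "sq_int lborel u" "\<And>x. 0 \<le> u x" and A: "\<And>d. 0 < d \<Longrightarrow> osc d u \<le> moment d * A"
  obtains V g where "sq_int lborel V" "sq_int lborel g" "weak_grad V g" "nsq lborel g \<le> A"
    "nsq lborel V = nsq lborel u" "energy u \<le> energy V" "radial V"
proof -
  obtain V where V: "V \<in> pol_class u"
    and max: "\<And>v. v \<in> pol_class u \<Longrightarrow> (\<integral>x. radial_weight x * (v x)\<^sup>2 \<partial>lborel) \<le> (\<integral>x. radial_weight x * (V x)\<^sup>2 \<partial>lborel)"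
    using pol_class_maximizer[OF u A] by blast
  have V': "sq_int lborel V" "\<And>x. 0 \<le> V x" using V by (auto simp: pol_class_def)
  have "osc d V \<le> moment d * A" if "0 < d" for d
    using V A[OF that] that unfolding pol_class_def by (blast intro: order_trans)
  then obtain g where g: "sq_int lborel g" "weak_grad V g" "nsq lborel g \<le> A"
    using weak_grad_of_osc_bound[OF V'(1)] by blast
  have half: "AE x in lborel. x \<bullet> e < t \<longrightarrow> V (mirror e t x) \<le> V x" if e: "norm e = 1" and t: "0 < t" for e t
  proof (rule polarize_weight(2)[OF e V', where w=radial_weight and B=1])
    show "(\<integral>x. radial_weight x * (polarize e t V x)\<^sup>2 \<partial>lborel) \<le> (\<integral>x. radial_weight x * (V x)\<^sup>2 \<partial>lborel)"
      by (rule max[OF polarize_pol_class[OF V e t]])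
    show "radial_weight (mirror e t x) \<le> radial_weight x" if "x \<bullet> e \<le> t" for x
      using mirror_norm(1)[OF e t that] by (auto simp: radial_weight_def intro!: divide_left_mono mult_pos_pos add_pos_nonneg)
    show "radial_weight (mirror e t x) < radial_weight x" if "x \<bullet> e < t" for x
      using mirror_norm(2)[OF e t that] by (auto simp: radial_weight_def intro!: divide_strict_left_mono mult_pos_pos add_pos_nonneg)
  qed (use radial_weight_bounds in auto)
  have "radial V"
    by (rule radial_of_reflections) (rule reflection_invariant_of_half_spaces[OF V'(1) g(1,2) half])
  then show thesis using that[OF V'(1) g] V by (simp add: pol_class_def)
qed

subsection \<open>The minimization problem\<close>

lemma weak_grad_unique:
  assumes g: "sq_int lborel g" "weak_grad u g" and k: "sq_int lborel k" "weak_grad u k"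
  shows "nsq lborel g = nsq lborel k"
proof -
  have "AE x in lborel. g x $ i - k x $ i = 0" for i
  proof (rule test_fun_orthogonal_imp_AE_zero)
    show "sq_int lborel (\<lambda>x. g x $ i - k x $ i)" by (intro sq_int_diff sq_int_component g k)
    fix \<phi> assume \<phi>: "test_fun \<phi>"
    have int: "integrable lborel (\<lambda>x. f x $ i * \<phi> x)" if "sq_int lborel f" for f :: "R3 \<Rightarrow> R3"
      by (intro sq_int_mult_integrable sq_int_component that test_fun_sq_int \<phi>)
    show "(\<integral>x. (g x $ i - k x $ i) * \<phi> x \<partial>lborel) = 0"
      using g(2) k(2) \<phi> int[OF g(1)] int[OF k(1)] unfolding weak_grad_def
      by (simp add: left_diff_distrib)
  qed
  then have "AE x in lborel. \<forall>i\<in>UNIV. g x $ i - k x $ i = 0"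
    by (subst AE_finite_all) auto
  then have "AE x in lborel. g x = k x"
    by eventually_elim (simp add: vec_eq_iff)
  then show ?thesis
    unfolding nsq_def using g(1) k(1) by (intro integral_cong_AE) auto
qed

text \<open>\<open>grad\<close> picks an unspecified weak gradient by \<open>SOME\<close>; by
  uniqueness almost everywhere, the norm can be computed from any square-integrable weak
  gradient.\<close>

lemma norm_sq_mu_eq:
  assumes "sq_int lborel g" "weak_grad u g"
  shows "norm_sq_mu \<mu> u = nsq lborel g + \<mu> * nsq lborel u"
proof -
  have "\<exists>g. L2grad g \<and> weak_grad u g" using assms by (auto simp: L2grad_iff)
  then have "L2grad (grad u) \<and> weak_grad u (grad u)" unfolding grad_def by (rule someI_ex)
  then have "nsq lborel (grad u) = nsq lborel g"
    using assms by (intro weak_grad_unique) (auto simp: L2grad_iff)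
  then show ?thesis by (simp add: norm_sq_mu_def nsq_def)
qed

lemma weak_grad_lincomb:
  assumes u: "sq_int lborel u" "sq_int lborel g" "weak_grad u g"
    and v: "sq_int lborel v" "sq_int lborel k" "weak_grad v k"
  shows "weak_grad (\<lambda>x. a * u x + b * v x) (\<lambda>x. a *\<^sub>R g x + b *\<^sub>R k x)"
  unfolding weak_grad_def
proof (intro allI impI)
  fix \<phi> i assume \<phi>: "test_fun \<phi>"
  note p = test_fun_sq_int[OF test_fun_partial[OF \<phi>, of i]] and q = test_fun_sq_int[OF \<phi>]
  have "(\<integral>x. (a * u x + b * v x) * partial i \<phi> x \<partial>lborel)
      = a * (\<integral>x. u x * partial i \<phi> x \<partial>lborel) + b * (\<integral>x. v x * partial i \<phi> x \<partial>lborel)"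
    using sq_int_mult_integrable[OF u(1) p] sq_int_mult_integrable[OF v(1) p]
    by (simp add: distrib_right mult.assoc)
  also have "\<dots> = a * - (\<integral>x. g x $ i * \<phi> x \<partial>lborel) + b * - (\<integral>x. k x $ i * \<phi> x \<partial>lborel)"
    using u(3) v(3) \<phi> unfolding weak_grad_def by simp
  also have "\<dots> = - (\<integral>x. (a *\<^sub>R g x + b *\<^sub>R k x) $ i * \<phi> x \<partial>lborel)"
    using sq_int_mult_integrable[OF sq_int_component[OF u(2), of i] q]
      sq_int_mult_integrable[OF sq_int_component[OF v(2), of i] q]
    by (simp add: distrib_right mult.assoc)
  finally show "(\<integral>x. (a * u x + b * v x) * partial i \<phi> x \<partial>lborel)
      = - (\<integral>x. (a *\<^sub>R g x + b *\<^sub>R k x) $ i * \<phi> x \<partial>lborel)" .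
qed

lemma weak_grad_limit:
  assumes u: "\<And>n. sq_int lborel (u n)" "sq_int lborel U" "(\<lambda>n. nsq lborel (\<lambda>x. u n x - U x)) \<longlonglongrightarrow> 0"
    and g: "\<And>n. sq_int lborel (g n)" "sq_int lborel G" "(\<lambda>n. nsq lborel (\<lambda>x. g n x - G x)) \<longlonglongrightarrow> 0"
    and w: "\<And>n. weak_grad (u n) (g n)"
  shows "weak_grad U G"
  unfolding weak_grad_def
proof (intro allI impI)
  fix \<phi> and i :: 3 assume \<phi>: "test_fun \<phi>"
  have s: "sq_int lborel (\<lambda>x. \<phi> x *\<^sub>R (axis i 1 :: R3))"
    using test_fun_sq_int[OF \<phi>] by (auto simp: sq_int_def)
  have "(\<lambda>n. \<integral>x. u n x * partial i \<phi> x \<partial>lborel) \<longlonglongrightarrow> (\<integral>x. U x * partial i \<phi> x \<partial>lborel)"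
    using inner_integral_tendsto[OF u test_fun_sq_int[OF test_fun_partial[OF \<phi>, of i]]] by simp
  moreover have "(\<lambda>n. - (\<integral>x. g n x $ i * \<phi> x \<partial>lborel)) \<longlonglongrightarrow> - (\<integral>x. G x $ i * \<phi> x \<partial>lborel)"
    using tendsto_minus[OF inner_integral_tendsto[OF g s]] by (simp add: inner_axis mult.commute)
  moreover have "(\<integral>x. u n x * partial i \<phi> x \<partial>lborel) = - (\<integral>x. g n x $ i * \<phi> x \<partial>lborel)" for n
    using w[of n] \<phi> unfolding weak_grad_def by simp
  ultimately show "(\<integral>x. U x * partial i \<phi> x \<partial>lborel) = - (\<integral>x. G x $ i * \<phi> x \<partial>lborel)"
    by (simp add: LIMSEQ_unique)
qed

lemma osc_contraction:
  assumes u: "sq_int lborel u" and v: "sq_int lborel v" and le: "\<And>x y. \<bar>v x - v y\<bar> \<le> \<bar>u x - u y\<bar>"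
  shows "osc d v \<le> osc d u"
  unfolding osc_def
proof (rule sq_int_bound(2)[OF osc_fun_sq_int(1)[OF u]])
  show "osc_fun d v \<in> borel_measurable (lborel \<Otimes>\<^sub>M lborel)" using osc_fun_sq_int(1)[OF v] by auto
  show "norm (osc_fun d v p) \<le> norm (osc_fun d u p)" for p
    using le by (auto simp: osc_fun_def split_beta' indicator_def)
qed

lemma sq_int_abs:
  fixes u :: "'a \<Rightarrow> real"
  assumes "sq_int M u"
  shows "sq_int M (\<lambda>x. \<bar>u x\<bar>)" "sq_int M (\<lambda>x. - \<bar>u x\<bar>)"
  using assms by (auto simp: sq_int_def)

text \<open>The reverse triangle inequality bounds the oscillation of -|u| by that of u, which takes
  the place of a chain rule.\<close>

lemma weak_grad_minus_abs:
  assumes "sq_int lborel u" "sq_int lborel g" "weak_grad u g"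
  obtains k where "sq_int lborel k" "weak_grad (\<lambda>x. - \<bar>u x\<bar>) k" "nsq lborel k \<le> nsq lborel g"
proof -
  have "osc d (\<lambda>x. - \<bar>u x\<bar>) \<le> moment d * nsq lborel g" for d
    using osc_contraction[OF assms(1) sq_int_abs(2)[OF assms(1)], of d] osc_le_moment[OF assms, of d]
    by (simp add: abs_triangle_ineq3 order_trans abs_minus_commute)
  then show thesis using weak_grad_of_osc_bound[OF sq_int_abs(2)[OF assms(1)]] that by blast
qed

lemma Mmu_iff: "u \<in> Mmu \<mu> \<longleftrightarrow> H1 u \<and> energy u = 1"
  using energy_eq[of u] by (auto simp: Mmu_def H1_iff)

lemma Mrad_iff: "u \<in> Mrad \<mu> \<longleftrightarrow> H1 u \<and> energy u = 1 \<and> radial u"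
  by (simp add: Mrad_def Mmu_iff)

text \<open>Composition with an orthogonal map is an isometry of L2, so the distance between v and
  its rotation is controlled by the distance of v to the sequence.\<close>

lemma radial_limit:
  assumes w: "\<And>n. sq_int lborel (w n)" "\<And>n. radial (w n)" and v: "sq_int lborel v"
    and lim: "(\<lambda>n. nsq lborel (\<lambda>x. w n x - v x)) \<longlonglongrightarrow> 0"
  shows "radial v"
  unfolding radial_def
proof (intro allI impI)
  fix R :: "R3 \<Rightarrow> R3" assume R: "orthogonal_transformation R"
  have mp: "measure_preserving lborel R" by (rule measure_preserving_orthogonal[OF R])
  have vR: "sq_int lborel (\<lambda>x. v (R x))" by (rule measure_preserving_sq_int(1)[OF mp v])
  have wR: "sq_int lborel (\<lambda>x. w n (R x))" for n by (rule measure_preserving_sq_int(1)[OF mp w(1)])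
  have b: "nsq lborel (\<lambda>x. v (R x) - v x) \<le> 4 * nsq lborel (\<lambda>x. w n x - v x)" for n
  proof -
    have "nsq lborel (\<lambda>x. v (R x) - w n x) = nsq lborel (\<lambda>x. v (R x) - w n (R x))"
      unfolding nsq_def
    proof (rule integral_cong_AE)
      have "AE x in lborel. w n (R x) = w n x" using w(2)[of n] R by (simp add: radial_def)
      then show "AE x in lborel. (norm (v (R x) - w n x))\<^sup>2 = (norm (v (R x) - w n (R x)))\<^sup>2"
        by eventually_elim simp
    qed (use sq_int_diff[OF vR w(1)[of n]] sq_int_diff[OF vR wR[of n]] in auto)
    also have "\<dots> = nsq lborel (\<lambda>x. w n (R x) - v (R x))" by (rule nsq_diff_commute)
    also have "\<dots> = nsq lborel (\<lambda>x. w n x - v x)"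
      by (rule measure_preserving_sq_int(2)[OF mp sq_int_diff[OF w(1) v]])
    finally show ?thesis using nsq_triangle[OF vR w(1)[of n] v] by simp
  qed
  have "nsq lborel (\<lambda>x. v (R x) - v x) \<le> 0"
  proof (rule LIMSEQ_le_const)
    show "(\<lambda>n. 4 * nsq lborel (\<lambda>x. w n x - v x)) \<longlonglongrightarrow> 0" using tendsto_mult[OF tendsto_const lim, of 4] by simp
  qed (use b in auto)
  then have "nsq lborel (\<lambda>x. v (R x) - v x) = 0" using nsq_nonneg[of lborel "\<lambda>x. v (R x) - v x"] by linarith
  then have "AE x in lborel. v (R x) - v x = 0" by (rule nsq_eq_0_AE[OF sq_int_diff[OF vR v]])
  then show "AE x in lborel. v (R x) = v x" by eventually_elim simp
qed

lemma radial_lincomb: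
  assumes "radial u" "radial v"
  shows "radial (\<lambda>x. a * u x + b * v x)"
  unfolding radial_def
proof (intro allI impI)
  fix R :: "R3 \<Rightarrow> R3" assume "orthogonal_transformation R"
  then have "AE x in lborel. u (R x) = u x" "AE x in lborel. v (R x) = v x"
    using assms by (auto simp: radial_def)
  then show "AE x in lborel. a * u (R x) + b * v (R x) = a * u x + b * v x"
    by eventually_elim simp
qed

lemma radial_minus_abs:
  assumes "radial u"
  shows "radial (\<lambda>x. - \<bar>u x\<bar>)"
  unfolding radial_def
proof (intro allI impI)
  fix R :: "R3 \<Rightarrow> R3" assume "orthogonal_transformation R"
  then have "AE x in lborel. u (R x) = u x" using assms by (auto simp: radial_def)
  then show "AE x in lborel. - \<bar>u (R x)\<bar> = - \<bar>u x\<bar>" by eventually_elim simp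
qed

text \<open>The energy has degree 4, so the factor energy^(-1/4) normalizes it, and the squared norm
  is multiplied by 1 / sqrt (energy).\<close>

lemma scaled_in_Mrad:
  assumes u: "sq_int lborel u" "sq_int lborel g" "weak_grad u g" "radial u" and E: "0 < energy u"
  obtains v where "v \<in> Mrad \<mu>" "norm_sq_mu \<mu> v * sqrt (energy u) = nsq lborel g + \<mu> * nsq lborel u"
proof -
  define c where "c = 1 / sqrt (sqrt (energy u))"
  have c2: "c\<^sup>2 = 1 / sqrt (energy u)" using E by (simp add: c_def power_divide)
  have c4: "c ^ 4 * energy u = 1"
  proof -
    have "c ^ 4 = (c\<^sup>2)\<^sup>2" by (simp flip: power_mult)
    then show ?thesis using E by (simp add: c2 power_divide)
  qed
  define v where "v = (\<lambda>x. c * u x)"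
  have w: "weak_grad v (\<lambda>x. c *\<^sub>R g x)" using weak_grad_lincomb[OF u(1-3) u(1-3), of c 0] by (simp add: v_def)
  have s: "sq_int lborel v" "sq_int lborel (\<lambda>x. c *\<^sub>R g x)"
    unfolding v_def by (intro sq_int_cmult sq_int_scaleR u)+
  have r: "radial v" using radial_lincomb[OF u(4) u(4), of c 0] by (simp add: v_def)
  have "energy v = 1" using c4 by (simp add: v_def energy_scale)
  then have "v \<in> Mrad \<mu>" using w s r by (auto simp: Mrad_iff H1_iff)
  moreover have "norm_sq_mu \<mu> v * sqrt (energy u) = nsq lborel g + \<mu> * nsq lborel u"
  proof -
    have "nsq lborel v = c\<^sup>2 * nsq lborel u" unfolding v_def by (rule nsq_cmult)
    then have "norm_sq_mu \<mu> v = c\<^sup>2 * (nsq lborel g + \<mu> * nsq lborel u)"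
      by (simp add: norm_sq_mu_eq[OF s(2) w] nsq_scaleR distrib_left)
    then show ?thesis using E by (simp add: c2)
  qed
  ultimately show thesis by (rule that)
qed

text \<open>Homogeneous form of the minimal norm, applicable to functions off the constraint set
  such as midpoints and symmetrized functions.\<close>

lemma norm_sq_lower_bound:
  assumes lb: "\<And>v. v \<in> Mrad \<mu> \<Longrightarrow> d \<le> norm_sq_mu \<mu> v"
    and u: "sq_int lborel u" "sq_int lborel g" "weak_grad u g" "radial u" "0 < energy u"
  shows "d * sqrt (energy u) \<le> nsq lborel g + \<mu> * nsq lborel u"
proof -
  obtain v where v: "v \<in> Mrad \<mu>" "norm_sq_mu \<mu> v * sqrt (energy u) = nsq lborel g + \<mu> * nsq lborel u"
    using scaled_in_Mrad[OF u] by blast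
  have "d * sqrt (energy u) \<le> norm_sq_mu \<mu> v * sqrt (energy u)"
    using lb[OF v(1)] u(5) by (intro mult_right_mono) auto
  then show ?thesis using v(2) by simp
qed

text \<open>On a large ball the midpoint is L2 close to \<open>w n\<close>, whose truncation already
  has energy close to 1 by the radial tail estimate; passing from the truncated to the full midpoint
  can only raise the energy. This works even while L2 mass may escape.\<close>

lemma midpoint_energy:
  assumes w: "\<And>n. sq_int lborel (w n)" "\<And>n. nsq lborel (w n) \<le> C" "\<And>n. radial (w n)" "\<And>n. energy (w n) = 1"
    and loc: "\<And>R. L2_Cauchy lborel (\<lambda>n x. indicator (ball 0 R) x * w n x)" and \<eta>: "0 < \<eta>"
  shows "\<exists>N. \<forall>n\<ge>N. \<forall>m\<ge>N. 1 - \<eta> \<le> energy (\<lambda>x. (1/2) * w n x + (1/2) * w m x)"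
proof -
  have C0: "0 \<le> C" using w(2)[of 0] nsq_nonneg[of lborel "w 0"] by linarith
  \<comment> \<open>Chosen so that the tail error 2 e1 C^2 is at most \<eta> / 2; the summand 1
    guards against C = 0.\<close>
  define e1 where "e1 = \<eta> / (4 * (C\<^sup>2 + 1))"
  have C1: "0 < C\<^sup>2 + 1" using zero_le_power2[of C] by linarith
  have e1: "0 < e1" using \<eta> C1 by (simp add: e1_def)
  have e1C: "2 * e1 * C\<^sup>2 \<le> \<eta> / 2"
  proof -
    have "2 * e1 * C\<^sup>2 \<le> 2 * e1 * (C\<^sup>2 + 1)" using e1 by simp
    also have "\<dots> = \<eta> / 2" using C1 by (simp add: e1_def field_simps)
    finally show ?thesis .
  qed
  obtain \<rho> where \<rho>: "0 < \<rho>"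
    "\<And>u y. sq_int lborel u \<Longrightarrow> radial u \<Longrightarrow> \<rho> \<le> norm y \<Longrightarrow> pot u y \<le> e1 * nsq lborel u"
    using radial_pot_tail[OF e1] by blast
  define I where "I x = (indicator (ball (0::R3) \<rho>) x :: real)" for x
  have Ib: "\<bar>I x\<bar> \<le> 1" for x by (auto simp: I_def indicator_def)
  have Im: "I \<in> borel_measurable lborel" unfolding I_def[abs_def] by simp
  have It: "sq_int lborel (\<lambda>x. I x * f x)" "nsq lborel (\<lambda>x. I x * f x) \<le> nsq lborel f" if "sq_int lborel f" for f
    using bounded_mult_sq_int[OF that Im Ib] by auto
  define L where "L = 4 * (C * sqrt C)"
  have L0: "0 \<le> L" using C0 by (simp add: L_def)
  \<comment> \<open>The midpoint is half as far from \<open>w n\<close> as \<open>w m\<close> is, so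
    the modulus \<open>L\<close> turns this squared distance into an energy error of at most \<eta>
    / 2.\<close>
  define e2 where "e2 = (\<eta> / (L + 1))\<^sup>2"
  have e2: "0 < e2" using \<eta> L0 by (simp add: e2_def)
  obtain N where N: "\<And>n m. n \<ge> N \<Longrightarrow> m \<ge> N \<Longrightarrow> nsq lborel (\<lambda>x. I x * w n x - I x * w m x) < e2"
    using loc[of \<rho>, unfolded L2_Cauchy_def, rule_format, OF e2] unfolding I_def by blast
  have "1 - \<eta> \<le> energy (\<lambda>x. (1/2) * w n x + (1/2) * w m x)" if nm: "n \<ge> N" "m \<ge> N" for n m
  proof -
    let ?mid = "\<lambda>x. (1/2) * w n x + (1/2) * w m x"
    have mid: "sq_int lborel ?mid" by (intro sq_int_add sq_int_cmult w)
    have midC: "nsq lborel ?mid \<le> C"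
    proof -
      have "nsq lborel ?mid \<le> 2 * nsq lborel (\<lambda>x. (1/2) * w n x) + 2 * nsq lborel (\<lambda>x. (1/2) * w m x)"
        by (intro nsq_add_le sq_int_cmult w)
      also have "\<dots> = (nsq lborel (w n) + nsq lborel (w m)) / 2"
        unfolding nsq_cmult by (simp add: power2_eq_square)
      also have "\<dots> \<le> C" using w(2)[of n] w(2)[of m] by simp
      finally show ?thesis .
    qed
    have "energy (w n) - energy (\<lambda>x. I x * w n x) \<le> 2 * e1 * (nsq lborel (w n))\<^sup>2"
      unfolding I_def by (rule radial_energy_tail[OF w(1) \<rho>(2)[OF w(1,3)]])
    also have "\<dots> \<le> 2 * e1 * C\<^sup>2"
      using e1 w(2)[of n] by (intro mult_left_mono power_mono) auto
    finally have 1: "1 - \<eta> / 2 \<le> energy (\<lambda>x. I x * w n x)" using e1C w(4)[of n] by simp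
    have "\<bar>energy (\<lambda>x. I x * ?mid x) - energy (\<lambda>x. I x * w n x)\<bar>
        \<le> L * sqrt (nsq lborel (\<lambda>x. I x * ?mid x - I x * w n x))"
      unfolding L_def
      by (intro energy_diff It(1) mid w order_trans[OF It(2)[OF mid] midC] order_trans[OF It(2)[OF w(1)] w(2)])
    also have "nsq lborel (\<lambda>x. I x * ?mid x - I x * w n x) = (1/4) * nsq lborel (\<lambda>x. I x * w m x - I x * w n x)"
    proof -
      have "(\<lambda>x. I x * ?mid x - I x * w n x) = (\<lambda>x. (1/2) * (I x * w m x - I x * w n x))"
        by (auto simp: algebra_simps)
      then show ?thesis by (simp only: nsq_cmult) (simp add: power2_eq_square)
    qed
    also have "L * sqrt ((1/4) * nsq lborel (\<lambda>x. I x * w m x - I x * w n x)) \<le> L * sqrt ((1/4) * e2)"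
      using N[OF nm(2,1)] L0 by (intro mult_left_mono) auto
    also have "\<dots> = L * (\<eta> / (L + 1)) / 2"
      using \<eta> L0 by (simp add: e2_def real_sqrt_mult real_sqrt_divide)
    also have "\<dots> \<le> \<eta> / 2"
      using \<eta> L0 by (simp add: field_simps)
    finally have 2: "energy (\<lambda>x. I x * w n x) - \<eta> / 2 \<le> energy (\<lambda>x. I x * ?mid x)" by linarith
    have "energy (\<lambda>x. I x * ?mid x) \<le> energy ?mid"
    proof (rule energy_mono[OF mid It(1)[OF mid]])
      show "\<bar>I x * ?mid x\<bar> \<le> \<bar>?mid x\<bar>" for x by (auto simp: I_def indicator_def)
    qed
    then show ?thesis using 1 2 by linarith
  qed
  then show ?thesis by blast
qed

text \<open>Packing sqrt \<mu> times the function and its gradient into one vector-valued function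
  makes the squared norm a single \<open>nsq\<close>, to which the midpoint criterion applies. The
  bound for midpoints combines \<open>midpoint_energy\<close> with
  \<open>norm_sq_lower_bound\<close>.\<close>

lemma minimizing_sequence_converges:
  assumes \<mu>: "0 < \<mu>" and lb: "\<And>v. v \<in> Mrad \<mu> \<Longrightarrow> d \<le> norm_sq_mu \<mu> v"
    and u: "\<And>n. u n \<in> Mrad \<mu>" and lim: "(\<lambda>n. norm_sq_mu \<mu> (u n)) \<longlonglongrightarrow> d"
  obtains r v where "strict_mono (r :: nat \<Rightarrow> nat)" "v \<in> Mrad \<mu>" "norm_sq_mu \<mu> v = d"
    "(\<lambda>n. norm_mu \<mu> (\<lambda>x. u (r n) x - v x)) \<longlonglongrightarrow> 0"
proof -
  have "\<exists>g. sq_int lborel g \<and> weak_grad (u n) g" for n using u[of n] by (auto simp: Mrad_iff H1_iff)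
  then obtain g where g: "\<And>n. sq_int lborel (g n)" "\<And>n. weak_grad (u n) (g n)" by metis
  have us: "sq_int lborel (u n)" "energy (u n) = 1" "radial (u n)" for n
    using u[of n] by (auto simp: Mrad_iff H1_iff)
  have Q: "norm_sq_mu \<mu> (u n) = nsq lborel (g n) + \<mu> * nsq lborel (u n)" for n
    by (rule norm_sq_mu_eq[OF g])
  have "Bseq (\<lambda>n. norm_sq_mu \<mu> (u n))" by (rule convergent_imp_Bseq[OF convergentI[OF lim]])
  then obtain A where A: "\<And>n. \<bar>norm_sq_mu \<mu> (u n)\<bar> \<le> A" unfolding Bseq_def by auto
  have gA: "nsq lborel (g n) \<le> A" and uA: "nsq lborel (u n) \<le> A / \<mu>" for n
  proof -
    have "0 \<le> \<mu> * nsq lborel (u n)" using \<mu> by simp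
    then show "nsq lborel (g n) \<le> A" using abs_le_D1[OF A[of n]] Q[of n] by linarith
    have "\<mu> * nsq lborel (u n) \<le> A"
      using abs_le_D1[OF A[of n]] Q[of n] nsq_nonneg[of lborel "g n"] by linarith
    then show "nsq lborel (u n) \<le> A / \<mu>" using \<mu> by (simp add: field_simps)
  qed
  have "\<exists>r :: nat \<Rightarrow> nat. strict_mono r \<and> (\<forall>R. L2_Cauchy lborel (\<lambda>n x. indicator (ball 0 R) x * u (r n) x))"
  proof (rule local_compactness[of u "A / \<mu>" A])
    show "osc e (u n) \<le> moment e * A" if "0 < e" for n e
      using osc_le_moment[OF us(1) g, of e n] mult_left_mono[OF gA[of n] moment_nonneg[of e]] by linarith
  qed (use us uA in auto)
  then obtain r :: "nat \<Rightarrow> nat" where r: "strict_mono r"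
    and loc: "\<And>R. L2_Cauchy lborel (\<lambda>n x. indicator (ball 0 R) x * u (r n) x)" by blast
  define w where "w n = u (r n)" for n
  define k where "k n = g (r n)" for n
  have w: "sq_int lborel (w n)" "energy (w n) = 1" "radial (w n)" "nsq lborel (w n) \<le> A / \<mu>"
    "sq_int lborel (k n)" "weak_grad (w n) (k n)" for n
    using us g uA by (auto simp: w_def k_def)
  define U where "U n x = (sqrt \<mu> * w n x, k n x)" for n x
  have Un: "sq_int lborel (\<lambda>x. (sqrt \<mu> * f x, h x))"
    "nsq lborel (\<lambda>x. (sqrt \<mu> * f x, h x)) = \<mu> * nsq lborel f + nsq lborel h"
    if f: "sq_int lborel f" "sq_int lborel h" for f :: "R3 \<Rightarrow> real" and h :: "R3 \<Rightarrow> R3"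
  proof -
    have [measurable]: "f \<in> borel_measurable borel" "h \<in> borel_measurable borel" using f by (auto simp: sq_int_def)
    have eq: "(norm (sqrt \<mu> * f x, h x))\<^sup>2 = \<mu> * (norm (f x))\<^sup>2 + (norm (h x))\<^sup>2" for x
      using \<mu> by (simp add: norm_Pair power_mult_distrib)
    have m: "(\<lambda>x. (sqrt \<mu> * f x, h x)) \<in> borel_measurable borel" by measurable
    show "sq_int lborel (\<lambda>x. (sqrt \<mu> * f x, h x))"
      unfolding sq_int_def eq using m sq_int_integrable[OF f(1)] sq_int_integrable[OF f(2)] by simp
    show "nsq lborel (\<lambda>x. (sqrt \<mu> * f x, h x)) = \<mu> * nsq lborel f + nsq lborel h"
      unfolding nsq_def eq using sq_int_integrable[OF f(1)] sq_int_integrable[OF f(2)] by simp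
  qed
  have limw: "(\<lambda>n. norm_sq_mu \<mu> (w n)) \<longlonglongrightarrow> d"
    using LIMSEQ_subseq_LIMSEQ[OF lim r] by (simp add: w_def comp_def)
  have Qw: "norm_sq_mu \<mu> (w n) = \<mu> * nsq lborel (w n) + nsq lborel (k n)" for n
    using norm_sq_mu_eq[OF w(5)[of n] w(6)[of n], of \<mu>] by simp
  have d0: "0 \<le> d"
    using limw by (rule LIMSEQ_le_const) (use \<mu> in \<open>auto simp: Qw\<close>)
  have "L2_Cauchy lborel U"
  proof (rule L2_Cauchy_midpoints)
    show "sq_int lborel (U n)" for n unfolding U_def by (rule Un(1)[OF w(1,5)])
    show "(\<lambda>n. nsq lborel (U n)) \<longlonglongrightarrow> d"
      using limw unfolding Qw U_def Un(2)[OF w(1,5)] .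
    fix e :: real assume e: "0 < e"
    \<comment> \<open>\<eta> <= 1/2 keeps the midpoint energy positive, and d * \<eta> <= e is the
      admissible loss; the denominator d + 1 covers d = 0.\<close>
    define \<eta> where "\<eta> = min (1/2) (e / (d + 1))"
    have "0 < \<eta>" using e d0 by (simp add: \<eta>_def)
    moreover have "\<eta> \<le> 1/2" unfolding \<eta>_def by (rule min.cobounded1)
    ultimately have \<eta>: "0 < \<eta>" "\<eta> \<le> 1/2" by blast+
    have d\<eta>: "d * \<eta> \<le> e"
    proof -
      have "d * \<eta> \<le> (d + 1) * (e / (d + 1))"
        using d0 \<eta> e by (intro mult_mono) (auto simp: \<eta>_def)
      then show ?thesis using d0 by simp
    qed
    obtain N where N: "\<And>n m. n \<ge> N \<Longrightarrow> m \<ge> N \<Longrightarrow> 1 - \<eta> \<le> energy (\<lambda>x. (1/2) * w n x + (1/2) * w m x)"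
      using midpoint_energy[OF w(1) w(4) w(3) w(2) loc[folded w_def] \<eta>(1)] by blast
    show "\<exists>N. \<forall>n\<ge>N. \<forall>m\<ge>N. d - e \<le> nsq lborel (\<lambda>x. (1/2) *\<^sub>R (U n x + U m x))"
    proof (intro exI[of _ N] allI impI)
      fix n m assume nm: "N \<le> n" "N \<le> m"
      let ?w = "\<lambda>x. (1/2) * w n x + (1/2) * w m x" and ?k = "\<lambda>x. (1/2) *\<^sub>R k n x + (1/2) *\<^sub>R k m x"
      have s: "sq_int lborel ?w" "sq_int lborel ?k"
        by (intro sq_int_add sq_int_cmult sq_int_scaleR w)+
      have E: "1 - \<eta> \<le> energy ?w" by (rule N[OF nm])
      have E0: "0 < energy ?w" using E \<eta> by linarith
      \<comment> \<open>Numbers in [0, 1] lie below their square roots, so the root in the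
        homogeneous bound costs at most a factor 1 - \<eta>.\<close>
      have "1 - \<eta> \<le> sqrt (1 - \<eta>)" using \<eta> by (intro real_le_rsqrt) (simp add: power2_eq_square mult_left_le)
      also have "\<dots> \<le> sqrt (energy ?w)" using E by simp
      finally have "d * (1 - \<eta>) \<le> d * sqrt (energy ?w)" using d0 by (rule mult_left_mono)
      also have "\<dots> \<le> nsq lborel ?k + \<mu> * nsq lborel ?w"
        by (rule norm_sq_lower_bound[OF lb s weak_grad_lincomb[OF w(1) w(5) w(6) w(1) w(5) w(6)] radial_lincomb[OF w(3) w(3)] E0])
      also have "\<dots> = nsq lborel (\<lambda>x. (sqrt \<mu> * ?w x, ?k x))" by (subst Un(2)[OF s]) (rule add.commute)
      also have "(\<lambda>x. (sqrt \<mu> * ?w x, ?k x)) = (\<lambda>x. (1/2) *\<^sub>R (U n x + U m x))"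
        by (auto simp: U_def algebra_simps)
      finally show "d - e \<le> nsq lborel (\<lambda>x. (1/2) *\<^sub>R (U n x + U m x))"
        using d\<eta> by (simp add: right_diff_distrib)
    qed
  qed
  moreover have Ud: "nsq lborel (\<lambda>x. U n x - U m x) = \<mu> * nsq lborel (\<lambda>x. w n x - w m x) + nsq lborel (\<lambda>x. k n x - k m x)" for n m
  proof -
    have "(\<lambda>x. U n x - U m x) = (\<lambda>x. (sqrt \<mu> * (w n x - w m x), k n x - k m x))"
      by (auto simp: U_def algebra_simps)
    then show ?thesis by (simp only: Un(2)[OF sq_int_diff[OF w(1) w(1)] sq_int_diff[OF w(5) w(5)]])
  qed
  ultimately have cauU: "\<exists>N. \<forall>n\<ge>N. \<forall>m\<ge>N. \<mu> * nsq lborel (\<lambda>x. w n x - w m x) + nsq lborel (\<lambda>x. k n x - k m x) < e"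
    if "0 < e" for e using that by (simp add: L2_Cauchy_def)
  have cw: "L2_Cauchy lborel w"
    unfolding L2_Cauchy_def
  proof (intro allI impI)
    fix e :: real assume e: "0 < e"
    obtain N where N: "\<forall>n\<ge>N. \<forall>m\<ge>N. \<mu> * nsq lborel (\<lambda>x. w n x - w m x) + nsq lborel (\<lambda>x. k n x - k m x) < \<mu> * e"
      using cauU[of "\<mu> * e"] e \<mu> by auto
    have "nsq lborel (\<lambda>x. w n x - w m x) < e" if "n \<ge> N" "m \<ge> N" for n m
    proof -
      have "\<mu> * nsq lborel (\<lambda>x. w n x - w m x) < \<mu> * e"
        using N that nsq_nonneg[of lborel "\<lambda>x. k n x - k m x"] by (meson le_less_trans less_add_same_cancel1 add_increasing2 order_refl)
      then show ?thesis using \<mu> by simp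
    qed
    then show "\<exists>N. \<forall>n\<ge>N. \<forall>m\<ge>N. nsq lborel (\<lambda>x. w n x - w m x) < e" by blast
  qed
  have ck: "L2_Cauchy lborel k"
    unfolding L2_Cauchy_def
  proof (intro allI impI)
    fix e :: real assume e: "0 < e"
    obtain N where N: "\<forall>n\<ge>N. \<forall>m\<ge>N. \<mu> * nsq lborel (\<lambda>x. w n x - w m x) + nsq lborel (\<lambda>x. k n x - k m x) < e"
      using cauU[OF e] by auto
    have "nsq lborel (\<lambda>x. k n x - k m x) < e" if "n \<ge> N" "m \<ge> N" for n m
    proof -
      have "0 \<le> \<mu> * nsq lborel (\<lambda>x. w n x - w m x)" using \<mu> by simp
      moreover have "\<mu> * nsq lborel (\<lambda>x. w n x - w m x) + nsq lborel (\<lambda>x. k n x - k m x) < e" using N that by blast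
      ultimately show ?thesis by linarith
    qed
    then show "\<exists>N. \<forall>n\<ge>N. \<forall>m\<ge>N. nsq lborel (\<lambda>x. k n x - k m x) < e" by blast
  qed
  obtain v where v: "sq_int lborel v" "(\<lambda>n. nsq lborel (\<lambda>x. w n x - v x)) \<longlonglongrightarrow> 0"
    using cw by (rule L2_complete[where f=w, OF w(1)])
  obtain G where G: "sq_int lborel G" "(\<lambda>n. nsq lborel (\<lambda>x. k n x - G x)) \<longlonglongrightarrow> 0"
    using ck by (rule L2_complete[where f=k, OF w(5)])
  have wv: "weak_grad v G" by (rule weak_grad_limit[OF w(1) v w(5) G w(6)])
  have "energy v = 1"
    using energy_tendsto[OF w(1) v] by (simp add: w(2) LIMSEQ_const_iff)
  moreover have "radial v" by (rule radial_limit[OF w(1,3) v])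
  ultimately have vM: "v \<in> Mrad \<mu>" using v(1) G(1) wv by (auto simp: Mrad_iff H1_iff)
  have "(\<lambda>n. \<mu> * nsq lborel (w n) + nsq lborel (k n)) \<longlonglongrightarrow> \<mu> * nsq lborel v + nsq lborel G"
    by (intro tendsto_intros nsq_tendsto[OF w(1) v] nsq_tendsto[OF w(5) G])
  then have "norm_sq_mu \<mu> v = d"
    using LIMSEQ_unique[OF limw] by (simp add: Qw norm_sq_mu_eq[OF G(1) wv])
  moreover have "(\<lambda>n. norm_mu \<mu> (\<lambda>x. u (r n) x - v x)) \<longlonglongrightarrow> 0"
  proof -
    have "norm_sq_mu \<mu> (\<lambda>x. w n x - v x) = nsq lborel (\<lambda>x. k n x - G x) + \<mu> * nsq lborel (\<lambda>x. w n x - v x)" for n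
      using weak_grad_lincomb[OF w(1)[of n] w(5)[of n] w(6)[of n] v(1) G(1) wv, of 1 "-1"]
      by (intro norm_sq_mu_eq sq_int_diff w G) simp
    moreover have "(\<lambda>n. sqrt (nsq lborel (\<lambda>x. k n x - G x) + \<mu> * nsq lborel (\<lambda>x. w n x - v x))) \<longlonglongrightarrow> sqrt (0 + \<mu> * 0)"
      by (intro tendsto_intros v G)
    ultimately show ?thesis by (simp add: norm_mu_def w_def)
  qed
  ultimately show thesis using that[OF r vM] by blast
qed

text \<open>A radial Lipschitz function of compact support, serving as a competitor: without one the
  infimum would be taken over a set not known to be nonempty.\<close>

definition tent :: "R3 \<Rightarrow> real" where
  "tent x = max 0 (1 - norm x)"

lemma tent_measurable [measurable]: "tent \<in> borel_measurable borel"
  unfolding tent_def[abs_def] by measurable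

lemma tent_sq_int: "sq_int lborel tent"
proof (rule sq_int_bound(1))
  show "sq_int lborel (\<lambda>x. indicator (ball (0::R3) 1) x :: real)"
    by (intro sq_int_indicator emeasure_lborel_ball_finite) simp
qed (auto simp: tent_def indicator_def)

lemma tent_nsq_pos: "0 < nsq lborel tent"
proof (rule ccontr)
  assume "\<not> 0 < nsq lborel tent"
  then have "nsq lborel tent = 0" using nsq_nonneg[of lborel tent] by linarith
  then have "AE x in lborel. tent x = 0" by (rule nsq_eq_0_AE[OF tent_sq_int])
  then have "AE x in lborel. x \<notin> ball (0::R3) 1" by eventually_elim (auto simp: tent_def max_def split: if_splits)
  then have "ball (0::R3) 1 \<in> null_sets lborel" by (subst AE_iff_null_sets) auto
  then show False using content_ball_pos[of 1 "0::R3"] by (simp add: null_sets_def measure_def)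
qed

text \<open>\<open>tent\<close> is 1-Lipschitz and supported in the closed unit ball, so for |h| < 1
  the squared difference is at most |h|^2 and vanishes outside the ball of radius 2; integrating
  |h|^2 gives three moments.\<close>

lemma tent_osc:
  assumes "0 < d" "d \<le> 1"
  shows "osc d tent \<le> moment d * (3 * measure lborel (ball (0::R3) 2))"
proof -
  define m where "m = measure lborel (ball (0::R3) 2)"
  have inner: "(\<integral>\<^sup>+x. ennreal ((tent (x + h) - tent x)\<^sup>2) \<partial>lborel) \<le> ennreal ((norm h)\<^sup>2 * m)" if h: "norm h < 1" for h
  proof -
    have "(\<integral>\<^sup>+x. ennreal ((tent (x + h) - tent x)\<^sup>2) \<partial>lborel)
        \<le> (\<integral>\<^sup>+x. ennreal ((norm h)\<^sup>2) * indicator (ball (0::R3) 2) x \<partial>lborel)"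
    proof (rule nn_integral_mono)
      fix x :: R3
      have t: "norm x \<le> norm (x + h) + norm h" using norm_triangle_ineq4[of "x + h" h] by simp
      show "ennreal ((tent (x + h) - tent x)\<^sup>2) \<le> ennreal ((norm h)\<^sup>2) * indicator (ball (0::R3) 2) x"
      proof (cases "norm x < 2")
        case True
        have "\<bar>tent (x + h) - tent x\<bar> \<le> \<bar>norm (x + h) - norm x\<bar>" by (auto simp: tent_def max_def)
        also have "\<dots> \<le> norm h" using norm_triangle_ineq3[of "x + h" x] by simp
        finally have "(tent (x + h) - tent x)\<^sup>2 \<le> (norm h)\<^sup>2" by (metis abs_ge_zero power2_abs power_mono)
        then show ?thesis using True by (simp add: ennreal_leI)
      next
        case False
        then have "tent x = 0" "tent (x + h) = 0" using t h by (auto simp: tent_def)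
        then show ?thesis by simp
      qed
    qed
    also have "\<dots> = ennreal ((norm h)\<^sup>2) * emeasure lborel (ball (0::R3) 2)"
      by (rule nn_integral_cmult_indicator) simp
    also have "\<dots> = ennreal ((norm h)\<^sup>2 * m)"
      using emeasure_lborel_ball_finite[of "0::R3" 2]
      by (simp add: m_def emeasure_eq_ennreal_measure less_top ennreal_mult)
    finally show ?thesis .
  qed
  have int: "integrable lborel (\<lambda>h. indicator (ball 0 d) h * (norm (h::R3))\<^sup>2)"
    by (rule ball_bounded_integrable[where B="d\<^sup>2"]) (auto intro: power_mono)
  have "ennreal (osc d tent) \<le> (\<integral>\<^sup>+h. ennreal (m * (indicator (ball 0 d) h * (norm h)\<^sup>2)) \<partial>(lborel :: R3 measure))"
    unfolding osc_eq_nn_integral(1)[OF tent_sq_int]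
  proof (rule nn_integral_mono)
    fix h :: R3
    show "indicator (ball 0 d) h * (\<integral>\<^sup>+x. ennreal ((tent (x + h) - tent x)\<^sup>2) \<partial>lborel)
        \<le> ennreal (m * (indicator (ball 0 d) h * (norm h)\<^sup>2))"
      using inner[of h] assms(2) by (cases "norm h < d") (auto simp: indicator_def mult.commute)
  qed
  also have "\<dots> = ennreal (\<integral>h. m * (indicator (ball 0 d) h * (norm h)\<^sup>2) \<partial>(lborel :: R3 measure))"
    using int by (intro nn_integral_eq_integral) (auto simp: m_def)
  also have "(\<integral>h. m * (indicator (ball 0 d) h * (norm h)\<^sup>2) \<partial>(lborel :: R3 measure)) = moment d * (3 * m)"
    by (simp add: moment_norm)
  finally show ?thesis using moment_nonneg[of d] by (simp add: m_def)
qed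

lemma Mrad_nonempty: "Mrad \<mu> \<noteq> {}"
proof -
  obtain g where g: "sq_int lborel g" "weak_grad tent g"
    using weak_grad_of_osc_bound[OF tent_sq_int tent_osc] by blast
  have "radial tent"
    by (simp add: radial_def tent_def orthogonal_transformation_norm)
  then obtain v where "v \<in> Mrad \<mu>"
    using scaled_in_Mrad[OF tent_sq_int g _ energy_pos[OF tent_sq_int tent_nsq_pos]] by blast
  then show ?thesis by blast
qed

text \<open>For negative t the oriented integral runs over (t, 0), where f vanishes.\<close>

lemma Fprim_nonneg:
  assumes "\<And>u. u \<ge> 0 \<Longrightarrow> f u \<ge> 0" "\<And>u. u \<le> 0 \<Longrightarrow> f u = 0"
  shows "0 \<le> Fprim f t" "t \<le> 0 \<Longrightarrow> Fprim f t = 0"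
proof -
  show *: "Fprim f t = 0" if "t \<le> 0"
  proof -
    have z: "indicator (einterval (ereal t) 0) s *\<^sub>R f s = 0" for s
      using assms(2)[of s] by (auto simp: indicator_def einterval_def zero_ereal_def)
    have "(LINT s:einterval (ereal t) 0|lborel. f s) = 0" unfolding set_lebesgue_integral_def z by simp
    moreover have "(LINT s:einterval 0 (ereal t)|lborel. f s) = 0" if "0 \<le> t"
      using that \<open>t \<le> 0\<close> by (simp add: set_lebesgue_integral_def einterval_def zero_ereal_def)
    ultimately show ?thesis by (auto simp: Fprim_def interval_lebesgue_integral_def)
  qed
  show "0 \<le> Fprim f t"
  proof (cases "t \<le> 0")
    case False
    have "0 \<le> indicator (einterval 0 (ereal t)) s *\<^sub>R f s" for s
      using assms(1)[of s] by (auto simp: indicator_def einterval_def zero_ereal_def)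
    then have "0 \<le> (LINT s:einterval 0 (ereal t)|lborel. f s)"
      unfolding set_lebesgue_integral_def by (intro Bochner_Integration.integral_nonneg) simp
    then show ?thesis using False by (simp add: Fprim_def interval_lebesgue_integral_def)
  qed (simp add: *)
qed

theorem theorem4p3:
  fixes \<mu> :: real and f :: "real \<Rightarrow> real"
  assumes "\<mu> > 0"
    and "continuous_on UNIV f"
    and "\<And>u. u \<ge> 0 \<Longrightarrow> f u \<ge> 0"
    and "\<And>u. u \<le> 0 \<Longrightarrow> f u = 0"
    and "\<exists>q. 2 < q \<and> q < 6 \<and> ((\<lambda>u. f u / u powr (q - 1)) \<longlongrightarrow> 0) at_top"
    and "((\<lambda>u. f u / u) \<longlongrightarrow> 0) (at 0)"
  shows "(\<forall>u :: nat \<Rightarrow> R3 \<Rightarrow> real.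
            (\<forall>n. u n \<in> Mrad \<mu>) \<and> (\<lambda>n. Emu \<mu> f (u n)) \<longlonglongrightarrow> Inf (Emu \<mu> f ` Mrad \<mu>) \<longrightarrow>
            (\<exists>r v. strict_mono r \<and> v \<in> Mrad \<mu> \<and>
                   (\<lambda>n. norm_mu \<mu> (\<lambda>x. u (r n) x - v x)) \<longlonglongrightarrow> 0))
       \<and> (\<exists>\<uu>. \<uu> \<in> Mrad \<mu> \<and>
              Emu \<mu> f \<uu> = Inf (Emu \<mu> f ` Mrad \<mu>) \<and>
              Inf (Emu \<mu> f ` Mrad \<mu>) = Inf (Emu \<mu> f ` Mmu \<mu>) \<and>
              (\<forall>v \<in> Mmu \<mu>. Emu \<mu> f \<uu> \<le> Emu \<mu> f v) \<and>
              Emu \<mu> f \<uu> > 0 \<and>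
              (AE x in lborel. \<uu> x \<le> 0) \<and>
              Emu \<mu> f \<uu> = norm_sq_mu \<mu> \<uu> / 2)"
proof -
  let ?E = "Emu \<mu> f"
  define m where "m = Inf (?E ` Mrad \<mu>)"
  note F = Fprim_nonneg[of f, OF assms(3) assms(4)]
  \<comment> \<open>If the composition with \<open>Fprim f\<close> is not integrable its integral is
    0 by convention, so the bound holds in every case.\<close>
  have E_ge: "norm_sq_mu \<mu> u / 2 \<le> ?E u" for u
    unfolding Emu_def using F(1) by (simp add: Bochner_Integration.integral_nonneg)
  have Q0: "0 \<le> norm_sq_mu \<mu> u" for u
    unfolding norm_sq_mu_def using assms(1) by simp
  have bdd: "bdd_below (?E ` X)" for X
    using E_ge Q0 by (intro bdd_belowI2[of _ 0]) (meson divide_nonneg_pos order_trans zero_less_numeral)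
  \<comment> \<open>Passing to -|u| keeps the constraint and the symmetry, removes the
    \<open>Fprim\<close> term and does not raise the norm. Hence twice the infimum of the functional
    bounds the squared norm from below (\<open>lb\<close>).\<close>
  have neg: "(\<lambda>x. - \<bar>u x\<bar>) \<in> Mrad \<mu> \<and> ?E (\<lambda>x. - \<bar>u x\<bar>) = norm_sq_mu \<mu> (\<lambda>x. - \<bar>u x\<bar>) / 2 \<and>
      norm_sq_mu \<mu> (\<lambda>x. - \<bar>u x\<bar>) \<le> norm_sq_mu \<mu> u" if u: "u \<in> Mrad \<mu>" for u
  proof -
    obtain g where g: "sq_int lborel u" "sq_int lborel g" "weak_grad u g" using u by (auto simp: Mrad_iff H1_iff)
    obtain k where k: "sq_int lborel k" "weak_grad (\<lambda>x. - \<bar>u x\<bar>) k" "nsq lborel k \<le> nsq lborel g"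
      using weak_grad_minus_abs[OF g] by blast
    have "energy (\<lambda>x. - \<bar>u x\<bar>) = 1" using u by (simp add: energy_minus energy_abs Mrad_iff)
    then have "(\<lambda>x. - \<bar>u x\<bar>) \<in> Mrad \<mu>"
      using u k sq_int_abs(2)[OF g(1)] radial_minus_abs[of u] by (auto simp: Mrad_iff H1_iff)
    moreover have "?E (\<lambda>x. - \<bar>u x\<bar>) = norm_sq_mu \<mu> (\<lambda>x. - \<bar>u x\<bar>) / 2"
      by (simp add: Emu_def F(2))
    moreover have "norm_sq_mu \<mu> (\<lambda>x. - \<bar>u x\<bar>) \<le> norm_sq_mu \<mu> u"
      using k(3) by (simp add: norm_sq_mu_eq[OF k(1,2)] norm_sq_mu_eq[OF g(2,3)] nsq_def)
    ultimately show ?thesis by blast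
  qed
  have m_le: "m \<le> ?E u" if "u \<in> Mrad \<mu>" for u
    unfolding m_def using that bdd by (intro cInf_lower) auto
  have lb: "2 * m \<le> norm_sq_mu \<mu> u" if "u \<in> Mrad \<mu>" for u
    using m_le[of "\<lambda>x. - \<bar>u x\<bar>"] neg[OF that] by simp
  have conv: "\<exists>r v. strict_mono (r :: nat \<Rightarrow> nat) \<and> v \<in> Mrad \<mu> \<and> norm_sq_mu \<mu> v = 2 * m \<and>
      (\<lambda>n. norm_mu \<mu> (\<lambda>x. u (r n) x - v x)) \<longlonglongrightarrow> 0"
    if u: "\<And>n. u n \<in> Mrad \<mu>" and lim: "(\<lambda>n. ?E (u n)) \<longlonglongrightarrow> m" for u
  proof -
    \<comment> \<open>Squeezed between \<open>lb\<close> and \<open>E_ge\<close>: along a minimizing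
      sequence the \<open>Fprim\<close> term dies out and the norms themselves are
      minimizing.\<close>
    have "(\<lambda>n. norm_sq_mu \<mu> (u n)) \<longlonglongrightarrow> 2 * m"
    proof (rule tendsto_sandwich[OF _ _ tendsto_const])
      show "\<forall>\<^sub>F n in sequentially. 2 * m \<le> norm_sq_mu \<mu> (u n)" using lb[OF u] by simp
      have "norm_sq_mu \<mu> (u n) \<le> 2 * ?E (u n)" for n using E_ge[of "u n"] by linarith
      then show "\<forall>\<^sub>F n in sequentially. norm_sq_mu \<mu> (u n) \<le> 2 * ?E (u n)" by simp
      show "(\<lambda>n. 2 * ?E (u n)) \<longlonglongrightarrow> 2 * m" by (intro tendsto_intros lim)
    qed
    from minimizing_sequence_converges[OF assms(1) lb u this] show ?thesis by blast
  qed
  obtain w where w: "\<And>n. w n \<in> Mrad \<mu>" "\<And>n. ?E (w n) < m + inverse (real (Suc n))"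
  proof -
    have "\<exists>w\<in>Mrad \<mu>. ?E w < m + inverse (real (Suc n))" for n
      using cInf_lessD[of "?E ` Mrad \<mu>" "m + inverse (real (Suc n))"] Mrad_nonempty[of \<mu>]
      by (auto simp: m_def[symmetric] simp del: of_nat_Suc)
    then show thesis using that by metis
  qed
  have "(\<lambda>n. ?E (w n)) \<longlonglongrightarrow> m"
  proof (rule tendsto_sandwich[OF _ _ tendsto_const])
    show "\<forall>\<^sub>F n in sequentially. m \<le> ?E (w n)" using m_le w(1) by simp
    show "\<forall>\<^sub>F n in sequentially. ?E (w n) \<le> m + inverse (real (Suc n))"
      using w(2) by (intro always_eventually allI less_imp_le)
    show "(\<lambda>n. m + inverse (real (Suc n))) \<longlonglongrightarrow> m"
      using tendsto_add[OF tendsto_const LIMSEQ_inverse_real_of_nat, of m] by simp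
  qed
  then obtain v where v: "v \<in> Mrad \<mu>" "norm_sq_mu \<mu> v = 2 * m" using conv[of w] w(1) by blast
  \<comment> \<open>The limit v is only known to minimize the norm; choosing the sign makes the
    \<open>Fprim\<close> term vanish identically.\<close>
  define \<uu> where "\<uu> = (\<lambda>x. - \<bar>v x\<bar>)"
  have \<uu>: "\<uu> \<in> Mrad \<mu>" "?E \<uu> = norm_sq_mu \<mu> \<uu> / 2" "norm_sq_mu \<mu> \<uu> \<le> 2 * m"
    using neg[OF v(1)] v(2) by (auto simp: \<uu>_def)
  have Em: "?E \<uu> = m" using m_le[OF \<uu>(1)] \<uu>(2,3) by linarith
  have pos: "0 < m"
  proof -
    obtain g where g: "sq_int lborel \<uu>" "sq_int lborel g" "weak_grad \<uu> g" using \<uu>(1) by (auto simp: Mrad_iff H1_iff)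
    \<comment> \<open>The kernel is at most 1, so the constraint keeps the L2 norm away from
      0.\<close>
    have "1 \<le> (nsq lborel \<uu>)\<^sup>2" using Dfun_sq_int(2)[OF g(1)] \<uu>(1) by (simp add: Mrad_iff)
    then have "nsq lborel \<uu> \<noteq> 0" by auto
    then have "0 < nsq lborel \<uu>" using nsq_nonneg[of lborel \<uu>] by linarith
    then have "0 < norm_sq_mu \<mu> \<uu>"
      using assms(1) by (simp add: norm_sq_mu_eq[OF g(2,3)] add_nonneg_pos)
    then show ?thesis using \<uu>(3) by linarith
  qed
  \<comment> \<open>|w| is symmetrized without lowering the energy, which may therefore exceed 1;
    the homogeneous bound absorbs this because m > 0.\<close>
  have glob: "m \<le> ?E w" if w: "w \<in> Mmu \<mu>" for w
  proof -
    obtain g where g: "sq_int lborel w" "sq_int lborel g" "weak_grad w g" using w by (auto simp: Mmu_iff H1_iff)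
    have osc: "osc d (\<lambda>x. \<bar>w x\<bar>) \<le> moment d * nsq lborel g" for d
      using osc_contraction[OF g(1) sq_int_abs(1)[OF g(1)] abs_triangle_ineq3, of d] osc_le_moment[OF g, of d] by linarith
    obtain V k where V: "sq_int lborel V" "sq_int lborel k" "weak_grad V k" "nsq lborel k \<le> nsq lborel g"
      "nsq lborel V = nsq lborel (\<lambda>x. \<bar>w x\<bar>)" "energy (\<lambda>x. \<bar>w x\<bar>) \<le> energy V" "radial V"
      using symmetrization[OF sq_int_abs(1)[OF g(1)] abs_ge_zero osc] by blast
    have EV: "1 \<le> energy V" using V(6) w by (simp add: energy_abs Mmu_iff)
    then have "2 * m * 1 \<le> 2 * m * sqrt (energy V)"
      using pos by (intro mult_left_mono) auto
    also have "\<dots> \<le> nsq lborel k + \<mu> * nsq lborel V"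
      using EV by (intro norm_sq_lower_bound[OF lb V(1-3,7)]) auto
    also have "\<dots> \<le> nsq lborel g + \<mu> * nsq lborel w"
      using V(4,5) by (simp add: nsq_def)
    also have "\<dots> = norm_sq_mu \<mu> w" by (simp add: norm_sq_mu_eq[OF g(2,3)])
    finally show ?thesis using E_ge[of w] by linarith
  qed
  have \<uu>M: "\<uu> \<in> Mmu \<mu>" using \<uu>(1) by (simp add: Mrad_def)
  have inf: "Inf (?E ` Mmu \<mu>) = m"
  proof (rule antisym)
    show "Inf (?E ` Mmu \<mu>) \<le> m"
      using cInf_lower[OF imageI[OF \<uu>M, of ?E] bdd] Em by simp
    show "m \<le> Inf (?E ` Mmu \<mu>)" using \<uu>M glob by (intro cInf_greatest) auto
  qed
  show ?thesis
  proof (intro conjI allI impI)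
    fix u :: "nat \<Rightarrow> R3 \<Rightarrow> real"
    assume "(\<forall>n. u n \<in> Mrad \<mu>) \<and> (\<lambda>n. ?E (u n)) \<longlonglongrightarrow> Inf (?E ` Mrad \<mu>)"
    then show "\<exists>r v. strict_mono r \<and> v \<in> Mrad \<mu> \<and> (\<lambda>n. norm_mu \<mu> (\<lambda>x. u (r n) x - v x)) \<longlonglongrightarrow> 0"
      using conv[of u] unfolding m_def by blast
  next
    show "\<exists>\<uu>. \<uu> \<in> Mrad \<mu> \<and> ?E \<uu> = Inf (?E ` Mrad \<mu>) \<and> Inf (?E ` Mrad \<mu>) = Inf (?E ` Mmu \<mu>) \<and>
        (\<forall>v\<in>Mmu \<mu>. ?E \<uu> \<le> ?E v) \<and> 0 < ?E \<uu> \<and> (AE x in lborel. \<uu> x \<le> 0) \<and> ?E \<uu> = norm_sq_mu \<mu> \<uu> / 2"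
      using \<uu>(1,2) Em inf glob pos by (intro exI[of _ \<uu>]) (auto simp: m_def \<uu>_def)
  qed
qed

end
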